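(* Let $G$ be a profinite group and let $p\in\pi(G)$. Assume that $\mathrm{Pr}(P_1,P_2)>0$ for every two Sylow $p$-subgroups $P_1,P_2$ of $G$. Then $O_{p,p'}(G)$ is open in $G$. Moreover, $O_p(G)$ is virtually abelian.
   Context: For a profinite group $G$, $\pi(G)$ is the set of primes dividing the (supernatural) order of $G$. Sylow $p$-subgroups are maximal pro-$p$ subgroups. For closed subgroups $H,K$ of $G$ with normalized Haar measures $\mu_H,\mu_K$, $\mathrm{Pr}(H,K)=(\mu_H\times\mu_K)(\{(x,y)\in H\times K\mid xy=yx\})$. $O_p(G)$ is the largest normal pro-$p$ subgroup of $G$, $O_{p'}(G)$ is the largest normal pro-$p'$ subgroup of $G$, and $O_{p,p'}(G)$ is the full preimage in $G$ of $O_{p'}(G/O_p(G))$. A profinite group is virtually abelian if it has an open abelian subgroup. *)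

theory Defs
  imports
    "HOL-Analysis.Analysis"
    "HOL-Algebra.Coset"
    "HOL-Computational_Algebra.Primes"
    "HOL-Library.Extended_Nat"
begin

definition topological_group :: "('a, 'b) monoid_scheme \<Rightarrow> 'a topology \<Rightarrow> bool" where
  "topological_group G T \<longleftrightarrow>
     group G \<and> topspace T = carrier G \<and>
     continuous_map (prod_topology T T) T (\<lambda>(x, y). x \<otimes>\<^bsub>G\<^esub> y) \<and>
     continuous_map T T (\<lambda>x. inv\<^bsub>G\<^esub> x)"

definition totally_disconnected_space :: "'a topology \<Rightarrow> bool" where
  "totally_disconnected_space T \<longleftrightarrow> (\<forall>C. connectedin T C \<longrightarrow> (\<exists>x. C \<subseteq> {x}))"

definition profinite_group :: "('a, 'b) monoid_scheme \<Rightarrow> 'a topology \<Rightarrow> bool" where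
  "profinite_group G T \<longleftrightarrow>
     topological_group G T \<and> compact_space T \<and> Hausdorff_space T \<and> totally_disconnected_space T"

definition open_normal_subgroups :: "('a, 'b) monoid_scheme \<Rightarrow> 'a topology \<Rightarrow> 'a set set" where
  "open_normal_subgroups G T = {N. N \<lhd> G \<and> openin T N}"

text \<open>A supernatural number is represented by its exponents \<open>nat \<Rightarrow> enat\<close>; only the values at
  primes are meaningful. The order of \<open>G\<close> is the least common multiple of the orders of the finite
  quotients by open normal subgroups.\<close>

definition supernatural_order :: "('a, 'b) monoid_scheme \<Rightarrow> 'a topology \<Rightarrow> nat \<Rightarrow> enat" where
  "supernatural_order G T q =
     (SUP N \<in> open_normal_subgroups G T. enat (multiplicity q (order (G Mod N))))"

definition prime_divisors_of_order :: "('a, 'b) monoid_scheme \<Rightarrow> 'a topology \<Rightarrow> nat set" where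
  "prime_divisors_of_order G T = {q. prime q \<and> supernatural_order G T q > 0}"

definition pro_p_group :: "nat \<Rightarrow> ('a, 'b) monoid_scheme \<Rightarrow> 'a topology \<Rightarrow> bool" where
  "pro_p_group p G T \<longleftrightarrow>
     profinite_group G T \<and> (\<forall>N \<in> open_normal_subgroups G T. \<exists>k. order (G Mod N) = p ^ k)"

definition pro_p'_group :: "nat \<Rightarrow> ('a, 'b) monoid_scheme \<Rightarrow> 'a topology \<Rightarrow> bool" where
  "pro_p'_group p G T \<longleftrightarrow>
     profinite_group G T \<and> (\<forall>N \<in> open_normal_subgroups G T. \<not> p dvd order (G Mod N))"

definition pro_p_subgroup :: "nat \<Rightarrow> ('a, 'b) monoid_scheme \<Rightarrow> 'a topology \<Rightarrow> 'a set \<Rightarrow> bool" where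
  "pro_p_subgroup p G T H \<longleftrightarrow>
     subgroup H G \<and> closedin T H \<and> pro_p_group p (G\<lparr>carrier := H\<rparr>) (subtopology T H)"

definition pro_p'_subgroup :: "nat \<Rightarrow> ('a, 'b) monoid_scheme \<Rightarrow> 'a topology \<Rightarrow> 'a set \<Rightarrow> bool" where
  "pro_p'_subgroup p G T H \<longleftrightarrow>
     subgroup H G \<and> closedin T H \<and> pro_p'_group p (G\<lparr>carrier := H\<rparr>) (subtopology T H)"

definition sylow_subgroup :: "nat \<Rightarrow> ('a, 'b) monoid_scheme \<Rightarrow> 'a topology \<Rightarrow> 'a set \<Rightarrow> bool" where
  "sylow_subgroup p G T P \<longleftrightarrow>
     pro_p_subgroup p G T P \<and> (\<forall>Q. pro_p_subgroup p G T Q \<and> P \<subseteq> Q \<longrightarrow> Q = P)"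

text \<open>\<open>GREATEST\<close> refers to inclusion of sets.\<close>

definition O_p :: "nat \<Rightarrow> ('a, 'b) monoid_scheme \<Rightarrow> 'a topology \<Rightarrow> 'a set" where
  "O_p p G T = (GREATEST N. N \<lhd> G \<and> pro_p_subgroup p G T N)"

definition O_p' :: "nat \<Rightarrow> ('a, 'b) monoid_scheme \<Rightarrow> 'a topology \<Rightarrow> 'a set" where
  "O_p' p G T = (GREATEST N. N \<lhd> G \<and> pro_p'_subgroup p G T N)"

text \<open>The quotient topology on \<open>G Mod N\<close>: elements are cosets, so the preimage in \<open>G\<close> of a set of
  cosets is its union (cf. \<open>quotient_map_coset_topology\<close>).\<close>

definition coset_topology :: "('a, 'b) monoid_scheme \<Rightarrow> 'a topology \<Rightarrow> 'a set \<Rightarrow> 'a set topology" where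
  "coset_topology G T N = topology (\<lambda>V. V \<subseteq> carrier (G Mod N) \<and> openin T (\<Union>V))"

text \<open>The full preimage in \<open>G\<close> of \<open>O_p' (G / O_p G)\<close>.\<close>

definition O_pp' :: "nat \<Rightarrow> ('a, 'b) monoid_scheme \<Rightarrow> 'a topology \<Rightarrow> 'a set" where
  "O_pp' p G T =
     {x \<in> carrier G. O_p p G T #>\<^bsub>G\<^esub> x \<in> O_p' p (G Mod O_p p G T) (coset_topology G T (O_p p G T))}"

definition virtually_abelian :: "('a, 'b) monoid_scheme \<Rightarrow> 'a topology \<Rightarrow> bool" where
  "virtually_abelian G T \<longleftrightarrow>
     (\<exists>A. subgroup A G \<and> openin T A \<and> comm_group (G\<lparr>carrier := A\<rparr>))"

definition borel_of :: "'a topology \<Rightarrow> 'a measure" where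
  "borel_of T = sigma (topspace T) {U. openin T U}"

definition regular_borel_measure :: "'a topology \<Rightarrow> 'a measure \<Rightarrow> bool" where
  "regular_borel_measure T M \<longleftrightarrow>
     sets M = sets (borel_of T) \<and>
     (\<forall>A \<in> sets M. emeasure M A = (INF U \<in> {U. openin T U \<and> A \<subseteq> U}. emeasure M U)) \<and>
     (\<forall>U. openin T U \<longrightarrow>
        emeasure M U = (SUP K \<in> {K. compactin T K \<and> K \<subseteq> U}. emeasure M K))"

definition is_normalized_haar_measure ::
    "('a, 'b) monoid_scheme \<Rightarrow> 'a topology \<Rightarrow> 'a measure \<Rightarrow> bool" where
  "is_normalized_haar_measure G T M \<longleftrightarrow>
     regular_borel_measure T M \<and> emeasure M (carrier G) = 1 \<and>
     (\<forall>x \<in> carrier G. \<forall>A \<in> sets M. emeasure M (x <#\<^bsub>G\<^esub> A) = emeasure M A)"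

text \<open>On a compact Hausdorff group there is exactly one such measure, so the choice is immaterial.\<close>

definition haar_measure :: "('a, 'b) monoid_scheme \<Rightarrow> 'a topology \<Rightarrow> 'a measure" where
  "haar_measure G T = (SOME M. is_normalized_haar_measure G T M)"

text \<open>The product of two regular Borel measures on compact Hausdorff spaces is taken as the (unique)
  regular Borel measure on the product space that is multiplicative on rectangles. It extends
  \<open>\<mu> \<Otimes>\<^sub>M \<nu>\<close>. The latter does not suffice: without second countability its domain need
  not contain all closed subsets of the product, and \<open>measure\<close> is \<open>0\<close> outside the domain.\<close>

definition radon_product ::
    "'a topology \<Rightarrow> 'b topology \<Rightarrow> 'a measure \<Rightarrow> 'b measure \<Rightarrow> ('a \<times> 'b) measure" where
  "radon_product S T \<mu> \<nu> =
     (SOME M. regular_borel_measure (prod_topology S T) M \<and>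
        (\<forall>A \<in> sets \<mu>. \<forall>B \<in> sets \<nu>. emeasure M (A \<times> B) = emeasure \<mu> A * emeasure \<nu> B))"

definition commuting_prob ::
    "('a, 'b) monoid_scheme \<Rightarrow> 'a topology \<Rightarrow> 'a set \<Rightarrow> 'a set \<Rightarrow> real" where
  "commuting_prob G T H K =
     measure
       (radon_product (subtopology T H) (subtopology T K)
          (haar_measure (G\<lparr>carrier := H\<rparr>) (subtopology T H))
          (haar_measure (G\<lparr>carrier := K\<rparr>) (subtopology T K)))
       {(x, y). x \<in> H \<and> y \<in> K \<and> x \<otimes>\<^bsub>G\<^esub> y = y \<otimes>\<^bsub>G\<^esub> x}"

lemma openin_coset_topology:
  fixes G (structure)
  assumes "N \<lhd> G"
  shows "openin (coset_topology G T N) V \<longleftrightarrow> V \<subseteq> carrier (G Mod N) \<and> openin T (\<Union>V)"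
proof -
  interpret normal N G by fact
  have int: "\<Union>(V \<inter> W) = \<Union>V \<inter> \<Union>W"
    if VW: "V \<subseteq> rcosets N" "W \<subseteq> rcosets N" for V W
  proof
    show "\<Union>V \<inter> \<Union>W \<subseteq> \<Union>(V \<inter> W)"
    proof
      fix x assume "x \<in> \<Union>V \<inter> \<Union>W"
      then obtain A B where AB: "A \<in> V" "x \<in> A" "B \<in> W" "x \<in> B" by blast
      have "A = B"
        using rcos_disjoint[OF subgroup_axioms] VW AB unfolding pairwise_def disjnt_def by blast
      with AB show "x \<in> \<Union>(V \<inter> W)" by blast
    qed
  qed blast
  have "istopology (\<lambda>V. V \<subseteq> carrier (G Mod N) \<and> openin T (\<Union>V))"
    unfolding istopology_def
  proof (intro conjI allI impI)
    fix V W
    assume "V \<subseteq> carrier (G Mod N) \<and> openin T (\<Union>V)" "W \<subseteq> carrier (G Mod N) \<and> openin T (\<Union>W)"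
    then show "V \<inter> W \<subseteq> carrier (G Mod N)" "openin T (\<Union>(V \<inter> W))"
      using int[of V W] by (auto simp: FactGroup_def)
  next
    fix \<V> assume V: "\<forall>V\<in>\<V>. V \<subseteq> carrier (G Mod N) \<and> openin T (\<Union>V)"
    then show "\<Union>\<V> \<subseteq> carrier (G Mod N)" by blast
    have "\<Union>(\<Union>\<V>) = \<Union>((\<lambda>V. \<Union>V) ` \<V>)" by blast
    then show "openin T (\<Union>(\<Union>\<V>))" using V by auto
  qed
  then show ?thesis by (simp add: coset_topology_def topology_inverse')
qed

lemma quotient_map_coset_topology:
  fixes G (structure)
  assumes "topological_group G T" "N \<lhd> G"
  shows "quotient_map T (coset_topology G T N) (\<lambda>x. N #>\<^bsub>G\<^esub> x)"
proof -
  interpret normal N G by fact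
  have T: "topspace T = carrier G" using assms by (simp add: topological_group_def)
  have un: "\<Union>V = {x \<in> carrier G. N #> x \<in> V}" if "V \<subseteq> rcosets N" for V
  proof
    show "\<Union>V \<subseteq> {x \<in> carrier G. N #> x \<in> V}"
    proof
      fix x assume "x \<in> \<Union>V"
      then obtain A where A: "A \<in> V" "x \<in> A" by blast
      with that obtain a where a: "a \<in> carrier G" "A = N #> a" by (auto simp: RCOSETS_def)
      then have "x \<in> carrier G" using A r_coset_subset_G[OF subset] by blast
      moreover have "N #> x = A" using repr_independence[OF _ a(1) subgroup_axioms] A a by simp
      ultimately show "x \<in> {x \<in> carrier G. N #> x \<in> V}" using A by simp
    qed
    show "{x \<in> carrier G. N #> x \<in> V} \<subseteq> \<Union>V" using rcos_self[OF _ subgroup_axioms] by blast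
  qed
  have car: "carrier (G Mod N) = rcosets N" by (simp add: FactGroup_def)
  have whole: "\<Union>(rcosets N) = carrier G" using rcosets_part_G[OF subgroup_axioms] .
  have top: "topspace (coset_topology G T N) = rcosets N"
  proof (rule antisym)
    show "topspace (coset_topology G T N) \<subseteq> rcosets N"
      using openin_topspace[of "coset_topology G T N"] unfolding openin_coset_topology[OF assms(2)] car
      by blast
    have "openin (coset_topology G T N) (rcosets N)"
      unfolding openin_coset_topology[OF assms(2)] car whole T[symmetric] by simp
    then show "rcosets N \<subseteq> topspace (coset_topology G T N)" by (rule openin_subset)
  qed
  show ?thesis
    unfolding quotient_map_def top T openin_coset_topology[OF assms(2)] car
    using un by (auto simp: RCOSETS_def)
qed

end

theory Submission
  imports Defs "HOL-Algebra.Sylow" "HOL-Algebra.Multiplicative_Group"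
begin

text \<open>
  Why the theorem holds. Write \<open>b\<^sup>g\<close> for \<open>g b g\<inverse>\<close>.

  Positive probability gives commuting open subgroups (\<open>commuting_open_subgroups\<close>). Let \<open>H\<close> and \<open>K\<close>
  be closed subgroups such that random elements of \<open>H\<close> and \<open>K\<close> commute with positive probability, in
  either order. Cutting the set of commuting pairs into sections yields a closed set \<open>Z\<close> of positive
  measure in \<open>H\<close> such that the centralisers in \<open>K\<close> of the elements of \<open>Z\<close> have measure bounded below;
  so the \<open>K\<close>-classes of these elements have bounded size. Finitely many translates of \<open>Z Z\<inverse>\<close> cover \<open>H\<close>, one of them
  has interior, and hence an open subgroup of \<open>H\<close> has \<open>K\<close>-classes of bounded size. With the same for
  \<open>K\<close>, the argument of B. H. Neumann for groups with bounded classes shows that the commutators of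
  suitable open subgroups of \<open>H\<close> and \<open>K\<close> form a finite set. An open normal subgroup of \<open>G\<close> that meets
  this set at most in \<open>1\<close> intersects \<open>H\<close> and \<open>K\<close> in subgroups that commute elementwise. For
  \<open>H = K = P\<close> a Sylow subgroup, \<open>P\<close> is virtually abelian, and so is its subgroup \<open>O\<^sub>p(G)\<close>.

  From commuting to normal (\<open>open_normal_Int_large_normal\<close>). Fix a Sylow subgroup \<open>P\<close>. By the above,
  for every \<open>g\<close> there is an open normal \<open>M\<close> such that \<open>P \<inter> M\<close> commutes with \<open>(P \<inter> M)\<^sup>g\<close>; a priori \<open>M\<close>
  depends on \<open>g\<close>. Suppose first that one \<open>N\<close> serves a whole coset \<open>g\<^sub>0 N\<close>. For \<open>g\<close> in this coset the
  product of \<open>P \<inter> N\<close> and \<open>(P \<inter> N)\<^sup>g\<close> is a pro-p subgroup of \<open>N\<close>; both factors have index prime to \<open>p\<close> in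
  every finite quotient of \<open>N\<close>; so they coincide. Thus \<open>N\<close> normalises \<open>P \<inter> N\<close>, and as \<open>P \<inter> N\<close> then is
  the only Sylow subgroup of \<open>N\<close>, it is normal in \<open>G\<close>. If no \<open>P \<inter> N\<close> is normal in \<open>G\<close>, every coset \<open>g N\<close>
  therefore contains a \<open>g'\<close> such that \<open>P \<inter> N\<close> and \<open>(P \<inter> N)\<^bsup>g'\<^esup>\<close> do not commute modulo some smaller
  \<open>N'\<close>. Iterating, as in the proof of Baire's theorem, one gets nested cosets; an element in all of
  them contradicts the existence of \<open>M\<close> for it.

  Conclusion (\<open>O_pp'_open\<close>). If \<open>P \<inter> N\<close> is normal in \<open>G\<close> it lies in \<open>O\<^sub>p(G)\<close>, so the image of \<open>N\<close> in
  \<open>G / O\<^sub>p(G)\<close> is a normal pro-p' subgroup. Hence \<open>N\<close> lies in the subgroup in question, which is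
  therefore open.

  The measures of the statement are chosen by \<open>SOME\<close>, so Haar measure on profinite groups and the
  regular product measure have to be constructed; both come from \<open>regular_extension\<close>, which extends a
  finitely additive function on the clopen sets to a regular Borel measure. Pro-p and pro-p'
  subgroups are handled together, through the exponents of their elements modulo open normal
  subgroups (\<open>pi_torsion\<close>).
\<close>

section \<open>Compactness and clopen sets\<close>

text \<open>The closed sets \<open>C - U\<close> form a downward directed family with empty intersection, so by compactness
  one of them is empty.\<close>

lemma directed_closed_subset_open:
  assumes "compact_space X" "\<C> \<noteq> {}" and clo: "\<And>C. C \<in> \<C> \<Longrightarrow> closedin X C"
    and dir: "\<And>A B. A \<in> \<C> \<Longrightarrow> B \<in> \<C> \<Longrightarrow> \<exists>C\<in>\<C>. C \<subseteq> A \<inter> B"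
    and "openin X U" and "\<Inter>\<C> \<subseteq> U"
  shows "\<exists>C\<in>\<C>. C \<subseteq> U"
proof (rule ccontr)
  assume neg: "\<not> (\<exists>C\<in>\<C>. C \<subseteq> U)"
  have low: "\<exists>C\<in>\<C>. C \<subseteq> \<Inter>\<F>" if "finite \<F>" "\<F> \<subseteq> \<C>" for \<F>
    using that
  proof (induction \<F>)
    case empty then show ?case using assms(2) by auto
  next
    case (insert A F)
    then obtain C where "C \<in> \<C>" "C \<subseteq> \<Inter>F" by auto
    moreover obtain D where "D \<in> \<C>" "D \<subseteq> A \<inter> C" using dir[of A C] insert calculation by auto
    ultimately show ?case by blast
  qed
  have "\<Inter>((\<lambda>C. C - U) ` \<C>) \<noteq> {}"
  proof (rule assms(1)[unfolded compact_space_fip, rule_format], intro conjI ballI allI impI)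
    fix C assume "C \<in> (\<lambda>C. C - U) ` \<C>"
    then show "closedin X C" using clo assms(5) by (auto intro: closedin_diff)
  next
    fix \<F> assume "finite \<F> \<and> \<F> \<subseteq> (\<lambda>C. C - U) ` \<C>"
    then obtain \<F>' where F': "finite \<F>'" "\<F>' \<subseteq> \<C>" "\<F> = (\<lambda>C. C - U) ` \<F>'"
      by (metis finite_subset_image)
    then obtain C where "C \<in> \<C>" "C \<subseteq> \<Inter>\<F>'" using low by blast
    then show "\<Inter>\<F> \<noteq> {}" using neg F'(3) by blast
  qed
  then show False using assms(2,6) by blast
qed

text \<open>The tube lemma as a statement on universal quantifiers. It makes stabilisers of clopen sets and
  intersections of all conjugates of an open subgroup open.\<close>

lemma openin_compact_forall:
  assumes "compactin X A" "continuous_map (prod_topology X Y) Z f" "openin Z U"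
  shows "openin Y {y \<in> topspace Y. \<forall>x\<in>A. f (x, y) \<in> U}"
proof (subst openin_subopen, safe)
  fix y assume y: "y \<in> topspace Y" "\<forall>x\<in>A. f (x, y) \<in> U"
  let ?W = "{z \<in> topspace (prod_topology X Y). f z \<in> U}"
  have "openin (prod_topology X Y) ?W" using assms openin_continuous_map_preimage by blast
  moreover have "A \<times> {y} \<subseteq> ?W" using y compactin_subset_topspace[OF assms(1)] by auto
  ultimately obtain V W where "openin X V" "openin Y W" "A \<subseteq> V" "y \<in> W" "V \<times> W \<subseteq> ?W"
    using tube_lemma_left[of X Y ?W A y] assms(1) y by blast
  then show "\<exists>W. openin Y W \<and> y \<in> W \<and> W \<subseteq> {y \<in> topspace Y. \<forall>x\<in>A. f (x, y) \<in> U}"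
    using openin_subset by (intro exI[of _ W]) blast
qed

text \<open>A compact component of a locally compact Hausdorff space can be separated by a clopen set from each
  disjoint closed set; here the components are points.\<close>

lemma clopen_base:
  assumes "compact_space X" "Hausdorff_space X" "totally_disconnected_space X" "openin X U" "x \<in> U"
  shows "\<exists>A. openin X A \<and> closedin X A \<and> x \<in> A \<and> A \<subseteq> U"
proof -
  have xT: "x \<in> topspace X" using assms openin_subset by blast
  have "connected_component_of_set X x = {x}"
    using assms(3) xT connectedin_connected_component_of[of X x] connected_component_of_refl[of X x]
    unfolding totally_disconnected_space_def by blast
  then have "{x} \<in> connected_components_of X"
    using xT by (force simp: connected_components_of_def)
  then have "separated_between X {x} (topspace X - U)"
    using separated_between_compact_connected_component[of X "{x}" "topspace X - U"] assms xT
      closedin_diff[OF closedin_topspace assms(4)]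
    by (simp add: compact_imp_locally_compact_space disjnt_def)
  then obtain A B where AB: "openin X A" "openin X B" "A \<union> B = topspace X" "disjnt A B" "{x} \<subseteq> A" "topspace X - U \<subseteq> B"
    unfolding separated_between_def by metis
  then have "A = topspace X - B" "A \<subseteq> U" using openin_subset[OF AB(1)] by (auto simp: disjnt_def)
  then show ?thesis using AB by (intro exI[of _ A]) auto
qed


section \<open>Open normal subgroups of a profinite group\<close>

lemma (in group) inv_cancel [simp]:
  assumes "x \<in> carrier G" "y \<in> carrier G"
  shows "inv x \<otimes> (x \<otimes> y) = y" "x \<otimes> (inv x \<otimes> y) = y"
  using assms by (simp_all add: m_assoc[symmetric])

locale profinite = group G for G :: "('a, 'b) monoid_scheme" (structure) +
  fixes T :: "'a topology"
  assumes profinite: "profinite_group G T"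
begin

abbreviation ONS :: "'a set set" where "ONS \<equiv> open_normal_subgroups G T"

lemma topspace [simp]: "topspace T = carrier G"
  using profinite by (simp add: profinite_group_def topological_group_def)

lemma compact: "compact_space T" and Hausdorff: "Hausdorff_space T"
  and tot_disc: "totally_disconnected_space T" and top_group: "topological_group G T"
  using profinite by (simp_all add: profinite_group_def)

lemma closed_compact: "closedin T A \<Longrightarrow> compactin T A"
  using compact closedin_compact_space by blast

lemma compact_closed: "compactin T A \<Longrightarrow> closedin T A"
  using Hausdorff compactin_imp_closedin by blast

lemma closed_carrier: "closedin T A \<Longrightarrow> A \<subseteq> carrier G"
  using closedin_subset[of T A] by simp

lemma open_carrier: "openin T A \<Longrightarrow> A \<subseteq> carrier G"
  using openin_subset[of T A] by simp

lemma continuous_mult: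
  assumes "continuous_map X T f" "continuous_map X T g"
  shows "continuous_map X T (\<lambda>x. f x \<otimes> g x)"
proof -
  have "continuous_map X (prod_topology T T) (\<lambda>x. (f x, g x))"
    using assms by (simp add: continuous_map_pairedI)
  moreover have "continuous_map (prod_topology T T) T (\<lambda>(x, y). x \<otimes> y)"
    using top_group by (simp add: topological_group_def)
  ultimately have "continuous_map X T ((\<lambda>(x, y). x \<otimes> y) \<circ> (\<lambda>x. (f x, g x)))"
    by (rule continuous_map_compose)
  then show ?thesis by (simp add: o_def)
qed

lemma continuous_inv:
  assumes "continuous_map X T f"
  shows "continuous_map X T (\<lambda>x. inv (f x))"
proof -
  have "continuous_map T T (\<lambda>x. inv x)"
    using top_group by (simp add: topological_group_def)
  from continuous_map_compose[OF assms this] show ?thesis by (simp add: o_def)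
qed

lemma continuous_constant: "a \<in> carrier G \<Longrightarrow> continuous_map X T (\<lambda>x. a)"
  by (simp add: continuous_map_const)

lemma continuous_ident: "continuous_map T T (\<lambda>x. x)"
  using continuous_map_id by (simp add: id_def)

lemmas continuous_group = continuous_mult continuous_inv continuous_constant continuous_ident
  continuous_map_fst[of T T, simplified] continuous_map_snd[of T T, simplified]

lemma open_preimage:
  assumes "continuous_map T T f" "openin T U" shows "openin T {x \<in> carrier G. f x \<in> U}"
  using openin_continuous_map_preimage[OF assms] by simp

lemma closed_preimage:
  assumes "continuous_map T T f" "closedin T U" shows "closedin T {x \<in> carrier G. f x \<in> U}"
  using closedin_continuous_map_preimage[OF assms] by simp

lemma ONS_D:
  assumes "N \<in> ONS"
  shows "N \<lhd> G" "subgroup N G" "openin T N" "N \<subseteq> carrier G" "\<one> \<in> N"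
proof -
  show "N \<lhd> G" "openin T N" using assms by (auto simp: open_normal_subgroups_def)
  then show "subgroup N G" by (simp add: normal_imp_subgroup)
  then show "N \<subseteq> carrier G" "\<one> \<in> N" by (simp_all add: subgroup.subset subgroup.one_closed)
qed

lemma ONS_conj: "N \<in> ONS \<Longrightarrow> x \<in> N \<Longrightarrow> g \<in> carrier G \<Longrightarrow> g \<otimes> x \<otimes> inv g \<in> N"
  using normal.inv_op_closed2[OF ONS_D(1)] by blast

lemma ONS_carrier: "carrier G \<in> ONS"
  using openin_topspace[of T] by (simp add: open_normal_subgroups_def normal_inv_iff subgroup_self)

lemma normal_Int: "A \<lhd> G \<Longrightarrow> B \<lhd> G \<Longrightarrow> A \<inter> B \<lhd> G"
  by (simp add: normal_inv_iff subgroups_Inter_pair)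

lemma ONS_Int:
  "A \<in> ONS \<Longrightarrow> B \<in> ONS \<Longrightarrow> A \<inter> B \<in> ONS"
  by (simp add: open_normal_subgroups_def normal_Int openin_Int)

lemma open_translate:
  assumes "openin T U" "a \<in> carrier G" shows "openin T (a <# U)"
proof -
  have "a <# U = {x \<in> carrier G. inv a \<otimes> x \<in> U}"
  proof safe
    fix x assume "x \<in> a <# U"
    then obtain u where "u \<in> U" "x = a \<otimes> u" by (auto simp: l_coset_def)
    then show "x \<in> carrier G" "inv a \<otimes> x \<in> U" using assms open_carrier[OF assms(1)] by (auto)
  next
    fix x assume "x \<in> carrier G" "inv a \<otimes> x \<in> U"
    then show "x \<in> a <# U" using assms by (auto simp: l_coset_def intro!: bexI[of _ "inv a \<otimes> x"])
  qed
  moreover have "continuous_map T T (\<lambda>x. inv a \<otimes> x)" using assms by (intro continuous_group) auto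
  ultimately show ?thesis using open_preimage assms(1) by simp
qed

lemma open_r_coset:
  assumes "openin T U" "a \<in> carrier G" shows "openin T (U #> a)"
proof -
  have "U #> a = {x \<in> carrier G. x \<otimes> inv a \<in> U}"
  proof safe
    fix x assume "x \<in> U #> a"
    then obtain u where "u \<in> U" "x = u \<otimes> a" by (auto simp: r_coset_def)
    then show "x \<in> carrier G" "x \<otimes> inv a \<in> U" using assms open_carrier[OF assms(1)] by (auto simp: m_assoc)
  next
    fix x assume "x \<in> carrier G" "x \<otimes> inv a \<in> U"
    then show "x \<in> U #> a" using assms by (auto simp: r_coset_def m_assoc intro!: bexI[of _ "x \<otimes> inv a"])
  qed
  moreover have "continuous_map T T (\<lambda>x. x \<otimes> inv a)" using assms by (intro continuous_group) auto
  ultimately show ?thesis using open_preimage assms(1) by simp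
qed

text \<open>The right translations that preserve a clopen neighbourhood \<open>W\<close> of \<open>1\<close> form a subgroup of \<open>W\<close>, and the
  intersection of its conjugates is normal. Both are open because \<open>W\<close> and \<open>G\<close> are compact.\<close>

lemma ONS_base:
  assumes "openin T U" "\<one> \<in> U"
  shows "\<exists>N \<in> ONS. N \<subseteq> U"
proof -
  obtain W where W: "openin T W" "closedin T W" "\<one> \<in> W" "W \<subseteq> U"
    using clopen_base[OF compact Hausdorff tot_disc assms] by blast
  have Wc: "W \<subseteq> carrier G" using W open_carrier by blast
  define H1 where "H1 = {x \<in> carrier G. \<forall>w\<in>W. w \<otimes> x \<in> W}"
  define H2 where "H2 = {x \<in> carrier G. \<forall>w\<in>W. w \<otimes> inv x \<in> W}"
  define H where "H = H1 \<inter> H2"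
  have "continuous_map (prod_topology T T) T (\<lambda>z. fst z \<otimes> snd z)"
    "continuous_map (prod_topology T T) T (\<lambda>z. fst z \<otimes> inv (snd z))"
    by (intro continuous_group)+
  then have "openin T H1" "openin T H2"
    using openin_compact_forall[OF closed_compact[OF W(2)] _ W(1)] unfolding H1_def H2_def by fastforce+
  then have oH: "openin T H" by (auto simp: H_def)
  have sH: "subgroup H G"
  proof (rule subgroupI)
    show "H \<subseteq> carrier G" by (auto simp: H_def H1_def)
    have "\<one> \<in> H" using Wc by (auto simp: H_def H1_def H2_def)
    then show "H \<noteq> {}" by blast
  next
    fix a assume "a \<in> H" then show "inv a \<in> H" by (auto simp: H_def H1_def H2_def)
  next
    fix a b assume ab: "a \<in> H" "b \<in> H"
    then have c: "a \<in> carrier G" "b \<in> carrier G" by (auto simp: H_def H1_def)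
    have "w \<otimes> (a \<otimes> b) \<in> W" "w \<otimes> inv (a \<otimes> b) \<in> W" if "w \<in> W" for w
    proof -
      have w: "w \<in> carrier G" using that Wc by auto
      have "(w \<otimes> a) \<otimes> b \<in> W" "(w \<otimes> inv b) \<otimes> inv a \<in> W" using that ab by (auto simp: H_def H1_def H2_def)
      then show "w \<otimes> (a \<otimes> b) \<in> W" "w \<otimes> inv (a \<otimes> b) \<in> W" using w c by (simp_all add: m_assoc inv_mult_group)
    qed
    then show "a \<otimes> b \<in> H" using c by (auto simp: H_def H1_def H2_def)
  qed
  have HW: "H \<subseteq> W" using W(3) by (auto simp: H_def H1_def)
  define N where "N = {x \<in> carrier G. \<forall>g\<in>carrier G. g \<otimes> x \<otimes> inv g \<in> H}"
  have "continuous_map (prod_topology T T) T (\<lambda>z. fst z \<otimes> snd z \<otimes> inv (fst z))"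
    by (intro continuous_group)
  then have oN: "openin T N"
    using openin_compact_forall[OF _ _ oH, of T "carrier G"] closed_compact[of "carrier G"] closedin_topspace[of T] unfolding N_def by fastforce
  have sN: "subgroup N G"
  proof (rule subgroupI)
    show "N \<subseteq> carrier G" by (auto simp: N_def)
    have "\<one> \<in> N" using subgroup.one_closed[OF sH] by (auto simp: N_def)
    then show "N \<noteq> {}" by blast
  next
    fix a assume a: "a \<in> N"
    have "g \<otimes> inv a \<otimes> inv g \<in> H" if "g \<in> carrier G" for g
    proof -
      have "inv (g \<otimes> a \<otimes> inv g) \<in> H" using a that subgroup.m_inv_closed[OF sH] by (auto simp: N_def)
      then show ?thesis using a that by (simp add: N_def inv_mult_group m_assoc)
    qed
    then show "inv a \<in> N" using a by (auto simp: N_def)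
  next
    fix a b assume ab: "a \<in> N" "b \<in> N"
    have "g \<otimes> (a \<otimes> b) \<otimes> inv g \<in> H" if "g \<in> carrier G" for g
    proof -
      have "(g \<otimes> a \<otimes> inv g) \<otimes> (g \<otimes> b \<otimes> inv g) \<in> H" using ab that subgroup.m_closed[OF sH] by (auto simp: N_def)
      moreover have "(g \<otimes> a \<otimes> inv g) \<otimes> (g \<otimes> b \<otimes> inv g) = g \<otimes> (a \<otimes> b) \<otimes> inv g"
        using ab that by (simp add: N_def m_assoc)
      ultimately show ?thesis by simp
    qed
    then show "a \<otimes> b \<in> N" using ab by (auto simp: N_def)
  qed
  have "N \<lhd> G"
    unfolding normal_inv_iff
  proof (intro conjI ballI sN)
    fix x h assume x: "x \<in> carrier G" "h \<in> N"
    have "g \<otimes> (x \<otimes> h \<otimes> inv x) \<otimes> inv g \<in> H" if "g \<in> carrier G" for g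
    proof -
      have "(g \<otimes> x) \<otimes> h \<otimes> inv (g \<otimes> x) \<in> H" using x that by (auto simp: N_def)
      then show ?thesis using x that by (simp add: N_def m_assoc inv_mult_group)
    qed
    then show "x \<otimes> h \<otimes> inv x \<in> N" using x by (auto simp: N_def)
  qed
  moreover have "N \<subseteq> H"
  proof
    fix x assume "x \<in> N"
    then have "x \<in> carrier G" "\<one> \<otimes> x \<otimes> inv \<one> \<in> H" unfolding N_def by blast+
    then show "x \<in> H" by simp
  qed
  ultimately show ?thesis using oN HW W(4) by (auto simp: open_normal_subgroups_def intro!: bexI[of _ N])
qed

text \<open>Closed sets are the intersections of their saturations by open normal subgroups.\<close>

lemma ONS_avoid_closed:
  assumes "closedin T C" "x \<in> carrier G" "x \<notin> C"
  shows "\<exists>N \<in> ONS. \<forall>n\<in>N. n \<otimes> x \<notin> C"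
proof -
  have o: "openin T (carrier G - C)" using openin_diff[OF openin_topspace assms(1)] by simp
  have "continuous_map T T (\<lambda>n. n \<otimes> x)" using assms by (intro continuous_group)
  from open_preimage[OF this o] obtain N where "N \<in> ONS"
    "N \<subseteq> {n \<in> carrier G. n \<otimes> x \<in> carrier G - C}" using ONS_base assms by fastforce
  then show ?thesis by blast
qed

lemma open_subgroup:
  assumes "subgroup H G" "N \<in> ONS" "N \<subseteq> H"
  shows "openin T H"
proof (subst openin_subopen, safe)
  fix x assume x: "x \<in> H"
  have "x \<in> carrier G" using x subgroup.subset[OF assms(1)] by auto
  moreover have "x \<in> N #> x" using rcos_self[OF calculation ONS_D(2)[OF assms(2)]] .
  moreover have "N #> x \<subseteq> H" using x assms(3) subgroup.m_closed[OF assms(1)] by (auto simp: r_coset_def)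
  ultimately show "\<exists>U. openin T U \<and> x \<in> U \<and> U \<subseteq> H"
    using open_r_coset[OF ONS_D(3)[OF assms(2)]] by blast
qed

end

section \<open>Torsion and orders of finite groups\<close>

text \<open>For \<open>\<pi> = {p}\<close> these are the powers of \<open>p\<close>, for \<open>\<pi> = - {p}\<close> the numbers prime to \<open>p\<close>.\<close>

definition pi_number :: "nat set \<Rightarrow> nat \<Rightarrow> bool" where
  "pi_number \<pi> n \<longleftrightarrow> n > 0 \<and> (\<forall>q. prime q \<and> q dvd n \<longrightarrow> q \<in> \<pi>)"

lemma pi_number_1 [simp]: "pi_number \<pi> (Suc 0)"
  by (auto simp: pi_number_def dest: prime_nat_iff[THEN iffD1])

lemma pi_number_mult: "pi_number \<pi> (a * b) \<longleftrightarrow> pi_number \<pi> a \<and> pi_number \<pi> b"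
  by (auto simp: pi_number_def prime_dvd_mult_iff)

lemma pi_number_singleton:
  assumes "prime p" shows "pi_number {p} n \<longleftrightarrow> (\<exists>k. n = p ^ k)"
proof
  assume n: "pi_number {p} n"
  then have "n \<noteq> 0" by (simp add: pi_number_def)
  then obtain m where m: "n = p ^ multiplicity p n * m" "\<not> p dvd m"
    using multiplicity_decompose'[of n p] assms by (metis not_prime_unit)
  have "m = 1"
  proof (rule ccontr)
    assume "m \<noteq> 1"
    then obtain q where "prime q" "q dvd m" using prime_factor_nat by blast
    then have "q = p" using n m(1) by (metis dvd_mult pi_number_def singletonD)
    then show False using \<open>q dvd m\<close> m(2) by simp
  qed
  then show "\<exists>k. n = p ^ k" using m(1) by auto
next
  assume "\<exists>k. n = p ^ k"
  then show "pi_number {p} n"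
    using assms by (auto simp: pi_number_def prime_gt_0_nat dest: prime_dvd_power primes_dvd_imp_eq)
qed

lemma pi_number_compl:
  assumes "prime p" shows "pi_number (- {p}) n \<longleftrightarrow> \<not> p dvd n"
  using assms by (cases "n = 0") (auto simp: pi_number_def)

text \<open>Cauchy's theorem: Sylow's theorem for exponent one yields a subgroup of order \<open>q\<close>.\<close>

lemma cauchy_prime_order:
  assumes "group Q" "finite (carrier Q)" "prime q" "q dvd order Q"
  shows "\<exists>x\<in>carrier Q. x \<noteq> \<one>\<^bsub>Q\<^esub> \<and> x [^]\<^bsub>Q\<^esub> q = \<one>\<^bsub>Q\<^esub>"
proof -
  interpret group Q by fact
  obtain m where "order Q = q ^ 1 * m" using assms(4) by auto
  from sylow_thm[OF assms(3,1) this assms(2)] obtain H where H: "subgroup H Q" "card H = q" by auto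
  have "H \<noteq> {\<one>\<^bsub>Q\<^esub>}" using H(2) assms(3) by auto
  then obtain x where x: "x \<in> H" "x \<noteq> \<one>\<^bsub>Q\<^esub>" using subgroup.one_closed[OF H(1)] by blast
  interpret H: group "Q\<lparr>carrier := H\<rparr>" using subgroup_imp_group[OF H(1)] .
  have "x [^]\<^bsub>Q\<lparr>carrier := H\<rparr>\<^esub> q = \<one>\<^bsub>Q\<^esub>"
    using H.pow_order_eq_1[of x] x H(2) by (simp add: order_def)
  then have "x [^]\<^bsub>Q\<^esub> q = \<one>\<^bsub>Q\<^esub>" by (simp add: nat_pow_consistent[symmetric])
  then show ?thesis using x subgroup.mem_carrier[OF H(1)] by blast
qed

text \<open>By Cauchy each prime divisor of the order is the order of an element; so the order is read off from
  the exponents of the elements.\<close>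

lemma pi_torsion_iff_order:
  assumes "group Q" "finite (carrier Q)"
  shows "(\<forall>x\<in>carrier Q. \<exists>e. pi_number \<pi> e \<and> x [^]\<^bsub>Q\<^esub> e = \<one>\<^bsub>Q\<^esub>) \<longleftrightarrow> pi_number \<pi> (order Q)"
proof
  interpret group Q by fact
  assume tors: "\<forall>x\<in>carrier Q. \<exists>e. pi_number \<pi> e \<and> x [^]\<^bsub>Q\<^esub> e = \<one>\<^bsub>Q\<^esub>"
  have "q \<in> \<pi>" if q: "prime q" "q dvd order Q" for q
  proof -
    obtain x where x: "x \<in> carrier Q" "x \<noteq> \<one>\<^bsub>Q\<^esub>" "x [^]\<^bsub>Q\<^esub> q = \<one>\<^bsub>Q\<^esub>"
      using cauchy_prime_order[OF assms q] by blast
    have "ord x \<noteq> 1" using x(1,2) ord_eq_1 by blast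
    then have "ord x = q" using x q(1) by (auto simp: pow_eq_id prime_nat_iff)
    moreover obtain e where "pi_number \<pi> e" "x [^]\<^bsub>Q\<^esub> e = \<one>\<^bsub>Q\<^esub>" using tors x by blast
    ultimately show ?thesis using x(1) q(1) by (simp add: pow_eq_id pi_number_def)
  qed
  then show "pi_number \<pi> (order Q)" using assms(2) order_gt_0_iff_finite by (simp add: pi_number_def)
next
  interpret group Q by fact
  assume "pi_number \<pi> (order Q)"
  then show "\<forall>x\<in>carrier Q. \<exists>e. pi_number \<pi> e \<and> x [^]\<^bsub>Q\<^esub> e = \<one>\<^bsub>Q\<^esub>"
    using pow_order_eq_1 by blast
qed

lemma card_image_eq_if_same_kernel:
  assumes "\<And>x y. x \<in> A \<Longrightarrow> y \<in> A \<Longrightarrow> f x = f y \<longleftrightarrow> g x = g y"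
  shows "card (f ` A) = card (g ` A)"
proof -
  define h where "h = (\<lambda>z. g (SOME x. x \<in> A \<and> f x = z))"
  have h: "h (f x) = g x" if "x \<in> A" for x
  proof -
    have "(SOME y. y \<in> A \<and> f y = f x) \<in> A \<and> f (SOME y. y \<in> A \<and> f y = f x) = f x"
      by (rule someI[of _ x]) (use that in simp)
    then show ?thesis using assms that unfolding h_def by blast
  qed
  have "inj_on h (f ` A)" using h assms by (auto simp: inj_on_def)
  moreover have "h ` f ` A = g ` A" using h by (auto simp: image_iff)
  ultimately show ?thesis by (metis card_image)
qed

section \<open>Counting cosets\<close>

context group
begin

text \<open>As \<open>D\<close> need not be contained in \<open>B\<close>, this is \<open>|B : B \<inter> D|\<close> for subgroups, without mention of the
  intersection; for a set \<open>B\<close> that is a union of cosets of \<open>D\<close> it counts these cosets.\<close>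

definition rel_index :: "'a set \<Rightarrow> 'a set \<Rightarrow> nat" where
  "rel_index B D = card ((\<lambda>b. D #> b) ` B)"

lemma r_coset_eq_iff:
  assumes "subgroup D G" "x \<in> carrier G" "y \<in> carrier G"
  shows "D #> x = D #> y \<longleftrightarrow> x \<otimes> inv y \<in> D"
  using assms subgroup.rcos_module[OF assms(1) is_group assms(3,2)] repr_independence[of x D y]
    rcos_self[OF assms(2,1)] by (metis)

lemma rcosets_image: "rcosets D = (\<lambda>b. D #> b) ` carrier G"
  by (auto simp: RCOSETS_def)

lemma finite_image_coset:
  "finite (rcosets D) \<Longrightarrow> B \<subseteq> carrier G \<Longrightarrow> finite ((\<lambda>b. D #> b) ` B)"
  by (metis finite_subset image_mono rcosets_image)

lemma r_coset_subgroup_mult: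
  assumes "subgroup D G" "subgroup C G" "D \<subseteq> C" "a \<in> carrier G"
  shows "C <#> (D #> a) = C #> a"
proof
  show "C <#> (D #> a) \<subseteq> C #> a"
  proof
    fix z assume "z \<in> C <#> (D #> a)"
    then obtain c d where "c \<in> C" "d \<in> D" "z = c \<otimes> (d \<otimes> a)" by (auto simp: set_mult_def r_coset_def)
    then show "z \<in> C #> a" using assms subgroup.m_closed[OF assms(2), of c d] subgroup.mem_carrier[OF assms(2)]
      by (auto simp: r_coset_def m_assoc[symmetric] intro!: bexI[of _ "c \<otimes> d"])
  qed
  show "C #> a \<subseteq> C <#> (D #> a)"
  proof
    fix z assume "z \<in> C #> a"
    then obtain c where "c \<in> C" "z = c \<otimes> a" by (auto simp: r_coset_def)
    then show "z \<in> C <#> (D #> a)" using rcos_self[OF assms(4,1)] unfolding set_mult_def by blast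
  qed
qed

lemma finite_rcosets_mono:
  assumes "subgroup D G" "subgroup C G" "D \<subseteq> C" "finite (rcosets D)"
  shows "finite (rcosets C)"
proof -
  have "rcosets C \<subseteq> (\<lambda>X. C <#> X) ` (rcosets D)"
    using r_coset_subgroup_mult[OF assms(1-3)] by (fastforce simp: rcosets_image)
  then show ?thesis using assms(4) finite_surj by blast
qed

text \<open>The map \<open>D a \<mapsto> C a\<close> from the \<open>D\<close>-cosets in \<open>A\<close> to the \<open>C\<close>-cosets in \<open>A\<close> has all fibres of size \<open>|C : D|\<close>.
  Taking for \<open>A\<close> any union of \<open>C\<close>-cosets serves both the index of subgroups and the content of clopen
  sets from which Haar measure is built.\<close>

lemma rel_index_tower:
  assumes "subgroup D G" "subgroup C G" "D \<subseteq> C" "finite (rcosets D)"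
    "A \<subseteq> carrier G" "\<And>c a. c \<in> C \<Longrightarrow> a \<in> A \<Longrightarrow> c \<otimes> a \<in> A"
  shows "rel_index A D = rel_index A C * rel_index C D"
proof -
  let ?f = "\<lambda>b. D #> b"
  have Cc: "C \<subseteq> carrier G" using subgroup.subset[OF assms(2)] .
  have fC: "finite (rcosets C)" using finite_rcosets_mono assms by blast
  have sub: "C #> a \<subseteq> A" if "a \<in> A" for a using assms(6) that by (auto simp: r_coset_def)
  have eq: "?f ` A = (\<Union>Y\<in>(\<lambda>a. C #> a) ` A. ?f ` Y)"
  proof
    show "?f ` A \<subseteq> (\<Union>Y\<in>(\<lambda>a. C #> a) ` A. ?f ` Y)"
    proof clarify
      fix a assume a: "a \<in> A"
      then have "a \<in> C #> a" using rcos_self[OF _ assms(2)] assms(5) by blast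
      with a show "?f a \<in> (\<Union>Y\<in>(\<lambda>a. C #> a) ` A. ?f ` Y)" by blast
    qed
    show "(\<Union>Y\<in>(\<lambda>a. C #> a) ` A. ?f ` Y) \<subseteq> ?f ` A" using sub by blast
  qed
  have crd: "card (?f ` (C #> a)) = rel_index C D" if a: "a \<in> carrier G" for a
  proof -
    have "C #> a = (\<lambda>c. c \<otimes> a) ` C" by (auto simp: r_coset_def)
    then have "card (?f ` (C #> a)) = card ((\<lambda>c. D #> (c \<otimes> a)) ` C)" by (simp add: image_image)
    also have "\<dots> = card (?f ` C)"
    proof (rule card_image_eq_if_same_kernel)
      fix x y assume "x \<in> C" "y \<in> C"
      then have c: "x \<in> carrier G" "y \<in> carrier G" using Cc by auto
      have "x \<otimes> a \<otimes> inv (y \<otimes> a) = x \<otimes> inv y" using a c by (simp add: inv_mult_group m_assoc)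
      then show "D #> (x \<otimes> a) = D #> (y \<otimes> a) \<longleftrightarrow> D #> x = D #> y"
        using a c assms(1) by (simp add: r_coset_eq_iff)
    qed
    finally show ?thesis by (simp add: rel_index_def)
  qed
  have disj: "?f ` Y \<inter> ?f ` Z = {}" if Y: "Y \<in> (\<lambda>a. C #> a) ` A" and Z: "Z \<in> (\<lambda>a. C #> a) ` A" and ne: "Y \<noteq> Z" for Y Z
  proof (rule ccontr)
    assume "?f ` Y \<inter> ?f ` Z \<noteq> {}"
    then obtain y z where yz: "y \<in> Y" "z \<in> Z" "?f y = ?f z" by blast
    obtain a b where ab: "a \<in> A" "b \<in> A" "Y = C #> a" "Z = C #> b" using Y Z by blast
    have c: "a \<in> carrier G" "b \<in> carrier G" "y \<in> carrier G" "z \<in> carrier G"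
      using ab yz sub assms(5) by blast+
    have "y \<otimes> inv z \<in> C" using r_coset_eq_iff[OF assms(1)] c yz(3) assms(3) by blast
    then have "C #> y = C #> z" using r_coset_eq_iff[OF assms(2)] c by blast
    moreover have "C #> y = C #> a" "C #> z = C #> b"
      using repr_independence[of y C a] repr_independence[of z C b] assms(2) c ab yz by auto
    ultimately show False using ne ab by simp
  qed
  have "card (?f ` A) = (\<Sum>Y\<in>(\<lambda>a. C #> a) ` A. card (?f ` Y))"
    unfolding eq
  proof (rule card_UN_disjoint)
    show "finite ((\<lambda>a. C #> a) ` A)" using finite_image_coset[OF fC assms(5)] .
    show "\<forall>Y\<in>(\<lambda>a. C #> a) ` A. finite (?f ` Y)"
      using sub assms(5) finite_image_coset[OF assms(4)] by blast
  qed (use disj in blast)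
  also have "\<dots> = (\<Sum>Y\<in>(\<lambda>a. C #> a) ` A. rel_index C D)"
    using crd assms(5) by (intro sum.cong) auto
  finally show ?thesis by (simp add: rel_index_def)
qed

lemma rel_index_Int:
  assumes "subgroup B G" "subgroup D G"
  shows "rel_index B (B \<inter> D) = rel_index B D"
  unfolding rel_index_def
proof (rule card_image_eq_if_same_kernel)
  fix x y assume xy: "x \<in> B" "y \<in> B"
  then have c: "x \<in> carrier G" "y \<in> carrier G" using subgroup.subset[OF assms(1)] by auto
  have "x \<otimes> inv y \<in> B" using xy assms(1) by (simp add: subgroup.m_closed subgroup.m_inv_closed)
  then show "B \<inter> D #> x = B \<inter> D #> y \<longleftrightarrow> D #> x = D #> y"
    using c assms by (simp add: r_coset_eq_iff subgroups_Inter_pair)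
qed

text \<open>Multiplying by elements of \<open>D\<close> on the left does not change right cosets of \<open>D\<close>. With
  \<open>rel_index_Int\<close> this replaces the second isomorphism theorem.\<close>

lemma rel_index_set_mult:
  assumes "subgroup D G" "B \<subseteq> carrier G"
  shows "rel_index (D <#> B) D = rel_index B D"
proof -
  have "D #> (d \<otimes> b) = D #> b" if "d \<in> D" "b \<in> B" for d b
  proof -
    have "d \<in> carrier G" "b \<in> carrier G" using that assms subgroup.mem_carrier by auto
    then show ?thesis using that assms by (simp add: r_coset_eq_iff m_assoc)
  qed
  moreover have "b \<in> D <#> B" if "b \<in> B" for b
    using that assms subgroup.one_closed[OF assms(1)] by (force simp: set_mult_def)
  ultimately have "(\<lambda>b. D #> b) ` (D <#> B) = (\<lambda>b. D #> b) ` B"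
    by (fastforce simp: set_mult_def image_iff)
  then show ?thesis by (simp add: rel_index_def)
qed

lemma rel_index_eq_1:
  assumes "subgroup B G" "subgroup D G" "rel_index B D = 1"
  shows "B \<subseteq> D"
proof
  fix x assume x: "x \<in> B"
  then have xc: "x \<in> carrier G" using subgroup.mem_carrier[OF assms(1)] by simp
  obtain X where X: "(\<lambda>b. D #> b) ` B = {X}" using assms(3) by (auto simp: rel_index_def card_1_singleton_iff)
  have "D #> x \<in> (\<lambda>b. D #> b) ` B" "D #> \<one> \<in> (\<lambda>b. D #> b) ` B" using x subgroup.one_closed[OF assms(1)] by auto
  then have "D #> x = D #> \<one>" using X by simp
  then show "x \<in> D" using r_coset_eq_iff[OF assms(2) xc one_closed] xc by simp
qed

lemma order_subgroup_Mod: "order ((G\<lparr>carrier := H\<rparr>) Mod L) = rel_index H L"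
proof -
  have "carrier ((G\<lparr>carrier := H\<rparr>) Mod L) = (\<lambda>b. L #> b) ` H"
    by (auto simp: FactGroup_def RCOSETS_def r_coset_def)
  then show ?thesis by (simp add: order_def rel_index_def)
qed

lemma subgroup_nat_pow_closed:
  assumes "subgroup H G" "x \<in> H" shows "x [^] (e::nat) \<in> H"
  using assms by (induction e) (auto simp: subgroup.one_closed subgroup.m_closed)

lemma Mod_nat_pow:
  assumes "L \<lhd> (G\<lparr>carrier := H\<rparr>)" "subgroup H G" "x \<in> H"
  shows "(L #> x) [^]\<^bsub>(G\<lparr>carrier := H\<rparr>) Mod L\<^esub> (e::nat) = L #> (x [^] e)"
proof -
  interpret L: normal L "G\<lparr>carrier := H\<rparr>" by fact
  have rc: "L #>\<^bsub>G\<lparr>carrier := H\<rparr>\<^esub> y = L #> y" for y by (simp add: r_coset_def)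
  have pw: "x [^]\<^bsub>G\<lparr>carrier := H\<rparr>\<^esub> e = x [^] e" by (simp add: nat_pow_consistent[symmetric])
  have hom: "group_hom (G\<lparr>carrier := H\<rparr>) ((G\<lparr>carrier := H\<rparr>) Mod L) (\<lambda>a. L #>\<^bsub>G\<lparr>carrier := H\<rparr>\<^esub> a)"
    using L.r_coset_hom_Mod L.factorgroup_is_group L.is_group by (auto simp: group_hom_def group_hom_axioms_def)
  show ?thesis using group_hom.hom_nat_pow[OF hom, of x e] assms(3) by (simp add: rc pw)
qed

text \<open>The element \<open>x\<close> of \<open>H\<close> satisfies \<open>x ^ e \<in> L\<close> exactly if its coset has \<open>e\<close>-th power one in \<open>H / L\<close>.\<close>

lemma pi_torsion_iff_index:
  assumes L: "L \<lhd> (G\<lparr>carrier := H\<rparr>)" and H: "subgroup H G" and fin: "finite ((\<lambda>b. L #> b) ` H)"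
  shows "(\<forall>x\<in>H. \<exists>e. pi_number \<pi> e \<and> x [^] e \<in> L) \<longleftrightarrow> pi_number \<pi> (rel_index H L)"
proof -
  interpret L: normal L "G\<lparr>carrier := H\<rparr>" by fact
  let ?Q = "(G\<lparr>carrier := H\<rparr>) Mod L"
  have sL: "subgroup L G" using L.subgroup_axioms H incl_subgroup by blast
  have car: "carrier ?Q = (\<lambda>b. L #> b) ` H"
    by (auto simp: FactGroup_def RCOSETS_def r_coset_def)
  have one: "\<one>\<^bsub>?Q\<^esub> = L" by (simp add: FactGroup_def)
  have fQ: "finite (carrier ?Q)" using fin car by simp
  have "(x [^] e \<in> L) = ((L #> x) [^]\<^bsub>?Q\<^esub> e = \<one>\<^bsub>?Q\<^esub>)" if "x \<in> H" for x and e :: nat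
  proof -
    have "x [^] e \<in> carrier G" using that subgroup.mem_carrier[OF H] by simp
    then show ?thesis unfolding one Mod_nat_pow[OF L H that] using sL coset_join1 coset_join2 
      subgroup.subset[OF sL] by metis
  qed
  then have "(\<forall>x\<in>H. \<exists>e. pi_number \<pi> e \<and> x [^] e \<in> L) \<longleftrightarrow>
    (\<forall>x\<in>carrier ?Q. \<exists>e. pi_number \<pi> e \<and> x [^]\<^bsub>?Q\<^esub> e = \<one>\<^bsub>?Q\<^esub>)"
    unfolding car by auto
  also have "\<dots> \<longleftrightarrow> pi_number \<pi> (order ?Q)"
    using pi_torsion_iff_order[OF L.factorgroup_is_group fQ] .
  finally show ?thesis by (simp add: order_subgroup_Mod)
qed

lemma pi_torsion_iff_index_normal:
  assumes M: "M \<lhd> G" "finite (rcosets M)" and H: "subgroup H G"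
  shows "(\<forall>x\<in>H. \<exists>e. pi_number \<pi> e \<and> x [^] e \<in> M) \<longleftrightarrow> pi_number \<pi> (rel_index H M)"
proof -
  have sM: "subgroup M G" using M normal_imp_subgroup by blast
  have Hc: "H \<subseteq> carrier G" using subgroup.subset[OF H] .
  have n: "H \<inter> M \<lhd> (G\<lparr>carrier := H\<rparr>)" using normal_Int_subgroup[OF H M(1)] by (simp add: Int_commute)
  have "finite ((\<lambda>b. (H \<inter> M) #> b) ` H)"
  proof -
    have "inj_on (\<lambda>X. M <#> X) ((\<lambda>b. (H \<inter> M) #> b) ` H)"
    proof (rule inj_onI, clarify)
      fix x y assume xy: "x \<in> H" "y \<in> H" "M <#> (H \<inter> M #> x) = M <#> (H \<inter> M #> y)"
      have s: "subgroup (H \<inter> M) G" using H sM subgroups_Inter_pair by blast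
      have c: "x \<in> carrier G" "y \<in> carrier G" using xy Hc by auto
      have "M #> x = M #> y" using xy(3) r_coset_subgroup_mult[OF s sM _ c(1)] r_coset_subgroup_mult[OF s sM _ c(2)] by simp
      then have "x \<otimes> inv y \<in> M" using r_coset_eq_iff sM c by blast
      moreover have "x \<otimes> inv y \<in> H" using xy H by (simp add: subgroup.m_closed subgroup.m_inv_closed)
      ultimately show "H \<inter> M #> x = H \<inter> M #> y" using r_coset_eq_iff[OF s c] by simp
    qed
    moreover have "finite ((\<lambda>X. M <#> X) ` (\<lambda>b. (H \<inter> M) #> b) ` H)"
    proof -
      have "subgroup (H \<inter> M) G" using H sM subgroups_Inter_pair by blast
      then have "(\<lambda>X. M <#> X) ` (\<lambda>b. (H \<inter> M) #> b) ` H \<subseteq> rcosets M"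
        using r_coset_subgroup_mult[of "H \<inter> M" M] sM Hc by (auto simp: rcosets_image)
      then show ?thesis using M(2) finite_subset by blast
    qed
    ultimately show ?thesis using finite_imageD by blast
  qed
  from pi_torsion_iff_index[OF n H this, of \<pi>] show ?thesis
    using rel_index_Int[OF H sM] subgroup_nat_pow_closed[OF H] by auto
qed

end

section \<open>Products of subgroups\<close>

context group
begin

lemma set_mult_iff: "x \<in> A <#> B \<longleftrightarrow> (\<exists>a\<in>A. \<exists>b\<in>B. x = a \<otimes> b)"
  by (auto simp: set_mult_def)

lemma subgroup_set_mult_normalising:
  assumes A: "subgroup A G" and B: "subgroup B G"
    and n: "\<And>a b. a \<in> A \<Longrightarrow> b \<in> B \<Longrightarrow> a \<otimes> b \<otimes> inv a \<in> B"
  shows "subgroup (A <#> B) G"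
proof (rule subgroupI)
  note c = subgroup.mem_carrier[OF A] subgroup.mem_carrier[OF B]
  have n': "inv a \<otimes> b \<otimes> a \<in> B" if "a \<in> A" "b \<in> B" for a b
    using n[of "inv a" b] that A c by (simp add: subgroup.m_inv_closed)
  show "A <#> B \<subseteq> carrier G" using c by (auto simp: set_mult_iff)
  show "A <#> B \<noteq> {}" using subgroup.one_closed[OF A] subgroup.one_closed[OF B] by (auto simp: set_mult_def)
  fix x assume "x \<in> A <#> B"
  then obtain a b where ab: "a \<in> A" "b \<in> B" "x = a \<otimes> b" by (auto simp: set_mult_iff)
  have "inv x = inv a \<otimes> (a \<otimes> inv b \<otimes> inv a)" using ab c by (simp add: inv_mult_group m_assoc)
  moreover have "a \<otimes> inv b \<otimes> inv a \<in> B" using ab n B by (simp add: subgroup.m_inv_closed)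
  ultimately show "inv x \<in> A <#> B" using ab A by (auto simp: set_mult_iff subgroup.m_inv_closed)
  fix y assume "y \<in> A <#> B"
  then obtain a' b' where ab': "a' \<in> A" "b' \<in> B" "y = a' \<otimes> b'" by (auto simp: set_mult_iff)
  have "x \<otimes> y = (a \<otimes> a') \<otimes> ((inv a' \<otimes> b \<otimes> a') \<otimes> b')" using ab ab' c by (simp add: m_assoc)
  moreover have "(inv a' \<otimes> b \<otimes> a') \<otimes> b' \<in> B" using n' ab ab' B by (simp add: subgroup.m_closed)
  ultimately show "x \<otimes> y \<in> A <#> B" using ab ab' A by (metis set_mult_iff subgroup.m_closed)
qed

lemma subset_set_mult:
  assumes "subgroup A G" "subgroup B G"
  shows "A \<subseteq> A <#> B" "B \<subseteq> A <#> B"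
proof -
  show "A \<subseteq> A <#> B"
  proof
    fix x assume "x \<in> A"
    then have "x = x \<otimes> \<one>" using subgroup.mem_carrier[OF assms(1)] by simp
    then show "x \<in> A <#> B" using \<open>x \<in> A\<close> subgroup.one_closed[OF assms(2)] unfolding set_mult_iff by blast
  qed
  show "B \<subseteq> A <#> B"
  proof
    fix x assume "x \<in> B"
    then have "x = \<one> \<otimes> x" using subgroup.mem_carrier[OF assms(2)] by simp
    then show "x \<in> A <#> B" using \<open>x \<in> B\<close> subgroup.one_closed[OF assms(1)] unfolding set_mult_iff by blast
  qed
qed

lemma normal_set_mult:
  assumes "A \<lhd> G" "B \<lhd> G" shows "A <#> B \<lhd> G"
  unfolding normal_inv_iff
proof (intro conjI ballI)
  note A = normal_imp_subgroup[OF assms(1)] and B = normal_imp_subgroup[OF assms(2)]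
  note c = subgroup.mem_carrier[OF A] subgroup.mem_carrier[OF B]
  show "subgroup (A <#> B) G"
    by (rule subgroup_set_mult_normalising[OF A B]) (use c normal.inv_op_closed2[OF assms(2)] in auto)
  fix x h assume x: "x \<in> carrier G" and "h \<in> A <#> B"
  then obtain a b where ab: "a \<in> A" "b \<in> B" "h = a \<otimes> b" by (auto simp: set_mult_iff)
  have "x \<otimes> h \<otimes> inv x = (x \<otimes> a \<otimes> inv x) \<otimes> (x \<otimes> b \<otimes> inv x)" using ab x c by (simp add: m_assoc)
  then show "x \<otimes> h \<otimes> inv x \<in> A <#> B"
    using normal.inv_op_closed2[OF assms(1) x ab(1)] normal.inv_op_closed2[OF assms(2) x ab(2)]
    unfolding set_mult_iff by blast
qed

text \<open>Modulo a subgroup that \<open>a\<close> normalises, \<open>a b\<close> and \<open>a\<close> have the same powers.\<close>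

lemma pow_mult_normalised:
  assumes "subgroup B G" "a \<in> carrier G" "\<And>b. b \<in> B \<Longrightarrow> inv a \<otimes> b \<otimes> a \<in> B" "b \<in> B"
  shows "\<exists>c\<in>B. (a \<otimes> b) [^] (e::nat) = a [^] e \<otimes> c"
proof (induction e)
  case 0 show ?case using subgroup.one_closed[OF assms(1)] by (auto intro!: bexI[of _ \<one>])
next
  case (Suc e)
  note c = subgroup.mem_carrier[OF assms(1)]
  obtain d where d: "d \<in> B" "(a \<otimes> b) [^] e = a [^] e \<otimes> d" using Suc by blast
  have "(a \<otimes> b) [^] Suc e = a [^] Suc e \<otimes> ((inv a \<otimes> d \<otimes> a) \<otimes> b)"
    using d assms(2,4) c by (simp add: m_assoc)
  moreover have "(inv a \<otimes> d \<otimes> a) \<otimes> b \<in> B" using assms d by (simp add: subgroup.m_closed)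
  ultimately show ?case by blast
qed

end

section \<open>Pro-p and pro-p' subgroups as torsion subgroups\<close>

context profinite
begin

lemma open_subgroup_finite_index:
  assumes D: "subgroup D G" "openin T D"
  shows "finite (rcosets D)"
proof -
  have cov: "carrier G \<subseteq> \<Union>(rcosets D)" using rcos_self[OF _ D(1)] by (force simp: rcosets_image)
  have "openin T X" if "X \<in> rcosets D" for X using that open_r_coset[OF D(2)] by (auto simp: rcosets_image)
  then obtain F where F: "finite F" "F \<subseteq> rcosets D" "carrier G \<subseteq> \<Union>F"
    using compactinD[of T "carrier G" "rcosets D"] compact cov unfolding compact_space_def by auto
  have "rcosets D \<subseteq> F"
  proof
    fix X assume X: "X \<in> rcosets D"
    then obtain a where a: "a \<in> carrier G" "X = D #> a" by (auto simp: rcosets_image)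
    then obtain Y where Y: "Y \<in> F" "a \<in> Y" using F by blast
    then obtain b where "b \<in> carrier G" "Y = D #> b" using F(2) by (auto simp: rcosets_image)
    then have "Y = D #> a" using repr_independence[of a D b] Y D by simp
    then show "X \<in> F" using Y a by simp
  qed
  then show ?thesis using F finite_subset by blast
qed

lemma ONS_finite_index: "M \<in> ONS \<Longrightarrow> finite (rcosets M)"
  using open_subgroup_finite_index ONS_D(2,3) by blast

lemma closed_subgroup_profinite:
  assumes H: "subgroup H G" "closedin T H"
  shows "profinite_group (G\<lparr>carrier := H\<rparr>) (subtopology T H)"
proof -
  let ?S = "subtopology T H"
  have Hc: "H \<subseteq> carrier G" using subgroup.subset[OF H(1)] .
  then have ts: "topspace ?S = H" by (auto simp: topspace_subtopology)
  have i: "continuous_map ?S T (\<lambda>x. x)" using continuous_ident continuous_map_from_subtopology by blast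
  have fs: "continuous_map (prod_topology ?S ?S) T fst" "continuous_map (prod_topology ?S ?S) T snd"
    using continuous_map_fst[of ?S ?S] continuous_map_snd[of ?S ?S] by (auto intro: continuous_map_into_fulltopology)
  have "continuous_map (prod_topology ?S ?S) ?S (\<lambda>z. fst z \<otimes> snd z)"
    using continuous_mult[OF fs] subgroup.m_closed[OF H(1)] ts
    by (auto simp: continuous_map_in_subtopology)
  then have 1: "continuous_map (prod_topology ?S ?S) ?S (\<lambda>(x, y). x \<otimes> y)" by (simp add: case_prod_unfold)
  have "continuous_map ?S ?S (\<lambda>x. inv x)"
    using continuous_inv[OF i] subgroup.m_inv_closed[OF H(1)] ts
    by (auto simp: continuous_map_in_subtopology)
  then have 2: "continuous_map ?S ?S (\<lambda>x. inv\<^bsub>G\<lparr>carrier := H\<rparr>\<^esub> x)"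
    by (rule continuous_map_eq) (use H ts in auto)
  have "compact_space ?S" using closed_compact[OF H(2)] by (simp add: compact_space_subtopology)
  moreover have "Hausdorff_space ?S" using Hausdorff Hausdorff_space_subtopology by blast
  moreover have "totally_disconnected_space ?S"
    using tot_disc by (simp add: totally_disconnected_space_def connectedin_subtopology)
  ultimately show ?thesis
    using 1 2 ts subgroup_imp_group[OF H(1)] by (simp add: profinite_group_def topological_group_def)
qed

lemma profinite_closed_subgroup:
  assumes "subgroup H G" "closedin T H"
  shows "profinite (G\<lparr>carrier := H\<rparr>) (subtopology T H)"
  using closed_subgroup_profinite[OF assms] subgroup_imp_group[OF assms(1)]
  by (simp add: profinite_def profinite_axioms_def)

lemma ONS_Int_subgroup:
  assumes "subgroup H G" "N \<in> ONS"
  shows "H \<inter> N \<in> open_normal_subgroups (G\<lparr>carrier := H\<rparr>) (subtopology T H)"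
  using normal_Int_subgroup[OF assms(1) ONS_D(1)[OF assms(2)]] ONS_D(3)[OF assms(2)]
  by (auto simp: open_normal_subgroups_def Int_commute openin_subtopology_Int2)

lemma ONS_below_subgroup:
  assumes "subgroup H G" "L \<in> open_normal_subgroups (G\<lparr>carrier := H\<rparr>) (subtopology T H)"
  shows "\<exists>N \<in> ONS. H \<inter> N \<subseteq> L"
proof -
  have L: "L \<lhd> (G\<lparr>carrier := H\<rparr>)" "openin (subtopology T H) L"
    using assms(2) by (auto simp: open_normal_subgroups_def)
  then have "\<one> \<in> L" using subgroup.one_closed[OF normal_imp_subgroup[OF L(1)]] by simp
  moreover obtain U where U: "openin T U" "L = U \<inter> H" using L(2) by (auto simp: openin_subtopology)
  ultimately obtain N where "N \<in> ONS" "N \<subseteq> U" using ONS_base[of U] by blast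
  then show ?thesis using U by blast
qed

text \<open>The elementwise form of being pro-\<open>\<pi>\<close>. It makes sense without a topology on \<open>H\<close> and is immediate for
  subsets, conjugates and unions.\<close>

definition pi_torsion :: "nat set \<Rightarrow> 'a set \<Rightarrow> bool" where
  "pi_torsion \<pi> H \<longleftrightarrow> (\<forall>M \<in> ONS. \<forall>x\<in>H. \<exists>e. pi_number \<pi> e \<and> x [^] e \<in> M)"

text \<open>The traces \<open>H \<inter> M\<close> of open normal subgroups \<open>M\<close> of \<open>G\<close> are cofinal among the open normal subgroups of
  \<open>H\<close>, so exponents may be tested in \<open>G\<close>.\<close>

lemma pi_torsion_iff_orders:
  assumes H: "subgroup H G" "closedin T H"
  shows "(\<forall>L \<in> open_normal_subgroups (G\<lparr>carrier := H\<rparr>) (subtopology T H).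
      pi_number \<pi> (order ((G\<lparr>carrier := H\<rparr>) Mod L))) \<longleftrightarrow> pi_torsion \<pi> H"
proof -
  interpret H: profinite "G\<lparr>carrier := H\<rparr>" "subtopology T H"
    by (rule profinite_closed_subgroup[OF H])
  let ?O = "open_normal_subgroups (G\<lparr>carrier := H\<rparr>) (subtopology T H)"
  have fin: "finite ((\<lambda>b. L #> b) ` H)" if "L \<in> ?O" for L
  proof -
    have "(\<lambda>b. L #> b) ` H = rcosets\<^bsub>G\<lparr>carrier := H\<rparr>\<^esub> L" by (auto simp: RCOSETS_def r_coset_def)
    then show ?thesis using H.ONS_finite_index[OF that] by simp
  qed
  have "pi_number \<pi> (order ((G\<lparr>carrier := H\<rparr>) Mod L)) \<longleftrightarrow> (\<forall>x\<in>H. \<exists>e. pi_number \<pi> e \<and> x [^] e \<in> L)"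
    if "L \<in> ?O" for L
    using pi_torsion_iff_index[OF H.ONS_D(1)[OF that] H(1) fin[OF that], of \<pi>] by (simp add: order_subgroup_Mod)
  then have "(\<forall>L\<in>?O. pi_number \<pi> (order ((G\<lparr>carrier := H\<rparr>) Mod L))) \<longleftrightarrow>
     (\<forall>L\<in>?O. \<forall>x\<in>H. \<exists>e. pi_number \<pi> e \<and> x [^] e \<in> L)" by blast
  also have "\<dots> \<longleftrightarrow> pi_torsion \<pi> H"
    unfolding pi_torsion_def
  proof (intro iffI ballI)
    fix M x assume a: "\<forall>L\<in>?O. \<forall>x\<in>H. \<exists>e. pi_number \<pi> e \<and> x [^] e \<in> L" "M \<in> ONS" "x \<in> H"
    then show "\<exists>e. pi_number \<pi> e \<and> x [^] e \<in> M" using ONS_Int_subgroup[OF H(1) a(2)] by blast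
  next
    fix L x assume a: "\<forall>M\<in>ONS. \<forall>x\<in>H. \<exists>e. pi_number \<pi> e \<and> x [^] e \<in> M" "L \<in> ?O" "x \<in> H"
    obtain N where N: "N \<in> ONS" "H \<inter> N \<subseteq> L" using ONS_below_subgroup[OF H(1) a(2)] by blast
    then obtain e where "pi_number \<pi> e" "x [^] e \<in> N" using a by blast
    then show "\<exists>e. pi_number \<pi> e \<and> x [^] e \<in> L" using N subgroup_nat_pow_closed[OF H(1) a(3), of e] by blast
  qed
  finally show ?thesis .
qed

lemma pro_p_subgroup_iff:
  assumes "prime p"
  shows "pro_p_subgroup p G T H \<longleftrightarrow> subgroup H G \<and> closedin T H \<and> pi_torsion {p} H"
  using pi_torsion_iff_orders[of H "{p}"] closed_subgroup_profinite[of H]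
  by (auto simp: pro_p_subgroup_def pro_p_group_def pi_number_singleton[OF assms])

lemma pro_p'_subgroup_iff:
  assumes "prime p"
  shows "pro_p'_subgroup p G T H \<longleftrightarrow> subgroup H G \<and> closedin T H \<and> pi_torsion (- {p}) H"
  using pi_torsion_iff_orders[of H "- {p}"] closed_subgroup_profinite[of H]
  by (auto simp: pro_p'_subgroup_def pro_p'_group_def pi_number_compl[OF assms])

lemma pi_torsion_index:
  assumes "M \<in> ONS" "subgroup H G"
  shows "(\<forall>x\<in>H. \<exists>e. pi_number \<pi> e \<and> x [^] e \<in> M) \<longleftrightarrow> pi_number \<pi> (rel_index H M)"
  using pi_torsion_iff_index_normal ONS_D(1) ONS_finite_index assms by blast

text \<open>If \<open>a ^ e \<in> M\<close>, then \<open>(a b) ^ e\<close> agrees modulo \<open>M\<close> with an element \<open>d\<close> of \<open>B\<close>; multiply \<open>e\<close> by an exponent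
  that works for \<open>d\<close>.\<close>

lemma pi_torsion_set_mult:
  assumes A: "subgroup A G" "pi_torsion \<pi> A" and B: "subgroup B G" "pi_torsion \<pi> B"
    and n: "\<And>a b. a \<in> A \<Longrightarrow> b \<in> B \<Longrightarrow> a \<otimes> b \<otimes> inv a \<in> B"
  shows "pi_torsion \<pi> (A <#> B)"
  unfolding pi_torsion_def
proof (intro ballI)
  fix M x assume M: "M \<in> ONS" and "x \<in> A <#> B"
  then obtain a b where ab: "a \<in> A" "b \<in> B" "x = a \<otimes> b" by (auto simp: set_mult_iff)
  note c = subgroup.mem_carrier[OF A(1)] subgroup.mem_carrier[OF B(1)]
  obtain e where e: "pi_number \<pi> e" "a [^] e \<in> M" using A(2) M ab by (auto simp: pi_torsion_def)
  have "inv a \<otimes> b \<otimes> a \<in> B" if "b \<in> B" for b using n[of "inv a" b] ab that A(1) c by (simp add: subgroup.m_inv_closed)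
  then obtain d where d: "d \<in> B" "x [^] e = a [^] e \<otimes> d"
    using pow_mult_normalised[OF B(1), of a b e] ab c by blast
  then obtain f where f: "pi_number \<pi> f" "d [^] f \<in> M" using B(2) M by (auto simp: pi_torsion_def)
  have cd: "a [^] e \<in> carrier G" "d \<in> carrier G" "x \<in> carrier G" using ab c d by auto
  have mc: "inv d \<otimes> m \<otimes> d \<in> M" if "m \<in> M" for m
    using ONS_conj[OF M that, of "inv d"] cd by simp
  have "x [^] e = d \<otimes> (inv d \<otimes> a [^] e \<otimes> d)" using d cd by (simp add: m_assoc)
  then obtain m where m: "m \<in> M" "(x [^] e) [^] f = d [^] f \<otimes> m"
    using pow_mult_normalised[OF ONS_D(2)[OF M] cd(2), of _ f] mc e(2) by metis
  then have "x [^] (e * f) \<in> M"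
    using f(2) cd ONS_D(2)[OF M] by (simp add: nat_pow_pow[symmetric] subgroup.m_closed)
  then show "\<exists>e. pi_number \<pi> e \<and> x [^] e \<in> M" using e f pi_number_mult by blast
qed

text \<open>The topological closure, for the base of neighbourhoods \<open>N x\<close> of a point \<open>x\<close>.\<close>

definition group_closure :: "'a set \<Rightarrow> 'a set" where
  "group_closure E = {x \<in> carrier G. \<forall>N \<in> ONS. \<exists>n\<in>N. n \<otimes> x \<in> E}"

lemma group_closure_closed: "closedin T (group_closure E)"
proof -
  have "openin T (carrier G - group_closure E)"
  proof (subst openin_subopen, clarify)
    fix x assume x: "x \<in> carrier G" "x \<notin> group_closure E"
    then obtain N where N: "N \<in> ONS" "\<forall>n\<in>N. n \<otimes> x \<notin> E" by (auto simp: group_closure_def)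
    have "N #> x \<subseteq> carrier G - group_closure E"
    proof
      fix y assume "y \<in> N #> x"
      then obtain m where m: "m \<in> N" "y = m \<otimes> x" by (auto simp: r_coset_def)
      have "n \<otimes> y \<notin> E" if "n \<in> N" for n
        using N(2) that m subgroup.m_closed[OF ONS_D(2)[OF N(1)]] ONS_D(4)[OF N(1)] x(1)
        by (metis m_assoc subsetD)
      then show "y \<in> carrier G - group_closure E" using N(1) m x ONS_D(4)[OF N(1)] by (auto simp: group_closure_def)
    qed
    moreover have "x \<in> N #> x" using rcos_self[OF x(1) ONS_D(2)[OF N(1)]] .
    ultimately show "\<exists>U. openin T U \<and> x \<in> U \<and> U \<subseteq> carrier G - group_closure E"
      using open_r_coset[OF ONS_D(3)[OF N(1)] x(1)] by blast
  qed
  moreover have "group_closure E \<subseteq> carrier G" by (auto simp: group_closure_def)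
  ultimately show ?thesis by (simp add: closedin_def)
qed

lemma group_closure_subset: "E \<subseteq> carrier G \<Longrightarrow> E \<subseteq> group_closure E"
  using ONS_D(5) by (force simp: group_closure_def)

lemma group_closure_normal:
  assumes E: "E \<lhd> G" shows "group_closure E \<lhd> G"
proof -
  note sE = normal_imp_subgroup[OF E]
  note Ec = subgroup.mem_carrier[OF sE]
  have "subgroup (group_closure E) G"
  proof (rule subgroupI)
    show "group_closure E \<subseteq> carrier G" by (auto simp: group_closure_def)
    show "group_closure E \<noteq> {}" using group_closure_subset[OF subgroup.subset[OF sE]] subgroup.one_closed[OF sE] by blast
  next
    fix a assume a: "a \<in> group_closure E"
    then have ac: "a \<in> carrier G" by (simp add: group_closure_def)
    have "\<exists>n\<in>N. n \<otimes> inv a \<in> E" if N: "N \<in> ONS" for N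
    proof -
      obtain n where n: "n \<in> N" "n \<otimes> a \<in> E" using a N by (auto simp: group_closure_def)
      have nc: "n \<in> carrier G" using n ONS_D(4)[OF N] by blast
      have "inv (n \<otimes> a) = (inv a \<otimes> inv n \<otimes> a) \<otimes> inv a" using ac nc by (simp add: inv_mult_group m_assoc)
      moreover have "inv a \<otimes> inv n \<otimes> a \<in> N"
        using ONS_conj[OF N, of "inv n" "inv a"] n ac ONS_D(2)[OF N] by (simp add: subgroup.m_inv_closed)
      moreover have "inv (n \<otimes> a) \<in> E" using n sE by (simp add: subgroup.m_inv_closed)
      ultimately show ?thesis by metis
    qed
    then show "inv a \<in> group_closure E" using ac by (simp add: group_closure_def)
  next
    fix a b assume a: "a \<in> group_closure E" "b \<in> group_closure E"
    then have ac: "a \<in> carrier G" "b \<in> carrier G" by (auto simp add: group_closure_def)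
    have "\<exists>n\<in>N. n \<otimes> (a \<otimes> b) \<in> E" if N: "N \<in> ONS" for N
    proof -
      obtain n m where n: "n \<in> N" "n \<otimes> a \<in> E" "m \<in> N" "m \<otimes> b \<in> E" using a N by (force simp: group_closure_def)
      have nc: "n \<in> carrier G" "m \<in> carrier G" using n ONS_D(4)[OF N] by blast+
      have "(n \<otimes> a) \<otimes> (m \<otimes> b) = (n \<otimes> (a \<otimes> m \<otimes> inv a)) \<otimes> (a \<otimes> b)" using ac nc by (simp add: m_assoc)
      moreover have "n \<otimes> (a \<otimes> m \<otimes> inv a) \<in> N"
        using ONS_conj[OF N n(3) ac(1)] n ONS_D(2)[OF N] by (simp add: subgroup.m_closed)
      moreover have "(n \<otimes> a) \<otimes> (m \<otimes> b) \<in> E" using n sE by (simp add: subgroup.m_closed)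
      ultimately show ?thesis by metis
    qed
    then show "a \<otimes> b \<in> group_closure E" using ac by (simp add: group_closure_def)
  qed
  then show ?thesis
    unfolding normal_inv_iff
  proof (intro conjI ballI)
    fix x a assume x: "x \<in> carrier G" and a: "a \<in> group_closure E"
    then have ac: "a \<in> carrier G" by (simp add: group_closure_def)
    have "\<exists>n\<in>N. n \<otimes> (x \<otimes> a \<otimes> inv x) \<in> E" if N: "N \<in> ONS" for N
    proof -
      obtain n where n: "n \<in> N" "n \<otimes> a \<in> E" using a N by (auto simp: group_closure_def)
      have nc: "n \<in> carrier G" using n ONS_D(4)[OF N] by blast
      have "x \<otimes> (n \<otimes> a) \<otimes> inv x = (x \<otimes> n \<otimes> inv x) \<otimes> (x \<otimes> a \<otimes> inv x)" using ac nc x by (simp add: m_assoc)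
      moreover have "x \<otimes> (n \<otimes> a) \<otimes> inv x \<in> E" using normal.inv_op_closed2[OF E x n(2)] .
      ultimately show ?thesis using ONS_conj[OF N n(1) x] by metis
    qed
    then show "x \<otimes> a \<otimes> inv x \<in> group_closure E" using ac x by (simp add: group_closure_def)
  qed
qed

lemma pi_torsion_group_closure:
  assumes "pi_torsion \<pi> E" shows "pi_torsion \<pi> (group_closure E)"
  unfolding pi_torsion_def
proof (intro ballI)
  fix M x assume M: "M \<in> ONS" and x: "x \<in> group_closure E"
  then obtain m where m: "m \<in> M" "m \<otimes> x \<in> E" by (auto simp: group_closure_def)
  then obtain e where e: "pi_number \<pi> e" "(m \<otimes> x) [^] e \<in> M" using assms M by (auto simp: pi_torsion_def)
  have c: "m \<in> carrier G" "x \<in> carrier G" using m ONS_D(4)[OF M] x by (auto simp: group_closure_def)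
  have "m \<otimes> x = x \<otimes> (inv x \<otimes> m \<otimes> x)" using c by (simp add: m_assoc)
  moreover have mc: "inv x \<otimes> m \<otimes> x \<in> M" if "m \<in> M" for m using ONS_conj[OF M that, of "inv x"] c by simp
  ultimately obtain m' where m': "m' \<in> M" "(m \<otimes> x) [^] e = x [^] e \<otimes> m'"
    using pow_mult_normalised[OF ONS_D(2)[OF M] c(2) mc, of _ e] m(1) by metis
  have m'c: "m' \<in> carrier G" using m' ONS_D(4)[OF M] by blast
  have "x [^] e = (m \<otimes> x) [^] e \<otimes> inv m'" using m'(2) m'c c by (simp add: m_assoc)
  then have "x [^] e \<in> M" using e(2) m'(1) ONS_D(2)[OF M] by (metis subgroup.m_closed subgroup.m_inv_closed)
  then show "\<exists>e. pi_number \<pi> e \<and> x [^] e \<in> M" using e by blast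
qed

text \<open>The largest closed normal pro-\<open>\<pi>\<close> subgroup: \<open>O\<^sub>p(G)\<close> for \<open>\<pi> = {p}\<close> and \<open>O\<^sub>p\<^sub>'(G)\<close> for \<open>\<pi> = - {p}\<close>.\<close>

definition pi_radical :: "nat set \<Rightarrow> 'a set" where
  "pi_radical \<pi> = group_closure (\<Union>{R. R \<lhd> G \<and> pi_torsion \<pi> R})"

text \<open>The normal pro-\<open>\<pi>\<close> subgroups are directed, since products of two of them are again of this kind;
  their union is therefore a subgroup, and closing it up adds no new elements modulo any open normal
  subgroup.\<close>

lemma pi_radical:
  shows pi_radical_normal: "pi_radical \<pi> \<lhd> G" and pi_radical_closed: "closedin T (pi_radical \<pi>)"
    and pi_radical_torsion: "pi_torsion \<pi> (pi_radical \<pi>)"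
    and pi_radical_greatest: "R \<lhd> G \<Longrightarrow> pi_torsion \<pi> R \<Longrightarrow> R \<subseteq> pi_radical \<pi>"
proof -
  let ?F = "{R. R \<lhd> G \<and> pi_torsion \<pi> R}"
  have sub: "subgroup R G" "R \<subseteq> carrier G" if "R \<in> ?F" for R
    using that normal_imp_subgroup[of R] subgroup.subset[of R G] by auto
  have prod: "A <#> B \<in> ?F" if "A \<in> ?F" "B \<in> ?F" for A B
    using that normal_set_mult[of A B] pi_torsion_set_mult[of A \<pi> B] normal_imp_subgroup[of A G] normal_imp_subgroup[of B G]
      normal.inv_op_closed2[of B G] subgroup.mem_carrier[of A G] by simp
  have "{\<one>} \<in> ?F"
  proof -
    have "\<one> [^] (1::nat) \<in> M" if "M \<in> ONS" for M using ONS_D(5)[OF that] by simp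
    then show ?thesis using one_is_normal unfolding pi_torsion_def by (auto intro!: exI[of _ 1])
  qed
  then have one: "\<one> \<in> \<Union>?F" by blast
  have norm: "\<Union>?F \<lhd> G"
  proof (rule normal_inv_iff[THEN iffD2], intro conjI ballI)
    show "subgroup (\<Union>?F) G"
    proof (rule subgroupI)
      show "\<Union>?F \<subseteq> carrier G" "\<Union>?F \<noteq> {}" using sub one by blast+
      fix a assume "a \<in> \<Union>?F"
      then obtain A where A: "A \<in> ?F" "a \<in> A" by blast
      then show "inv a \<in> \<Union>?F" using subgroup.m_inv_closed[OF sub(1)[OF A(1)]] by blast
      fix b assume "b \<in> \<Union>?F"
      then obtain B where B: "B \<in> ?F" "b \<in> B" by blast
      then have "a \<otimes> b \<in> A <#> B" using A by (auto simp: set_mult_iff)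
      then show "a \<otimes> b \<in> \<Union>?F" using prod[OF A(1) B(1)] by blast
    qed
    fix x h assume x: "x \<in> carrier G" and "h \<in> \<Union>?F"
    then obtain A where A: "A \<in> ?F" "h \<in> A" by blast
    then show "x \<otimes> h \<otimes> inv x \<in> \<Union>?F" using normal.inv_op_closed2[of A G x h] x by blast
  qed
  have tors: "pi_torsion \<pi> (\<Union>?F)" by (auto simp: pi_torsion_def)
  show "pi_radical \<pi> \<lhd> G" "closedin T (pi_radical \<pi>)" "pi_torsion \<pi> (pi_radical \<pi>)"
    unfolding pi_radical_def using group_closure_normal[OF norm] group_closure_closed pi_torsion_group_closure[OF tors] by auto
  show "R \<subseteq> pi_radical \<pi>" if "R \<lhd> G" "pi_torsion \<pi> R"
    unfolding pi_radical_def using that group_closure_subset[of "\<Union>?F"] sub by blast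
qed

lemma O_p_eq: assumes "prime p" shows "O_p p G T = pi_radical {p}"
  unfolding O_p_def pro_p_subgroup_iff[OF assms]
  by (rule Greatest_equality)
    (auto simp: pi_radical_normal pi_radical_closed pi_radical_torsion normal_imp_subgroup dest: pi_radical_greatest)

lemma O_p'_eq: assumes "prime p" shows "O_p' p G T = pi_radical (- {p})"
  unfolding O_p'_def pro_p'_subgroup_iff[OF assms]
  by (rule Greatest_equality)
    (auto simp: pi_radical_normal pi_radical_closed pi_radical_torsion normal_imp_subgroup dest: pi_radical_greatest)

end

section \<open>Quotients of profinite groups\<close>

context profinite
begin

lemma closed_r_coset:
  assumes M: "subgroup M G" "openin T M" and a: "a \<in> carrier G"
  shows "closedin T (M #> a)"
proof -
  have "carrier G - (M #> a) = \<Union>((\<lambda>z. M #> z) ` (carrier G - (M #> a)))"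
  proof
    show "carrier G - (M #> a) \<subseteq> \<Union>((\<lambda>z. M #> z) ` (carrier G - (M #> a)))"
      using rcos_self[OF _ M(1)] by blast
    show "\<Union>((\<lambda>z. M #> z) ` (carrier G - (M #> a))) \<subseteq> carrier G - (M #> a)"
    proof clarify
      fix z w assume z: "z \<in> carrier G" "z \<notin> M #> a" "w \<in> M #> z"
      have "M #> z = M #> w" using repr_independence[OF z(3,1) M(1)] .
      moreover have w: "w \<in> carrier G" using r_coset_subset_G[OF subgroup.subset[OF M(1)] z(1)] z(3) by auto
      moreover have "M #> a = M #> w" if "w \<in> M #> a" using repr_independence[OF that a M(1)] .
      ultimately show "w \<in> carrier G - (M #> a)" using z rcos_self[OF z(1) M(1)] by auto
    qed
  qed
  moreover have "openin T (\<Union>((\<lambda>z. M #> z) ` (carrier G - (M #> a))))"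
    using open_r_coset[OF M(2)] by blast
  moreover have "M #> a \<subseteq> carrier G" using r_coset_subset_G[OF subgroup.subset[OF M(1)] a] .
  ultimately show ?thesis by (simp add: closedin_def)
qed

text \<open>Two distinct cosets \<open>R x\<close>, \<open>R y\<close> are separated by the image of \<open>N R x\<close>, which is clopen, for an open
  normal \<open>N\<close> such that \<open>N y x\<inverse>\<close> misses \<open>R\<close>. This gives the Hausdorff property and total
  disconnectedness at once; multiplication is continuous because the quotient map is open.\<close>

lemma quotient_profinite:
  assumes R: "R \<lhd> G" "closedin T R"
  shows "profinite_group (G Mod R) (coset_topology G T R)"
proof -
  interpret R: normal R G by fact
  let ?q = "\<lambda>x. R #> x" and ?S = "coset_topology G T R"
  have sR: "subgroup R G" using normal_imp_subgroup[OF R(1)] .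
  have car: "carrier (G Mod R) = ?q ` carrier G" by (auto simp: FactGroup_def rcosets_image)
  have qm: "quotient_map T ?S ?q" using quotient_map_coset_topology[OF top_group R(1)] .
  have cm: "continuous_map T ?S ?q" using quotient_imp_continuous_map[OF qm] .
  have ts: "topspace ?S = carrier (G Mod R)" using quotient_imp_surjective_map[OF qm] car by simp
  have openq: "openin ?S V \<longleftrightarrow> V \<subseteq> ?q ` carrier G \<and> openin T (\<Union>V)" for V
    using openin_coset_topology[OF R(1), of T V] car by simp
  have selfc: "x \<in> R #> x" if "x \<in> carrier G" for x using rcos_self[OF that sR] .
  have sat: "\<Union>(?q ` U) = R <#> U" for U by (auto simp: r_coset_def set_mult_def)
  have oq: "openin ?S (?q ` U)" if "openin T U" for U
  proof -
    have "R <#> U = (\<Union>r\<in>R. r <# U)" by (auto simp: set_mult_def l_coset_def)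
    moreover have "openin T (\<Union>r\<in>R. r <# U)"
      using open_translate[OF that] R.mem_carrier by auto
    ultimately show ?thesis unfolding openq sat using open_carrier[OF that] by auto
  qed
  have cosetrep: "\<exists>x\<in>carrier G. A = R #> x" if "A \<in> carrier (G Mod R)" for A using that car by auto
  have mem: "?q x \<in> V \<longleftrightarrow> x \<in> \<Union>V" if xV: "x \<in> carrier G" "V \<subseteq> ?q ` carrier G" for x V
  proof
    assume "x \<in> \<Union>V"
    then obtain A where A: "A \<in> V" "x \<in> A" by (rule UnionE)
    then obtain y where "y \<in> carrier G" "A = R #> y" using xV(2) by blast
    with A have y: "y \<in> carrier G" "R #> y \<in> V" "x \<in> R #> y" by simp_all
    then have "R #> y = R #> x" using repr_independence[OF y(3,1) sR] by simp
    then show "?q x \<in> V" using y by simp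
  next
    assume "?q x \<in> V" then show "x \<in> \<Union>V" using selfc[OF xV(1)] by (rule UnionI)
  qed
  have mult: "continuous_map (prod_topology ?S ?S) ?S (\<lambda>(X, Y). X \<otimes>\<^bsub>G Mod R\<^esub> Y)"
    unfolding continuous_map_def
  proof (intro conjI allI impI)
    interpret Q: group "G Mod R" by (rule R.factorgroup_is_group)
    show "(\<lambda>(X, Y). X \<otimes>\<^bsub>G Mod R\<^esub> Y) \<in> topspace (prod_topology ?S ?S) \<rightarrow> topspace ?S"
      using Q.m_closed by (auto simp: ts)
    fix V assume V: "openin ?S V"
    then have V': "V \<subseteq> ?q ` carrier G" "openin T (\<Union>V)" using openq by auto
    let ?P = "{z \<in> topspace (prod_topology ?S ?S). (case z of (X, Y) \<Rightarrow> X \<otimes>\<^bsub>G Mod R\<^esub> Y) \<in> V}"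
    show "openin (prod_topology ?S ?S) ?P"
    proof (subst openin_prod_topology_alt, intro allI impI)
      fix X Y assume "(X, Y) \<in> ?P"
      then have "X \<in> carrier (G Mod R)" "Y \<in> carrier (G Mod R)" and XYV: "X <#> Y \<in> V" by (auto simp: ts)
      then obtain x y where xy: "x \<in> carrier G" "y \<in> carrier G" "X = R #> x" "Y = R #> y" using cosetrep by blast
      have "R #> (x \<otimes> y) \<in> V" using XYV xy R.rcos_sum by simp
      then have "x \<otimes> y \<in> \<Union>V" using mem V' xy by simp
      moreover have "continuous_map (prod_topology T T) T (\<lambda>z. fst z \<otimes> snd z)" by (intro continuous_group)
      then have W: "openin (prod_topology T T) {z \<in> topspace (prod_topology T T). fst z \<otimes> snd z \<in> \<Union>V}"
        using openin_continuous_map_preimage V' by blast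
      ultimately have "(x, y) \<in> {z \<in> topspace (prod_topology T T). fst z \<otimes> snd z \<in> \<Union>V}" using xy by simp
      then obtain U1 U2 where U: "openin T U1" "openin T U2" "x \<in> U1" "y \<in> U2"
        "U1 \<times> U2 \<subseteq> {z \<in> topspace (prod_topology T T). fst z \<otimes> snd z \<in> \<Union>V}"
        using W[unfolded openin_prod_topology_alt, rule_format, of x y] by blast
      have sub: "?q ` U1 \<times> ?q ` U2 \<subseteq> ?P"
      proof clarify
        fix u v assume uv: "u \<in> U1" "v \<in> U2"
        then have c: "u \<in> carrier G" "v \<in> carrier G" using open_carrier U by blast+
        have "(u, v) \<in> {z \<in> topspace (prod_topology T T). fst z \<otimes> snd z \<in> \<Union>V}" using U(5) uv by blast
        then have "u \<otimes> v \<in> \<Union>V" by simp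
        then have "R #> (u \<otimes> v) \<in> V" using mem[of "u \<otimes> v"] V' c by simp
        then show "(R #> u, R #> v) \<in> topspace (prod_topology ?S ?S) \<and> (R #> u) \<otimes>\<^bsub>G Mod R\<^esub> (R #> v) \<in> V"
          using c by (simp add: ts car R.rcos_sum)
      qed
      then show "\<exists>U V. openin ?S U \<and> openin ?S V \<and> X \<in> U \<and> Y \<in> V \<and> U \<times> V \<subseteq> ?P"
        by (intro exI[of _ "?q ` U1"] exI[of _ "?q ` U2"] conjI oq U(1,2) sub)
          (use U(3,4) xy(3,4) in simp_all)
    qed
  qed
  have inverse: "continuous_map ?S ?S (\<lambda>X. inv\<^bsub>G Mod R\<^esub> X)"
  proof (rule continuous_compose_quotient_map[OF qm])
    have "continuous_map T ?S (?q \<circ> (\<lambda>x. inv x))"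
      using continuous_map_compose[OF continuous_inv[OF continuous_ident] cm] .
    then show "continuous_map T ?S ((\<lambda>X. inv\<^bsub>G Mod R\<^esub> X) \<circ> ?q)"
      by (rule continuous_map_eq) (use R.inv_FactGroup R.rcos_inv car in \<open>auto simp: \<close>)
  qed
  have sep: "\<exists>V. openin ?S V \<and> openin ?S (topspace ?S - V) \<and> X \<in> V \<and> Y \<in> topspace ?S - V"
    if XY: "X \<in> carrier (G Mod R)" "Y \<in> carrier (G Mod R)" "X \<noteq> Y" for X Y
  proof -
    obtain x y where xy: "x \<in> carrier G" "y \<in> carrier G" "X = R #> x" "Y = R #> y" using cosetrep XY by blast
    have "y \<otimes> inv x \<notin> R" using r_coset_eq_iff[OF sR xy(2,1)] xy(3,4) XY(3) by simp
    then obtain N where N: "N \<in> ONS" "\<forall>n\<in>N. n \<otimes> (y \<otimes> inv x) \<notin> R"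
      using ONS_avoid_closed[OF R(2)] xy by blast
    let ?M = "N <#> R"
    have nM: "?M \<lhd> G" using normal_set_mult[OF ONS_D(1)[OF N(1)] R(1)] .
    have sM: "subgroup ?M G" using normal_imp_subgroup[OF nM] .
    have NM: "N \<subseteq> ?M" "R \<subseteq> ?M" using subset_set_mult[OF ONS_D(2)[OF N(1)] sR] by auto
    have oM: "openin T ?M" using open_subgroup[OF sM N(1) NM(1)] .
    let ?V = "?q ` (?M #> x)"
    have "R <#> ?M = ?M"
    proof
      show "R <#> ?M \<subseteq> ?M"
      proof
        fix z assume "z \<in> R <#> ?M"
        then have "\<exists>r\<in>R. \<exists>w\<in>?M. z = r \<otimes> w" by (rule set_mult_iff[THEN iffD1])
        then obtain r w where "r \<in> R" "w \<in> ?M" "z = r \<otimes> w" by (elim bexE)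
        then show "z \<in> ?M" using subsetD[OF NM(2)] subgroup.m_closed[OF sM] by simp
      qed
      show "?M \<subseteq> R <#> ?M" using subset_set_mult[OF sR sM] by simp
    qed
    then have RM: "R <#> (?M #> x) = ?M #> x"
      using setmult_rcos_assoc[OF R.subset subgroup.subset[OF sM] xy(1)] by simp
    have oV: "openin ?S ?V" using oq open_r_coset[OF oM xy(1)] by blast
    have "openin T (carrier G - (?M #> x))"
      using closed_r_coset[OF sM oM xy(1)] openin_diff[OF openin_topspace] by fastforce
    moreover have "\<Union>(topspace ?S - ?V) = carrier G - (?M #> x)"
    proof -
      have V: "?V \<subseteq> ?q ` carrier G" using openq[THEN iffD1, OF oV] by simp
      have W: "topspace ?S - ?V \<subseteq> ?q ` carrier G" using ts car by simp
      have cup: "\<Union>?V = ?M #> x" using sat RM by simp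
      have "\<Union>(topspace ?S) \<subseteq> carrier G" using ts car r_coset_subset_G[OF R.subset] by blast
      then have "\<Union>(topspace ?S - ?V) \<subseteq> carrier G" by blast
      moreover have "z \<in> \<Union>(topspace ?S - ?V) \<longleftrightarrow> z \<notin> ?M #> x" if z: "z \<in> carrier G" for z
        using mem[OF z W] mem[OF z V] z by (simp add: cup ts car)
      ultimately show ?thesis by blast
    qed
    ultimately have "openin ?S (topspace ?S - ?V)" by (simp add: openq ts car)
    moreover have "X \<in> ?V" using xy rcos_self[OF xy(1) sM] by blast
    moreover have "Y \<notin> ?V"
    proof
      assume "Y \<in> ?V"
      then obtain m where m: "m \<in> ?M" "R #> y = R #> (m \<otimes> x)" using xy by (auto simp: r_coset_def)
      have mc: "m \<in> carrier G" using m subgroup.mem_carrier[OF sM] by blast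
      have "y \<otimes> inv (m \<otimes> x) \<in> R" using m(2) r_coset_eq_iff[OF sR] xy mc by simp
      then have "y \<otimes> inv (m \<otimes> x) \<in> ?M" using NM by blast
      then have "(y \<otimes> inv (m \<otimes> x)) \<otimes> m \<in> ?M" using m subgroup.m_closed[OF sM] by blast
      then have "y \<otimes> inv x \<in> ?M" using xy mc by (simp add: inv_mult_group m_assoc)
      then obtain n r where nr: "n \<in> N" "r \<in> R" "y \<otimes> inv x = n \<otimes> r" by (auto simp: set_mult_iff)
      have "inv n \<otimes> (y \<otimes> inv x) = r" using nr ONS_D(4)[OF N(1)] R.mem_carrier by auto
      moreover have "inv n \<in> N" using nr ONS_D(2)[OF N(1)] by (simp add: subgroup.m_inv_closed)
      ultimately show False using N(2) nr by metis
    qed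
    ultimately show ?thesis using oV ts XY by blast
  qed
  have "Hausdorff_space ?S"
    unfolding Hausdorff_space_def
  proof clarify
    fix X Y assume "X \<in> topspace ?S" "Y \<in> topspace ?S" "X \<noteq> Y"
    then obtain V where "openin ?S V" "openin ?S (topspace ?S - V)" "X \<in> V" "Y \<in> topspace ?S - V"
      using sep ts by metis
    then show "\<exists>U V. openin ?S U \<and> openin ?S V \<and> X \<in> U \<and> Y \<in> V \<and> disjnt U V"
      by (intro exI[of _ V] exI[of _ "topspace ?S - V"]) (auto simp: disjnt_def)
  qed
  moreover have "totally_disconnected_space ?S"
    unfolding totally_disconnected_space_def
  proof (intro allI impI)
    fix C assume C: "connectedin ?S C"
    have "X = Y" if XY: "X \<in> C" "Y \<in> C" for X Y
    proof (rule ccontr)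
      assume ne: "X \<noteq> Y"
      have "C \<subseteq> topspace ?S" using C connectedin_subset_topspace by blast
      then obtain V where "openin ?S V" "openin ?S (topspace ?S - V)" "X \<in> V" "Y \<in> topspace ?S - V"
        using sep[of X Y] XY ne ts by auto
      moreover from this have "V \<inter> (topspace ?S - V) \<inter> C = {}" "C \<subseteq> V \<union> (topspace ?S - V)"
        using \<open>C \<subseteq> topspace ?S\<close> by auto
      ultimately show False using C XY unfolding connectedin by blast
    qed
    then show "\<exists>x. C \<subseteq> {x}" by blast
  qed
  moreover have "compact_space ?S" 
    using image_compactin[OF _ cm, of "carrier G"] compact quotient_imp_surjective_map[OF qm]
    by (simp add: compact_space_def)
  ultimately show ?thesis
    using R.factorgroup_is_group ts mult inverse by (simp add: profinite_group_def topological_group_def)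
qed

end

section \<open>Regular Borel measures from contents on clopen sets\<close>

definition clopenin :: "'a topology \<Rightarrow> 'a set \<Rightarrow> bool" where
  "clopenin X A \<longleftrightarrow> openin X A \<and> closedin X A"

lemma clopenin_simps:
  "clopenin X {}" "clopenin X (topspace X)"
  "clopenin X A \<Longrightarrow> clopenin X B \<Longrightarrow> clopenin X (A \<union> B)"
  "clopenin X A \<Longrightarrow> clopenin X B \<Longrightarrow> clopenin X (A \<inter> B)"
  "clopenin X A \<Longrightarrow> clopenin X B \<Longrightarrow> clopenin X (A - B)"
  by (auto simp: clopenin_def)

text \<open>Compact Hausdorff spaces with a base of clopen sets.\<close>

definition stone_space :: "'a topology \<Rightarrow> bool" where
  "stone_space X \<longleftrightarrow> compact_space X \<and> Hausdorff_space X \<and>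
     (\<forall>U x. openin X U \<and> x \<in> U \<longrightarrow> (\<exists>A. clopenin X A \<and> x \<in> A \<and> A \<subseteq> U))"

lemma stone_space_profinite: "profinite_group G T \<Longrightarrow> stone_space T"
  using clopen_base[of T] by (auto simp: stone_space_def profinite_group_def clopenin_def)

lemma clopen_between:
  assumes X: "stone_space X" and K: "closedin X K" and U: "openin X U" "K \<subseteq> U"
  shows "\<exists>A. clopenin X A \<and> K \<subseteq> A \<and> A \<subseteq> U"
proof -
  have "\<exists>A. clopenin X A \<and> x \<in> A \<and> A \<subseteq> U" if "x \<in> K" for x
    using X U that unfolding stone_space_def by blast
  then obtain A where A: "\<And>x. x \<in> K \<Longrightarrow> clopenin X (A x) \<and> x \<in> A x \<and> A x \<subseteq> U" by metis
  have "compactin X K" using X K closedin_compact_space unfolding stone_space_def by blast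
  then obtain F where F: "finite F" "F \<subseteq> A ` K" "K \<subseteq> \<Union>F"
    using compactinD[of X K "A ` K"] A unfolding clopenin_def by blast
  have "clopenin X (\<Union>F)"
    using F(1) F(2)
  proof (induction F)
    case (insert B F)
    then show ?case using A by (auto intro!: clopenin_simps(3))
  qed (simp add: clopenin_simps)
  then show ?thesis using F A by blast
qed

lemma stone_space_prod:
  assumes "stone_space X" "stone_space Y"
  shows "stone_space (prod_topology X Y)"
  unfolding stone_space_def
proof (intro conjI allI impI)
  show "compact_space (prod_topology X Y)" "Hausdorff_space (prod_topology X Y)"
    using assms by (simp_all add: stone_space_def compact_space_prod_topology Hausdorff_space_prod_topology)
  fix U z assume Uz: "openin (prod_topology X Y) U \<and> z \<in> U"
  obtain x y where z: "z = (x, y)" by force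
  obtain V W where VW: "openin X V" "openin Y W" "x \<in> V" "y \<in> W" "V \<times> W \<subseteq> U"
    using Uz[unfolded openin_prod_topology_alt] z by blast
  obtain A where A: "clopenin X A" "x \<in> A" "A \<subseteq> V" using assms(1) VW unfolding stone_space_def by blast
  obtain B where B: "clopenin Y B" "y \<in> B" "B \<subseteq> W" using assms(2) VW unfolding stone_space_def by blast
  have "clopenin (prod_topology X Y) (A \<times> B)"
    using A B by (simp add: clopenin_def openin_prod_Times_iff closedin_prod_Times_iff)
  then show "\<exists>A. clopenin (prod_topology X Y) A \<and> z \<in> A \<and> A \<subseteq> U"
    using A B VW z by (intro exI[of _ "A \<times> B"]) auto
qed

lemma space_borel_of [simp]: "space (borel_of X) = topspace X"
  unfolding borel_of_def by (rule space_measure_of) (use openin_subset in auto)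

lemma sets_borel_of: "sets (borel_of X) = sigma_sets (topspace X) {U. openin X U}"
  unfolding borel_of_def by (rule sets_measure_of) (use openin_subset in auto)

lemma borel_of_open: "openin X U \<Longrightarrow> U \<in> sets (borel_of X)"
  unfolding sets_borel_of by (rule sigma_sets.Basic) simp

lemma borel_of_closed: "closedin X C \<Longrightarrow> C \<in> sets (borel_of X)"
  using borel_of_open[of X "topspace X - C"] sets.compl_sets[of "topspace X - C" "borel_of X"]
  by (simp add: closedin_def double_diff)

lemma measurable_borel_of:
  assumes "continuous_map X Y f" shows "f \<in> measurable (borel_of X) (borel_of Y)"
proof (rule measurable_sigma_sets[OF sets_borel_of])
  show "{U. openin Y U} \<subseteq> Pow (topspace Y)" using openin_subset by auto
  show "f \<in> space (borel_of X) \<rightarrow> topspace Y" using assms by (simp add: continuous_map_def)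
  fix U assume "U \<in> {U. openin Y U}"
  then have "openin X {x \<in> topspace X. f x \<in> U}" using assms openin_continuous_map_preimage by blast
  moreover have "f -` U \<inter> space (borel_of X) = {x \<in> topspace X. f x \<in> U}" by auto
  ultimately show "f -` U \<inter> space (borel_of X) \<in> sets (borel_of X)" using borel_of_open by auto
qed

text \<open>The inner measure of open sets, and the outer measure of all sets, that a content \<open>m\<close> on the clopen
  sets determines.\<close>

definition clopen_sup :: "'a topology \<Rightarrow> ('a set \<Rightarrow> ennreal) \<Rightarrow> 'a set \<Rightarrow> ennreal" where
  "clopen_sup X m U = (SUP A\<in>{A. clopenin X A \<and> A \<subseteq> U}. m A)"

definition open_inf :: "'a topology \<Rightarrow> ('a set \<Rightarrow> ennreal) \<Rightarrow> 'a set \<Rightarrow> ennreal" where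
  "open_inf X f E = (INF U\<in>{U. openin X U \<and> E \<subseteq> U}. f U)"

locale clopen_content =
  fixes X :: "'a topology" and m :: "'a set \<Rightarrow> ennreal"
  assumes X: "stone_space X"
    and add: "\<And>A B. clopenin X A \<Longrightarrow> clopenin X B \<Longrightarrow> A \<inter> B = {} \<Longrightarrow> m (A \<union> B) = m A + m B"
    and fin: "m (topspace X) < \<infinity>"
begin

abbreviation "lam \<equiv> clopen_sup X m"
abbreviation "out \<equiv> open_inf X lam"

lemma m_Diff: "clopenin X A \<Longrightarrow> clopenin X B \<Longrightarrow> A \<subseteq> B \<Longrightarrow> m B = m A + m (B - A)"
  using add[of A "B - A"] clopenin_simps(5)[of X B A] by (simp add: Un_absorb1)

lemma m_mono: "clopenin X A \<Longrightarrow> clopenin X B \<Longrightarrow> A \<subseteq> B \<Longrightarrow> m A \<le> m B"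
  using m_Diff[of A B] by (metis le_iff_add)

lemma m_finite: assumes "clopenin X A" shows "m A < \<infinity>"
proof -
  have "A \<subseteq> topspace X" using assms openin_subset by (auto simp: clopenin_def)
  then show ?thesis using m_mono[OF assms clopenin_simps(2)] fin order_le_less_trans by blast
qed

lemma m_empty: "m {} = 0"
proof -
  have "m ({} \<union> {}) = m {} + m {}" by (rule add) (simp_all add: clopenin_simps)
  then have "m {} + m {} = m {} + 0" by (metis Un_empty_left add.right_neutral)
  then show ?thesis
    using m_finite[OF clopenin_simps(1)] unfolding infinity_ennreal_def ennreal_add_left_cancel
    by (elim disjE) simp_all
qed

lemma lam_mono: "U \<subseteq> V \<Longrightarrow> lam U \<le> lam V"
  unfolding clopen_sup_def by (rule SUP_subset_mono) auto

lemma lam_upper: "clopenin X A \<Longrightarrow> A \<subseteq> U \<Longrightarrow> m A \<le> lam U"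
  unfolding clopen_sup_def by (rule SUP_upper) simp

lemma lam_least: "(\<And>A. clopenin X A \<Longrightarrow> A \<subseteq> U \<Longrightarrow> m A \<le> c) \<Longrightarrow> lam U \<le> c"
  unfolding clopen_sup_def by (rule SUP_least) simp

lemma lam_clopen: "clopenin X A \<Longrightarrow> lam A = m A"
  by (intro antisym lam_least lam_upper m_mono) auto

lemma out_mono: "E \<subseteq> F \<Longrightarrow> out E \<le> out F"
  unfolding open_inf_def by (rule INF_superset_mono) auto

lemma out_open: "openin X U \<Longrightarrow> out U = lam U"
  unfolding open_inf_def by (intro antisym INF_lower INF_greatest lam_mono) auto

lemma out_le: "openin X U \<Longrightarrow> E \<subseteq> U \<Longrightarrow> out E \<le> lam U"
  unfolding open_inf_def by (rule INF_lower) simp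

text \<open>A clopen subset of \<open>U \<union> V\<close> is cut by a clopen set between \<open>A - V\<close> and \<open>U\<close> into pieces in \<open>U\<close> and in \<open>V\<close>.\<close>

lemma lam_Un:
  assumes "openin X U" "openin X V" shows "lam (U \<union> V) \<le> lam U + lam V"
proof (rule lam_least)
  fix A assume A: "clopenin X A" "A \<subseteq> U \<union> V"
  have "closedin X (A - V)" "openin X (U \<inter> A)" "A - V \<subseteq> U \<inter> A"
    using A assms by (auto simp: clopenin_def)
  then obtain B where B: "clopenin X B" "A - V \<subseteq> B" "B \<subseteq> U \<inter> A"
    using clopen_between[OF X] by metis
  have "m A = m B + m (A - B)" using m_Diff[OF B(1) A(1)] B by blast
  also have "\<dots> \<le> lam U + lam V"
    using B A by (intro add_mono lam_upper clopenin_simps) auto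
  finally show "m A \<le> lam U + lam V" .
qed

lemma lam_UN_finite:
  fixes n :: nat
  assumes "\<And>i. openin X (U i)" shows "lam (\<Union>i<n. U i) \<le> (\<Sum>i<n. lam (U i))"
proof (induction n)
  case 0 show ?case using lam_clopen[of "{}"] by (simp add: clopenin_simps m_empty)
next
  case (Suc n)
  have "lam (\<Union>i<Suc n. U i) \<le> lam (\<Union>i<n. U i) + lam (U n)"
    using lam_Un[of "\<Union>i<n. U i" "U n"] assms by (auto simp: lessThan_Suc Un_commute)
  also have "\<dots> \<le> (\<Sum>i<Suc n. lam (U i))" using Suc by (simp add: add_mono)
  finally show ?case .
qed

text \<open>A clopen set is compact, so finitely many members of an open cover suffice for it.\<close>

lemma lam_UN:
  assumes U: "\<And>i. openin X (U i)" shows "lam (\<Union>i::nat. U i) \<le> (\<Sum>i. lam (U i))"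
proof (rule lam_least)
  fix A assume A: "clopenin X A" "A \<subseteq> (\<Union>i. U i)"
  have "compactin X A" using X A closedin_compact_space unfolding stone_space_def clopenin_def by blast
  then obtain F where F: "finite F" "F \<subseteq> range U" "A \<subseteq> \<Union>F"
    using compactinD[of X A "range U"] U A by blast
  then obtain I where I: "finite I" "F = U ` I" by (metis finite_subset_image)
  then obtain n where n: "I \<subseteq> {..<n}" using finite_nat_iff_bounded by blast
  have "m A \<le> lam (\<Union>i<n. U i)" using F I n by (intro lam_upper A) blast
  also have "\<dots> \<le> (\<Sum>i<n. lam (U i))" using lam_UN_finite U by blast
  also have "\<dots> \<le> (\<Sum>i. lam (U i))" by (rule sum_le_suminf) auto
  finally show "m A \<le> (\<Sum>i. lam (U i))" .
qed

lemma out_countably_subadditive: "countably_subadditive (Pow (topspace X)) out"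
proof (simp add: countably_subadditive_def, safe)
  fix A :: "nat \<Rightarrow> _" assume A: "range A \<subseteq> Pow (topspace X)"
  show "out (\<Union>i. A i) \<le> (\<Sum>n. out (A n))"
  proof (rule ennreal_le_epsilon)
    fix e :: real assume e: "0 < e" "(\<Sum>n. out (A n)) < Orderings.top"
    then have *: "\<And>n. out (A n) < out (A n) + e * (1/2)^Suc n"
      by (auto simp add: less_top dest!: ennreal_suminf_lessD)
    have "\<exists>U. openin X U \<and> A n \<subseteq> U \<and> lam U \<le> out (A n) + e * (1/2)^Suc n" for n
    proof -
      have "\<exists>U. openin X U \<and> E \<subseteq> U \<and> lam U \<le> c" if "out E < c" for E c
        using that unfolding open_inf_def INF_less_iff by (auto intro: less_imp_le)
      then show ?thesis using *[of n] by blast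
    qed
    then obtain U where U: "\<And>n. openin X (U n)" "\<And>n. A n \<subseteq> U n" "\<And>n. lam (U n) \<le> out (A n) + e * (1/2)^Suc n"
      by metis
    have "out (\<Union>i. A i) \<le> lam (\<Union>i. U i)" using U by (intro out_le) auto
    also have "\<dots> \<le> (\<Sum>i. lam (U i))" using lam_UN U by blast
    also have "\<dots> \<le> (\<Sum>n. out (A n) + e * (1/2) ^ Suc n)"
      by (intro suminf_le allI U) auto
    also have "... = (\<Sum>n. out (A n)) + (\<Sum>n. ennreal e * ennreal ((1/2) ^ Suc n))"
      using \<open>0 < e\<close> by (subst suminf_add[symmetric])
                       (auto simp del: ennreal_suminf_cmult simp add: ennreal_mult[symmetric])
    also have "\<dots> = (\<Sum>n. out (A n)) + e"
      unfolding ennreal_suminf_cmult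
      by (subst suminf_ennreal_eq[OF zero_le_power power_half_series]) auto
    finally show "out (\<Union>i. A i) \<le> (\<Sum>n. out (A n)) + e" .
  qed
qed

text \<open>Fill \<open>W \<inter> U\<close> up to a small error by a clopen \<open>A\<close>; the rest of \<open>W\<close> is covered by the open set \<open>W - A\<close>, whose
  clopen subsets are disjoint from \<open>A\<close>. This is Caratheodory's condition for \<open>U\<close>, tested on open sets.\<close>

lemma out_split_le:
  assumes U: "openin X U" and W: "openin X W"
  shows "lam (W \<inter> U) + out (W - U) \<le> lam W"
proof -
  have "m A + out (W - U) \<le> lam W" if A: "clopenin X A" "A \<subseteq> W \<inter> U" for A
  proof -
    have AB: "m A + m B \<le> lam W" if B: "clopenin X B" "B \<subseteq> W - A" for B
    proof -
      have "m A + m B = m (A \<union> B)" using B by (intro add[symmetric] A(1)) auto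
      also have "\<dots> \<le> lam W" using A B by (intro lam_upper clopenin_simps) auto
      finally show ?thesis .
    qed
    have "lam (W - A) \<le> lam W - m A"
    proof (rule lam_least)
      fix B assume "clopenin X B" "B \<subseteq> W - A"
      then have "m A + m B \<le> lam W" using AB by blast
      then show "m B \<le> lam W - m A" using m_finite[OF A(1)] by (simp add: ennreal_le_minus_iff add.commute less_top)
    qed
    moreover have "out (W - U) \<le> lam (W - A)" using A W by (intro out_le) (auto simp: clopenin_def)
    moreover have "m A \<le> lam W" using A by (intro lam_upper) auto
    ultimately have "m A + out (W - U) \<le> m A + (lam W - m A)" by (meson add_left_mono order_trans)
    also have "\<dots> = lam W" using \<open>m A \<le> lam W\<close> by (simp add: add_diff_inverse_ennreal)
    finally show ?thesis .
  qed
  then have le: "m A \<le> lam W - out (W - U)" if "clopenin X A" "A \<subseteq> W \<inter> U" for A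
    using that by (simp add: ennreal_le_minus_iff)
  have outW: "out (W - U) \<le> lam W" using W by (intro out_le) auto
  have "lam (W \<inter> U) \<le> lam W - out (W - U)" using le by (rule lam_least)
  then have "lam (W \<inter> U) + out (W - U) \<le> (lam W - out (W - U)) + out (W - U)" by (rule add_right_mono)
  also have "\<dots> = lam W" using outW by (simp add: diff_add_cancel_ennreal)
  finally show ?thesis .
qed

lemma open_measurable:
  assumes U: "openin X U" shows "U \<in> lambda_system (topspace X) (Pow (topspace X)) out"
proof -
  interpret P: Sigma_Algebra.algebra "topspace X" "Pow (topspace X)" by (rule algebra_Pow)
  have "out (E \<inter> U) + out (E - U) = out E" if E: "E \<subseteq> topspace X" for E
  proof (rule antisym)
    show "out (E \<inter> U) + out (E - U) \<le> out E"
      unfolding open_inf_def[of X lam E]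
    proof (rule INF_greatest, clarify)
      fix W assume W: "openin X W" "E \<subseteq> W"
      have "out (E \<inter> U) + out (E - U) \<le> lam (W \<inter> U) + out (W - U)"
        using W U by (intro add_mono out_le out_mono) auto
      then show "out (E \<inter> U) + out (E - U) \<le> lam W" using out_split_le[OF U W(1)] by (rule order_trans)
    qed
    have "positive (Pow (topspace X)) out"
      using out_open[of "{}"] lam_clopen[of "{}"] by (simp add: positive_def clopenin_simps m_empty)
    then have "subadditive (Pow (topspace X)) out"
      using P.countably_subadditive_subadditive[OF _ out_countably_subadditive] by blast
    from Measure_Space.subadditiveD[OF this, of "E \<inter> U" "E - U"] show "out E \<le> out (E \<inter> U) + out (E - U)"
      using E by (auto simp: Int_Diff_Un)
  qed
  then show ?thesis using openin_subset[OF U] by (auto simp: P.lambda_system_eq)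
qed

text \<open>Open sets are measurable for the outer measure, so it restricts to a Borel measure. It is outer
  regular by definition and inner regular on open sets because clopen sets are compact. As
  the outer measure is built from covers by single open sets, it measures all Borel sets and not only
  those generated by the clopen sets.\<close>

theorem regular_extension:
  "\<exists>M. regular_borel_measure X M \<and> (\<forall>A. clopenin X A \<longrightarrow> emeasure M A = m A) \<and>
       (\<forall>U. openin X U \<longrightarrow> emeasure M U = lam U)"
proof -
  let ?\<Omega> = "topspace X" and ?O = "{U. openin X U}"
  have pos: "positive (Pow ?\<Omega>) out"
    using out_open[of "{}"] lam_clopen[of "{}"] by (simp add: positive_def clopenin_simps m_empty)
  have "outer_measure_space (Pow ?\<Omega>) out"
    using pos out_countably_subadditive out_mono by (simp add: outer_measure_space_def increasing_def)
  then have ms: "measure_space ?\<Omega> (lambda_system ?\<Omega> (Pow ?\<Omega>) out) out"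
    by (rule sigma_algebra.caratheodory_lemma[OF sigma_algebra_Pow])
  have "?O \<subseteq> lambda_system ?\<Omega> (Pow ?\<Omega>) out" using open_measurable by blast
  then have sub: "sigma_sets ?\<Omega> ?O \<subseteq> lambda_system ?\<Omega> (Pow ?\<Omega>) out"
    using ms by (intro sigma_algebra.sigma_sets_subset) (simp_all add: measure_space_def)
  have OP: "?O \<subseteq> Pow ?\<Omega>" using openin_subset by auto
  have ms': "measure_space ?\<Omega> (sigma_sets ?\<Omega> ?O) out"
    by (rule measure_down[OF ms sigma_algebra_sigma_sets[OF OP] sub])
  define M where "M = measure_of ?\<Omega> ?O out"
  have sM: "sets M = sets (borel_of X)" unfolding M_def borel_of_def using OP by (simp add: sets_measure_of)
  have eM: "emeasure M A = out A" if "A \<in> sets M" for A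
  proof -
    have "A \<in> sigma_sets ?\<Omega> ?O" using that OP by (simp add: M_def sets_measure_of)
    then show ?thesis unfolding M_def
      using ms' OP by (intro emeasure_measure_of[OF refl]) (auto simp: measure_space_def sets_measure_of)
  qed
  have eO: "emeasure M U = lam U" if "openin X U" for U
    using that eM[of U] borel_of_open[OF that] sM out_open[OF that] by simp
  have "regular_borel_measure X M"
    unfolding regular_borel_measure_def
  proof (intro conjI ballI allI impI sM)
    fix A assume A: "A \<in> sets M"
    show "emeasure M A = (INF U\<in>{U. openin X U \<and> A \<subseteq> U}. emeasure M U)"
      unfolding eM[OF A] open_inf_def using eO by (intro INF_cong) auto
  next
    fix U assume U: "openin X U"
    show "emeasure M U = (SUP K\<in>{K. compactin X K \<and> K \<subseteq> U}. emeasure M K)"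
    proof (rule antisym)
      have "m A \<le> (SUP K\<in>{K. compactin X K \<and> K \<subseteq> U}. emeasure M K)" if A: "clopenin X A" "A \<subseteq> U" for A
      proof -
        have "compactin X A" using X A closedin_compact_space unfolding stone_space_def clopenin_def by blast
        moreover have "m A = emeasure M A" using eO lam_clopen A by (simp add: clopenin_def)
        ultimately show ?thesis using A by (auto intro!: SUP_upper2)
      qed
      then show "emeasure M U \<le> (SUP K\<in>{K. compactin X K \<and> K \<subseteq> U}. emeasure M K)"
        unfolding eO[OF U] by (rule lam_least)
      show "(SUP K\<in>{K. compactin X K \<and> K \<subseteq> U}. emeasure M K) \<le> emeasure M U"
        using borel_of_open[OF U] sM by (auto intro!: SUP_least emeasure_mono)
    qed
  qed
  then show ?thesis using eO lam_clopen by (auto simp: clopenin_def)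
qed

end

section \<open>Haar measure of a profinite group\<close>

context group
begin

lemma l_coset_image: "x <# A = (\<lambda>a. x \<otimes> a) ` A"
  by (auto simp: l_coset_def)

lemma l_coset_inverse:
  assumes "x \<in> carrier G" "A \<subseteq> carrier G"
  shows "inv x <# (x <# A) = A" "x <# (inv x <# A) = A"
  using assms by (simp_all add: lcos_m_assoc lcos_mult_one)

end

context profinite
begin

text \<open>The proportion of the cosets of \<open>N\<close> that are contained in \<open>A\<close>, for \<open>A\<close> a union of such cosets.\<close>

definition density :: "'a set \<Rightarrow> 'a set \<Rightarrow> real" where
  "density N A = real (rel_index A N) / real (rel_index (carrier G) N)"

definition stable :: "'a set \<Rightarrow> 'a set \<Rightarrow> bool" where
  "stable N A \<longleftrightarrow> N \<in> ONS \<and> A \<subseteq> carrier G \<and> (\<forall>n\<in>N. \<forall>a\<in>A. n \<otimes> a \<in> A)"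

definition haar_content :: "'a set \<Rightarrow> ennreal" where
  "haar_content A = ennreal (density (SOME N. stable N A) A)"

lemma clopen_carrier: "clopenin T A \<Longrightarrow> A \<subseteq> carrier G"
  using open_carrier by (auto simp: clopenin_def)

text \<open>By compactness of \<open>A\<close>, the elements \<open>x\<close> with \<open>x A \<subseteq> A\<close> form a neighbourhood of \<open>1\<close>.\<close>

lemma stable_exists:
  assumes "clopenin T A" shows "\<exists>N. stable N A"
proof -
  have A: "openin T A" "closedin T A" "A \<subseteq> carrier G" using assms clopen_carrier by (auto simp: clopenin_def)
  have "continuous_map (prod_topology T T) T (\<lambda>z. snd z \<otimes> fst z)" by (intro continuous_group)
  then have "openin T {x \<in> topspace T. \<forall>a\<in>A. snd (a, x) \<otimes> fst (a, x) \<in> A}"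
    by (rule openin_compact_forall[OF closed_compact[OF A(2)] _ A(1)])
  then have "openin T {x \<in> carrier G. \<forall>a\<in>A. x \<otimes> a \<in> A}" by simp
  moreover have "\<one> \<in> {x \<in> carrier G. \<forall>a\<in>A. x \<otimes> a \<in> A}" using A(3) by auto
  ultimately obtain N where "N \<in> ONS" "N \<subseteq> {x \<in> carrier G. \<forall>a\<in>A. x \<otimes> a \<in> A}"
    using ONS_base by blast
  then show ?thesis using A(3) unfolding stable_def by blast
qed

lemma rel_index_pos:
  assumes "N \<in> ONS" "B \<subseteq> carrier G" "B \<noteq> {}" shows "rel_index B N > 0"
  using finite_image_coset[OF ONS_finite_index[OF assms(1)] assms(2)] assms(3) by (simp add: rel_index_def card_gt_0_iff)

lemma density_mono:
  assumes N: "stable N A" and M: "M \<in> ONS" "M \<subseteq> N"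
  shows "density M A = density N A"
proof -
  have N': "N \<in> ONS" using N by (simp add: stable_def)
  note tower = rel_index_tower[OF ONS_D(2)[OF M(1)] ONS_D(2)[OF N'] M(2) ONS_finite_index[OF M(1)]]
  have "rel_index A M = rel_index A N * rel_index N M"
    by (rule tower) (use N in \<open>auto simp: stable_def\<close>)
  moreover have "rel_index (carrier G) M = rel_index (carrier G) N * rel_index N M"
    by (rule tower) (use ONS_D(4)[OF N'] in auto)
  moreover have "rel_index N M > 0" using rel_index_pos[OF M(1) ONS_D(4)[OF N']] ONS_D(5)[OF N'] by blast
  ultimately show ?thesis by (simp add: density_def)
qed

lemma stable_mono: "stable N A \<Longrightarrow> M \<in> ONS \<Longrightarrow> M \<subseteq> N \<Longrightarrow> stable M A"
  by (auto simp: stable_def)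

lemma haar_content_eq:
  assumes "stable N A" shows "haar_content A = ennreal (density N A)"
proof -
  let ?M = "SOME N. stable N A"
  have M: "stable ?M A" using assms by (rule someI)
  have "N \<inter> ?M \<in> ONS" using assms M ONS_Int by (simp add: stable_def)
  then have "density ?M A = density N A" using density_mono[OF assms, of "N \<inter> ?M"] density_mono[OF M, of "N \<inter> ?M"] by simp
  then show ?thesis by (simp add: haar_content_def)
qed

lemma haar_content_add:
  assumes "clopenin T A" "clopenin T B" "A \<inter> B = {}"
  shows "haar_content (A \<union> B) = haar_content A + haar_content B"
proof -
  obtain N1 N2 where N: "stable N1 A" "stable N2 B" using stable_exists assms by blast
  let ?N = "N1 \<inter> N2"
  have N': "?N \<in> ONS" using N ONS_Int by (simp add: stable_def)
  have sA: "stable ?N A" and sB: "stable ?N B" using stable_mono[OF N(1) N'] stable_mono[OF N(2) N'] by auto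
  then have sAB: "stable ?N (A \<union> B)" by (auto simp: stable_def)
  let ?f = "\<lambda>b. ?N #> b"
  have c: "A \<subseteq> carrier G" "B \<subseteq> carrier G" using sA sB by (auto simp: stable_def)
  have "?f ` A \<inter> ?f ` B = {}"
  proof (rule ccontr)
    assume "?f ` A \<inter> ?f ` B \<noteq> {}"
    then obtain a b where ab: "a \<in> A" "b \<in> B" "?f a = ?f b" by blast
    have "a \<otimes> inv b \<in> ?N" using r_coset_eq_iff[OF ONS_D(2)[OF N']] ab c by blast
    then have "(a \<otimes> inv b) \<otimes> b \<in> B" using sB ab(2) unfolding stable_def by blast
    then have "a \<in> B" using ab c by (auto simp: m_assoc subset_iff)
    then show False using ab assms(3) by blast
  qed
  then have "rel_index (A \<union> B) ?N = rel_index A ?N + rel_index B ?N"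
    unfolding rel_index_def image_Un
    using finite_image_coset[OF ONS_finite_index[OF N']] c by (intro card_Un_disjoint) auto
  then have "density ?N (A \<union> B) = density ?N A + density ?N B" by (simp add: density_def add_divide_distrib)
  then show ?thesis
    unfolding haar_content_eq[OF sA] haar_content_eq[OF sB] haar_content_eq[OF sAB]
    by (simp add: density_def ennreal_plus)
qed

lemma haar_content_carrier: "haar_content (carrier G) = 1"
proof -
  have "stable (carrier G) (carrier G)" using ONS_carrier by (auto simp: stable_def)
  moreover have "rel_index (carrier G) (carrier G) > 0" using rel_index_pos[OF ONS_carrier] by auto
  ultimately show ?thesis by (simp add: haar_content_eq density_def)
qed

text \<open>Conjugation by \<open>x\<close> preserves \<open>N\<close>, so left translation by \<open>x\<close> permutes the cosets of \<open>N\<close>.\<close>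

lemma haar_content_translate:
  assumes A: "clopenin T A" and x: "x \<in> carrier G"
  shows "haar_content (x <# A) = haar_content A"
proof -
  obtain N where N: "stable N A" using stable_exists A by blast
  have N': "N \<in> ONS" and Ac: "A \<subseteq> carrier G" using N by (auto simp: stable_def)
  have "n \<otimes> (x \<otimes> a) \<in> x <# A" if na: "n \<in> N" "a \<in> A" for n a
  proof -
    have c: "n \<in> carrier G" "a \<in> carrier G" using na Ac ONS_D(4)[OF N'] by auto
    have "inv x \<otimes> n \<otimes> x \<in> N" using ONS_conj[OF N' na(1), of "inv x"] x by simp
    then have "(inv x \<otimes> n \<otimes> x) \<otimes> a \<in> A" using N na by (auto simp: stable_def)
    moreover have "n \<otimes> (x \<otimes> a) = x \<otimes> ((inv x \<otimes> n \<otimes> x) \<otimes> a)" using c x by (simp add: m_assoc)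
    ultimately show ?thesis by (auto simp: l_coset_image)
  qed
  then have sx: "stable N (x <# A)" using N' Ac x by (auto simp: stable_def l_coset_image)
  have "rel_index (x <# A) N = card ((\<lambda>a. N #> (x \<otimes> a)) ` A)"
    by (simp add: rel_index_def l_coset_image image_image)
  also have "\<dots> = rel_index A N"
    unfolding rel_index_def
  proof (rule card_image_eq_if_same_kernel)
    fix a b assume "a \<in> A" "b \<in> A"
    then have c: "a \<in> carrier G" "b \<in> carrier G" using Ac by auto
    have "(x \<otimes> a) \<otimes> inv (x \<otimes> b) = x \<otimes> (a \<otimes> inv b) \<otimes> inv x" using x c by (simp add: inv_mult_group m_assoc)
    moreover have "x \<otimes> (a \<otimes> inv b) \<otimes> inv x \<in> N \<longleftrightarrow> a \<otimes> inv b \<in> N"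
    proof
      assume "x \<otimes> (a \<otimes> inv b) \<otimes> inv x \<in> N"
      from ONS_conj[OF N' this, of "inv x"] show "a \<otimes> inv b \<in> N" using x c by (simp add: m_assoc)
    qed (use ONS_conj[OF N' _ x] in blast)
    ultimately show "N #> (x \<otimes> a) = N #> (x \<otimes> b) \<longleftrightarrow> N #> a = N #> b"
      using x c ONS_D(2)[OF N'] by (simp add: r_coset_eq_iff)
  qed
  finally show ?thesis by (simp add: haar_content_eq[OF N] haar_content_eq[OF sx] density_def)
qed

lemma clopen_translate:
  assumes "clopenin T A" "x \<in> carrier G" shows "clopenin T (x <# A)"
proof -
  have A: "openin T A" "closedin T A" "A \<subseteq> carrier G" using assms clopen_carrier by (auto simp: clopenin_def)
  have "openin T (x <# (carrier G - A))"
    using open_translate[OF _ assms(2)] openin_diff[OF openin_topspace A(2)] by simp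
  moreover have "x <# (carrier G - A) = carrier G - (x <# A)"
  proof -
    have "x <# carrier G = carrier G" using assms(2)
    proof (intro equalityI subsetI)
      fix y assume "y \<in> carrier G"
      then have "y = x \<otimes> (inv x \<otimes> y)" "inv x \<otimes> y \<in> carrier G" using assms(2) by simp_all
      then show "y \<in> x <# carrier G" unfolding l_coset_image by blast
    qed (auto simp: l_coset_image)
    moreover have "inj_on (\<lambda>a. x \<otimes> a) (carrier G)" using assms(2) by (simp add: inj_on_def)
    ultimately show ?thesis using A(3) unfolding l_coset_image by (simp add: inj_on_image_set_diff)
  qed
  moreover have "x <# A \<subseteq> carrier G" using A assms(2) by (auto simp: l_coset_image)
  ultimately show ?thesis using open_translate[OF A(1) assms(2)] by (simp add: clopenin_def closedin_def)
qed

text \<open>Left translation preserves the content, hence the inner measure of open sets, hence by outer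
  regularity the measure of all Borel sets.\<close>

lemma haar_exists: "\<exists>M. is_normalized_haar_measure G T M"
proof -
  interpret clopen_content T haar_content
    using stone_space_profinite[OF profinite] haar_content_add haar_content_carrier by unfold_locales auto
  obtain M where M: "regular_borel_measure T M" "\<And>A. clopenin T A \<Longrightarrow> emeasure M A = haar_content A"
    "\<And>U. openin T U \<Longrightarrow> emeasure M U = clopen_sup T haar_content U" using regular_extension by blast
  have lam_le: "clopen_sup T haar_content (x <# U) \<le> clopen_sup T haar_content U"
    if x: "x \<in> carrier G" and U: "U \<subseteq> carrier G" for x U
  proof (rule lam_least)
    fix A assume A: "clopenin T A" "A \<subseteq> x <# U"
    have "inv x <# A \<subseteq> inv x <# (x <# U)" using A(2) unfolding l_coset_image by blast
    then have "inv x <# A \<subseteq> U" using l_coset_inverse[OF x U] by simp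
    then have "haar_content (inv x <# A) \<le> clopen_sup T haar_content U"
      using clopen_translate[OF A(1), of "inv x"] x by (intro lam_upper) auto
    then show "haar_content A \<le> clopen_sup T haar_content U" using haar_content_translate[OF A(1), of "inv x"] x by simp
  qed
  have sM: "sets M = sets (borel_of T)" using M(1) by (simp add: regular_borel_measure_def)
  have tr: "x <# A \<in> sets M" if x: "x \<in> carrier G" and A: "A \<in> sets M" for x A
  proof -
    have Ac: "A \<subseteq> carrier G" using sets.sets_into_space[OF A] sets_eq_imp_space_eq[OF sM] by simp
    have "continuous_map T T (\<lambda>y. inv x \<otimes> y)" using x by (intro continuous_group) auto
    then have "(\<lambda>y. inv x \<otimes> y) \<in> measurable (borel_of T) (borel_of T)" by (rule measurable_borel_of)
    from measurable_sets[OF this, of A] have "(\<lambda>y. inv x \<otimes> y) -` A \<inter> carrier G \<in> sets M" using A sM by simp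
    moreover have "(\<lambda>y. inv x \<otimes> y) -` A \<inter> carrier G = x <# A"
    proof (intro equalityI subsetI)
      fix y assume "y \<in> (\<lambda>y. inv x \<otimes> y) -` A \<inter> carrier G"
      then have "y = x \<otimes> (inv x \<otimes> y)" "inv x \<otimes> y \<in> A" using x by simp_all
      then show "y \<in> x <# A" unfolding l_coset_image by blast
    next
      fix y assume "y \<in> x <# A"
      then obtain a where "a \<in> A" "y = x \<otimes> a" unfolding l_coset_image by blast
      then show "y \<in> (\<lambda>y. inv x \<otimes> y) -` A \<inter> carrier G" using x Ac by auto
    qed
    ultimately show ?thesis by simp
  qed
  have le: "emeasure M (x <# A) \<le> emeasure M A" if x: "x \<in> carrier G" and A: "A \<in> sets M" for x A
  proof -
    have "emeasure M (x <# A) \<le> emeasure M U" if U: "openin T U" "A \<subseteq> U" for U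
    proof -
      have "emeasure M (x <# A) \<le> emeasure M (x <# U)"
        using U(2) tr[OF x] borel_of_open[OF U(1)] sM unfolding l_coset_image by (intro emeasure_mono) auto
      also have "\<dots> \<le> emeasure M U"
        using M(3)[OF U(1)] M(3)[OF open_translate[OF U(1) x]] lam_le[OF x open_carrier[OF U(1)]] by simp
      finally show ?thesis .
    qed
    moreover have "emeasure M A = (INF U\<in>{U. openin T U \<and> A \<subseteq> U}. emeasure M U)"
      using M(1) A unfolding regular_borel_measure_def by blast
    ultimately show ?thesis by (auto intro: INF_greatest)
  qed
  have "emeasure M (x <# A) = emeasure M A" if x: "x \<in> carrier G" and A: "A \<in> sets M" for x A
  proof (rule antisym[OF le[OF x A]])
    have Ac: "A \<subseteq> carrier G" using sets.sets_into_space[OF A] sets_eq_imp_space_eq[OF sM] by simp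
    show "emeasure M A \<le> emeasure M (x <# A)"
      using le[OF inv_closed[OF x] tr[OF x A]] l_coset_inverse[OF x Ac] by simp
  qed
  moreover have "emeasure M (carrier G) = 1"
    using M(2)[OF clopenin_simps(2)] haar_content_carrier by simp
  ultimately show ?thesis using M(1) unfolding is_normalized_haar_measure_def by blast
qed

lemma haar_measure: "is_normalized_haar_measure G T (haar_measure G T)"
  unfolding haar_measure_def using haar_exists by (rule someI_ex)

end

section \<open>Products of regular Borel measures\<close>

text \<open>By compactness a clopen set of the product is a finite union of open rectangles, so it is measurable
  for the ordinary product measure, although closed sets of the product need not be.\<close>

lemma clopen_prod_measurable:
  assumes S: "stone_space S" and T: "stone_space T"
    and \<mu>: "sets \<mu> = sets (borel_of S)" and \<nu>: "sets \<nu> = sets (borel_of T)"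
    and W: "clopenin (prod_topology S T) W"
  shows "W \<in> sets (\<mu> \<Otimes>\<^sub>M \<nu>)"
proof -
  let ?R = "{A \<times> B | A B. openin S A \<and> openin T B \<and> A \<times> B \<subseteq> W}"
  have oW: "openin (prod_topology S T) W" and cW: "closedin (prod_topology S T) W" using W by (auto simp: clopenin_def)
  have "W \<subseteq> \<Union>?R"
  proof
    fix z assume z: "z \<in> W"
    obtain x y where xy: "z = (x, y)" by force
    obtain U V where "openin S U" "openin T V" "x \<in> U" "y \<in> V" "U \<times> V \<subseteq> W"
      using oW[unfolded openin_prod_topology_alt, rule_format, of x y] z xy by blast
    then show "z \<in> \<Union>?R" using xy by blast
  qed
  moreover have "openin (prod_topology S T) R" if "R \<in> ?R" for R
    using that by (auto simp: openin_prod_Times_iff)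
  moreover have "compactin (prod_topology S T) W"
    using stone_space_prod[OF S T] cW closedin_compact_space unfolding stone_space_def by blast
  ultimately obtain F where F: "finite F" "F \<subseteq> ?R" "W \<subseteq> \<Union>F"
    using compactinD[of "prod_topology S T" W ?R] by blast
  have "R \<in> sets (\<mu> \<Otimes>\<^sub>M \<nu>)" if R: "R \<in> F" for R
  proof -
    obtain A B where "R = A \<times> B" "openin S A" "openin T B" using F(2) R by blast
    then show ?thesis using borel_of_open[of S A] borel_of_open[of T B] \<mu> \<nu> by simp
  qed
  then have "\<Union>F \<in> sets (\<mu> \<Otimes>\<^sub>M \<nu>)" using F(1) by (intro sets.finite_Union) auto
  moreover have "\<Union>F = W" using F by blast
  ultimately show ?thesis by simp
qed

lemma times_borel_of:
  assumes "A \<in> sets (borel_of S)" "B \<in> sets (borel_of T)"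
  shows "A \<times> B \<in> sets (borel_of (prod_topology S T))"
proof -
  let ?P = "prod_topology S T"
  have "fst -` A \<inter> space (borel_of ?P) \<in> sets (borel_of ?P)"
    using measurable_sets[OF measurable_borel_of[OF continuous_map_fst] assms(1)] .
  moreover have "snd -` B \<inter> space (borel_of ?P) \<in> sets (borel_of ?P)"
    using measurable_sets[OF measurable_borel_of[OF continuous_map_snd] assms(2)] .
  moreover have "A \<times> B = (fst -` A \<inter> space (borel_of ?P)) \<inter> (snd -` B \<inter> space (borel_of ?P))"
    using sets.sets_into_space[OF assms(1)] sets.sets_into_space[OF assms(2)] by auto
  ultimately show ?thesis by (metis sets.Int)
qed

lemma regular_outer_approx:
  assumes "regular_borel_measure X M" "A \<in> sets M" "emeasure M A < c"
  shows "\<exists>U. openin X U \<and> A \<subseteq> U \<and> emeasure M U < c"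
proof -
  have "emeasure M A = (INF U \<in> {U. openin X U \<and> A \<subseteq> U}. emeasure M U)"
    using assms unfolding regular_borel_measure_def by blast
  with assms(3) have "(INF U \<in> {U. openin X U \<and> A \<subseteq> U}. emeasure M U) < c" by (simp only:)
  then show ?thesis unfolding INF_less_iff by auto
qed

lemma sum_eq_if_le:
  fixes a b c d :: ennreal
  assumes "a \<le> b" "c \<le> d" "a + c = b + d" "b + d < \<infinity>"
  shows "a = b"
proof (rule antisym[OF assms(1)])
  have d: "d < \<infinity>" using assms(4) by (simp add: less_top)
  have "b + d \<le> a + d" using assms(2,3) by (metis add_left_mono)
  then show "b \<le> a" using d by (metis add.commute ennreal_add_left_cancel_le infinity_ennreal_def not_less_iff_gr_or_eq)
qed

text \<open>Restrict the ordinary product measure to the clopen sets and extend. On rectangles of open sets the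
  extension is at most the product of the measures, and by outer regularity so it is on rectangles of
  Borel sets. As the four rectangles made from \<open>A\<close>, \<open>B\<close> and their complements add up to the same total
  for both, equality holds.\<close>

lemma radon_product_exists:
  assumes S: "stone_space S" and T: "stone_space T"
    and \<mu>: "regular_borel_measure S \<mu>" "emeasure \<mu> (topspace S) = 1"
    and \<nu>: "regular_borel_measure T \<nu>" "emeasure \<nu> (topspace T) = 1"
  shows "\<exists>M. regular_borel_measure (prod_topology S T) M \<and>
    (\<forall>A\<in>sets \<mu>. \<forall>B\<in>sets \<nu>. emeasure M (A \<times> B) = emeasure \<mu> A * emeasure \<nu> B)"
proof -
  let ?P = "prod_topology S T"
  have s\<mu>: "sets \<mu> = sets (borel_of S)" and s\<nu>: "sets \<nu> = sets (borel_of T)"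
    using \<mu> \<nu> by (auto simp: regular_borel_measure_def)
  have sp: "space \<mu> = topspace S" "space \<nu> = topspace T"
    using sets_eq_imp_space_eq[OF s\<mu>] sets_eq_imp_space_eq[OF s\<nu>] by auto
  interpret \<mu>: finite_measure \<mu> by standard (use \<mu>(2) sp in simp)
  interpret \<nu>: finite_measure \<nu> by standard (use \<nu>(2) sp in simp)
  have rect: "emeasure (\<mu> \<Otimes>\<^sub>M \<nu>) (A \<times> B) = emeasure \<mu> A * emeasure \<nu> B" if "A \<in> sets \<mu>" "B \<in> sets \<nu>" for A B
    using \<nu>.emeasure_pair_measure_Times[OF that] .
  define m where "m = (\<lambda>W. emeasure (\<mu> \<Otimes>\<^sub>M \<nu>) W)"
  have topS: "topspace S \<in> sets \<mu>" and topT: "topspace T \<in> sets \<nu>" using sp sets.top by metis+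
  have mtop: "m (topspace ?P) = 1" using rect[OF topS topT] \<mu>(2) \<nu>(2) by (simp add: m_def)
  interpret clopen_content ?P m
  proof
    show "stone_space ?P" using stone_space_prod[OF S T] .
    show "m (topspace ?P) < \<infinity>" using mtop by simp
    fix A B assume AB: "clopenin ?P A" "clopenin ?P B" "A \<inter> B = {}"
    show "m (A \<union> B) = m A + m B"
      unfolding m_def using plus_emeasure[of A "\<mu> \<Otimes>\<^sub>M \<nu>" B] AB(3)
        clopen_prod_measurable[OF S T s\<mu> s\<nu> AB(1)] clopen_prod_measurable[OF S T s\<mu> s\<nu> AB(2)] by simp
  qed
  obtain M where M: "regular_borel_measure ?P M" "\<And>A. clopenin ?P A \<Longrightarrow> emeasure M A = m A"
    "\<And>U. openin ?P U \<Longrightarrow> emeasure M U = clopen_sup ?P m U" using regular_extension by blast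
  have sM: "sets M = sets (borel_of ?P)" using M(1) by (simp add: regular_borel_measure_def)
  have times: "A \<times> B \<in> sets M" if "A \<in> sets \<mu>" "B \<in> sets \<nu>" for A B
    using that times_borel_of s\<mu> s\<nu> sM by blast
  have open_le: "emeasure M (U \<times> V) \<le> emeasure \<mu> U * emeasure \<nu> V" if U: "openin S U" and V: "openin T V" for U V
  proof -
    have UV: "U \<in> sets \<mu>" "V \<in> sets \<nu>" using borel_of_open U V s\<mu> s\<nu> by auto
    have "openin ?P (U \<times> V)" using U V by (simp add: openin_prod_Times_iff)
    then have "emeasure M (U \<times> V) = clopen_sup ?P m (U \<times> V)" by (rule M(3))
    also have "\<dots> \<le> emeasure \<mu> U * emeasure \<nu> V"
      using UV rect[OF UV] by (intro lam_least) (auto simp: m_def intro: emeasure_mono[of _ "U \<times> V", THEN order_trans])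
    finally show ?thesis .
  qed
  have le: "emeasure M (A \<times> B) \<le> emeasure \<mu> A * emeasure \<nu> B" if AB: "A \<in> sets \<mu>" "B \<in> sets \<nu>" for A B
  proof -
    have *: "emeasure M (A \<times> B) \<le> ennreal a * ennreal b" if ab: "emeasure \<mu> A < ennreal a" "emeasure \<nu> B < ennreal b" for a b
    proof -
      obtain U where U: "openin S U" "A \<subseteq> U" "emeasure \<mu> U < ennreal a" using regular_outer_approx[OF \<mu>(1) AB(1) ab(1)] by blast
      obtain V where V: "openin T V" "B \<subseteq> V" "emeasure \<nu> V < ennreal b" using regular_outer_approx[OF \<nu>(1) AB(2) ab(2)] by blast
      have "U \<times> V \<in> sets M" using borel_of_open[OF U(1)] borel_of_open[OF V(1)] s\<mu> s\<nu> by (intro times) simp_all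
      then have "emeasure M (A \<times> B) \<le> emeasure M (U \<times> V)" using U V by (intro emeasure_mono) auto
      also have "\<dots> \<le> emeasure \<mu> U * emeasure \<nu> V" using open_le U V by blast
      also have "\<dots> \<le> ennreal a * ennreal b" using U V by (intro mult_mono) auto
      finally show ?thesis .
    qed
    define a b where "a = measure \<mu> A" and "b = measure \<nu> B"
    have eq: "emeasure \<mu> A = ennreal a" "emeasure \<nu> B = ennreal b" "a \<ge> 0" "b \<ge> 0"
      by (auto simp: a_def b_def \<mu>.emeasure_eq_measure \<nu>.emeasure_eq_measure)
    have le_e: "emeasure M (A \<times> B) \<le> ennreal ((a + e) * (b + e))" if "e > 0" for e
    proof -
      have "emeasure \<mu> A < ennreal (a + e)" "emeasure \<nu> B < ennreal (b + e)"
        using eq that by (simp_all add: ennreal_less_iff del: ennreal_plus)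
      from *[OF this] show ?thesis using eq that by (simp add: ennreal_mult del: ennreal_plus)
    qed
    have fin: "emeasure M (A \<times> B) < \<infinity>" using le_e[of 1] by (simp add: order_le_less_trans del: ennreal_plus)
    have "enn2real (emeasure M (A \<times> B)) \<le> (a + e) * (b + e)" if "e > 0" for e
      using le_e[OF that] eq that by (intro enn2real_leI) auto
    then have ev: "eventually (\<lambda>e. enn2real (emeasure M (A \<times> B)) \<le> (a + e) * (b + e)) (at_right 0)"
      by (auto simp: eventually_at_right_field intro: exI[of _ 1])
    have "((\<lambda>e. (a + e) * (b + e)) \<longlongrightarrow> (a + 0) * (b + 0)) (at_right 0)"
      by (intro tendsto_intros)
    then have "enn2real (emeasure M (A \<times> B)) \<le> (a + 0) * (b + 0)"
      by (rule tendsto_lowerbound[OF _ ev]) simp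
    then have "emeasure M (A \<times> B) \<le> ennreal (a * b)" using fin eq by (simp add: enn2real_le less_top)
    then show ?thesis using eq by (simp add: ennreal_mult)
  qed
  have Mtop: "emeasure M (topspace S \<times> topspace T) = 1"
    using M(2)[OF clopenin_simps(2)] mtop by simp
  have "emeasure M (A \<times> B) = emeasure \<mu> A * emeasure \<nu> B" if AB: "A \<in> sets \<mu>" "B \<in> sets \<nu>" for A B
  proof -
    let ?A = "topspace S - A" and ?B = "topspace T - B"
    have AB': "?A \<in> sets \<mu>" "?B \<in> sets \<nu>" using AB topS topT by auto
    have sub: "A \<subseteq> topspace S" "B \<subseteq> topspace T" using sets.sets_into_space AB sp by blast+
    have "topspace S \<times> topspace T = (A \<times> B) \<union> ((?A \<times> B) \<union> (topspace S \<times> ?B))" using sub by blast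
    then have "1 = emeasure M ((A \<times> B) \<union> ((?A \<times> B) \<union> (topspace S \<times> ?B)))" using Mtop by simp
    also have "\<dots> = emeasure M (A \<times> B) + emeasure M ((?A \<times> B) \<union> (topspace S \<times> ?B))"
      using times[OF AB] times[OF AB'(1) AB(2)] times[OF topS AB'(2)] by (intro plus_emeasure[symmetric]) auto
    also have "emeasure M ((?A \<times> B) \<union> (topspace S \<times> ?B)) = emeasure M (?A \<times> B) + emeasure M (topspace S \<times> ?B)"
      using times[OF AB'(1) AB(2)] times[OF topS AB'(2)] by (intro plus_emeasure[symmetric]) auto
    finally have 1: "emeasure M (A \<times> B) + (emeasure M (?A \<times> B) + emeasure M (topspace S \<times> ?B)) = 1" by simp
    have "emeasure \<mu> A * emeasure \<nu> B + emeasure \<mu> ?A * emeasure \<nu> B = (emeasure \<mu> A + emeasure \<mu> ?A) * emeasure \<nu> B"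
      by (simp add: distrib_right)
    also have "emeasure \<mu> A + emeasure \<mu> ?A = 1"
    proof -
      have "emeasure \<mu> A + emeasure \<mu> ?A = emeasure \<mu> (A \<union> ?A)" using AB AB' by (intro plus_emeasure) auto
      moreover have "A \<union> ?A = topspace S" using sub by blast
      ultimately show ?thesis using \<mu>(2) by simp
    qed
    finally have "(emeasure \<mu> A * emeasure \<nu> B + emeasure \<mu> ?A * emeasure \<nu> B) + emeasure \<nu> ?B = emeasure \<nu> B + emeasure \<nu> ?B"
      by simp
    also have "\<dots> = emeasure \<nu> (B \<union> ?B)" using AB AB' by (intro plus_emeasure) auto
    also have "B \<union> ?B = topspace T" using sub by blast
    finally have 2: "emeasure \<mu> A * emeasure \<nu> B + (emeasure \<mu> ?A * emeasure \<nu> B + emeasure \<nu> ?B) = 1"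
      using \<nu>(2) by (simp add: add.assoc)
    show ?thesis
    proof (rule sum_eq_if_le)
      show "emeasure M (A \<times> B) \<le> emeasure \<mu> A * emeasure \<nu> B" using le AB by blast
      show "emeasure M (?A \<times> B) + emeasure M (topspace S \<times> ?B) \<le> emeasure \<mu> ?A * emeasure \<nu> B + emeasure \<nu> ?B"
        using le[OF AB'(1) AB(2)] le[OF topS AB'(2)] \<mu>(2) by (intro add_mono) auto
      show "emeasure M (A \<times> B) + (emeasure M (?A \<times> B) + emeasure M (topspace S \<times> ?B)) =
        emeasure \<mu> A * emeasure \<nu> B + (emeasure \<mu> ?A * emeasure \<nu> B + emeasure \<nu> ?B)"
        using 1 2 by simp
      show "emeasure \<mu> A * emeasure \<nu> B + (emeasure \<mu> ?A * emeasure \<nu> B + emeasure \<nu> ?B) < \<infinity>" unfolding 2 by simp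
    qed
  qed
  then show ?thesis using M(1) by blast
qed

text \<open>A substitute for Fubini's theorem, for closed sets \<open>C\<close> and without measurability for the ordinary
  product. The set \<open>Z\<close> of points with large section is closed: a section of measure less than \<open>d\<close> lies
  in an open set of measure less than \<open>d\<close>, and so do the sections at nearby points. Were \<open>Z\<close> a null set,
  covering the rest by finitely many such neighbourhoods would make \<open>C\<close> too small.\<close>

lemma positive_measure_sections:
  assumes S: "compact_space S" "Hausdorff_space S" and T: "compact_space T" "Hausdorff_space T"
    and \<mu>: "regular_borel_measure S \<mu>" "emeasure \<mu> (topspace S) = 1"
    and \<nu>: "regular_borel_measure T \<nu>" "emeasure \<nu> (topspace T) = 1"
    and M: "regular_borel_measure (prod_topology S T) M"
      "\<And>A B. A \<in> sets \<mu> \<Longrightarrow> B \<in> sets \<nu> \<Longrightarrow> emeasure M (A \<times> B) = emeasure \<mu> A * emeasure \<nu> B"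
    and C: "closedin (prod_topology S T) C" "emeasure M C > 0"
  shows "\<exists>d Z. d > 0 \<and> closedin S Z \<and> emeasure \<mu> Z > 0 \<and> (\<forall>x\<in>Z. emeasure \<nu> {y. (x, y) \<in> C} \<ge> ennreal d)"
proof -
  let ?P = "prod_topology S T"
  have s\<mu>: "sets \<mu> = sets (borel_of S)" and s\<nu>: "sets \<nu> = sets (borel_of T)" and sM: "sets M = sets (borel_of ?P)"
    using \<mu> \<nu> M by (auto simp: regular_borel_measure_def)
  have sp: "space \<mu> = topspace S" "space \<nu> = topspace T"
    using sets_eq_imp_space_eq[OF s\<mu>] sets_eq_imp_space_eq[OF s\<nu>] by auto
  have topT: "topspace T \<in> sets \<nu>" using sp sets.top by metis
  have topS: "topspace S \<in> sets \<mu>" using sp sets.top by metis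
  have Csub: "C \<subseteq> topspace S \<times> topspace T" using closedin_subset[OF C(1)] by simp
  have CM: "C \<in> sets M" using borel_of_closed[OF C(1)] sM by simp
  have times: "A \<times> B \<in> sets M" if "A \<in> sets \<mu>" "B \<in> sets \<nu>" for A B
    using that times_borel_of s\<mu> s\<nu> sM by blast
  have "emeasure M C \<le> emeasure M (topspace S \<times> topspace T)" using Csub times[OF topS topT] by (intro emeasure_mono)
  also have "\<dots> = 1" using M(2)[OF topS topT] \<mu>(2) \<nu>(2) by simp
  finally have "emeasure M C \<le> 1" .
  then obtain c where c: "emeasure M C = ennreal c" "c \<ge> 0"
    by (metis ennreal_one_neq_top ennreal_cases neq_top_trans)
  then have c0: "c > 0" using C(2) by (simp add: ennreal_less_zero_iff)
  \<comment> \<open>half for the points near \<open>Z\<close>, half for those with small sections\<close>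
  define d where "d = c / 2"
  have d0: "d > 0" using c0 by (simp add: d_def)
  define Z where "Z = {x \<in> topspace S. emeasure \<nu> {y. (x, y) \<in> C} \<ge> ennreal d}"
  have sec: "{y. (x, y) \<in> C} \<in> sets \<nu>" if "x \<in> topspace S" for x
  proof -
    have "continuous_map T ?P (\<lambda>y. (x, y))" using that by (intro continuous_map_pairedI) auto
    from closedin_continuous_map_preimage[OF this C(1)] have "closedin T {y \<in> topspace T. (x, y) \<in> C}" .
    moreover have "{y \<in> topspace T. (x, y) \<in> C} = {y. (x, y) \<in> C}" using Csub by auto
    ultimately show ?thesis using borel_of_closed s\<nu> by metis
  qed
  have tube: "\<exists>W V. openin S W \<and> x \<in> W \<and> V \<in> sets \<nu> \<and> emeasure \<nu> V < ennreal d \<and> C \<inter> (W \<times> UNIV) \<subseteq> W \<times> V"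
    if x: "x \<in> topspace S - Z" for x
  proof -
    have "emeasure \<nu> {y. (x, y) \<in> C} < ennreal d" using x by (auto simp: Z_def)
    then obtain V where V: "openin T V" "{y. (x, y) \<in> C} \<subseteq> V" "emeasure \<nu> V < ennreal d"
      using regular_outer_approx[OF \<nu>(1) sec] x by blast
    have "closedin T (topspace T - V)" using V(1) by blast
    then have cpt: "compactin T (topspace T - V)" using T(1) closedin_compact_space by blast
    have op: "openin ?P (topspace ?P - C)" using C(1) by blast
    have "{x} \<times> (topspace T - V) \<subseteq> topspace ?P - C" using x V(2) by auto
    then obtain W V' where W: "openin S W" "openin T V'" "x \<in> W" "topspace T - V \<subseteq> V'" "W \<times> V' \<subseteq> topspace ?P - C"
      using tube_lemma_right[OF op cpt, of x] x by blast
    have "C \<inter> (W \<times> UNIV) \<subseteq> W \<times> V" using W Csub by blast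
    then show ?thesis using W V borel_of_open[OF V(1)] s\<nu> by blast
  qed
  then obtain W V where WV: "\<And>x. x \<in> topspace S - Z \<Longrightarrow> openin S (W x) \<and> x \<in> W x \<and> V x \<in> sets \<nu> \<and>
     emeasure \<nu> (V x) < ennreal d \<and> C \<inter> (W x \<times> UNIV) \<subseteq> W x \<times> V x" by metis
  have "openin S (topspace S - Z)"
  proof (subst openin_subopen, intro ballI)
    fix x assume x: "x \<in> topspace S - Z"
    have "W x \<subseteq> topspace S - Z"
    proof
      fix x' assume x': "x' \<in> W x"
      have "{y. (x', y) \<in> C} \<subseteq> V x" using WV[OF x] x' by blast
      then have "emeasure \<nu> {y. (x', y) \<in> C} \<le> emeasure \<nu> (V x)" using WV[OF x] by (intro emeasure_mono) auto
      also have "\<dots> < ennreal d" using WV[OF x] by blast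
      finally have "emeasure \<nu> {y. (x', y) \<in> C} < ennreal d" .
      then show "x' \<in> topspace S - Z" using WV[OF x] x' openin_subset[of S "W x"] by (auto simp: Z_def)
    qed
    then show "\<exists>U. openin S U \<and> x \<in> U \<and> U \<subseteq> topspace S - Z" using WV[OF x] by blast
  qed
  then have Zcl: "closedin S Z" by (simp add: closedin_def Z_def)
  have ZM: "Z \<in> sets \<mu>" using borel_of_closed[OF Zcl] s\<mu> by simp
  have bound: "emeasure M (C \<inter> (B \<times> topspace T)) \<le> ennreal d * emeasure \<mu> B"
    if "finite F" "F \<subseteq> topspace S - Z" "B \<in> sets \<mu>" "B \<subseteq> \<Union>(W ` F)" for F B
    using that
  proof (induction F arbitrary: B)
    case empty then show ?case by simp
  next
    case (insert x F)
    have x: "x \<in> topspace S - Z" using insert.prems by blast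
    have Wx: "W x \<in> sets \<mu>" using borel_of_open WV[OF x] s\<mu> by blast
    let ?B1 = "B \<inter> W x" and ?B2 = "B - W x"
    have B12: "?B1 \<in> sets \<mu>" "?B2 \<in> sets \<mu>" using insert.prems(2) Wx by auto
    have C12: "C \<inter> (?B1 \<times> topspace T) \<in> sets M" "C \<inter> (?B2 \<times> topspace T) \<in> sets M"
      using times[OF B12(1) topT] times[OF B12(2) topT] CM by auto
    have "emeasure M (C \<inter> (B \<times> topspace T)) = emeasure M ((C \<inter> (?B1 \<times> topspace T)) \<union> (C \<inter> (?B2 \<times> topspace T)))"
      by (rule arg_cong[where f = "emeasure M"]) blast
    also have "\<dots> = emeasure M (C \<inter> (?B1 \<times> topspace T)) + emeasure M (C \<inter> (?B2 \<times> topspace T))"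
      using C12 by (intro plus_emeasure[symmetric]) auto
    also have "emeasure M (C \<inter> (?B1 \<times> topspace T)) \<le> emeasure M (?B1 \<times> V x)"
      using WV[OF x] times[OF B12(1)] by (intro emeasure_mono) auto
    also have "emeasure M (?B1 \<times> V x) = emeasure \<mu> ?B1 * emeasure \<nu> (V x)" using M(2) B12(1) WV[OF x] by blast
    also have "\<dots> \<le> emeasure \<mu> ?B1 * ennreal d" using WV[OF x] by (intro mult_left_mono) auto
    also have "emeasure M (C \<inter> (?B2 \<times> topspace T)) \<le> ennreal d * emeasure \<mu> ?B2"
      using insert.prems B12 by (intro insert.IH) auto
    also have "emeasure \<mu> ?B1 * ennreal d + ennreal d * emeasure \<mu> ?B2 = ennreal d * (emeasure \<mu> ?B1 + emeasure \<mu> ?B2)"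
      by (simp add: distrib_left mult.commute)
    also have "emeasure \<mu> ?B1 + emeasure \<mu> ?B2 = emeasure \<mu> (?B1 \<union> ?B2)"
      using B12 by (intro plus_emeasure) auto
    also have "?B1 \<union> ?B2 = B" by blast
    finally show ?case by (simp add: add_mono)
  qed
  have "emeasure \<mu> Z > 0"
  proof (rule ccontr)
    assume "\<not> emeasure \<mu> Z > 0"
    then have "emeasure \<mu> Z < ennreal d" using d0 by simp
    then obtain O' where O': "openin S O'" "Z \<subseteq> O'" "emeasure \<mu> O' < ennreal d" using regular_outer_approx[OF \<mu>(1) ZM] by blast
    let ?K = "topspace S - O'"
    have Kcl: "closedin S ?K" using O' by blast
    then have "compactin S ?K" using S(1) closedin_compact_space by blast
    moreover have "?K \<subseteq> \<Union>(W ` ?K)" using WV O'(2) by blast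
    moreover have "\<And>U. U \<in> W ` ?K \<Longrightarrow> openin S U" using WV O'(2) by blast
    ultimately obtain \<F> where F: "finite \<F>" "\<F> \<subseteq> W ` ?K" "?K \<subseteq> \<Union>\<F>" using compactinD[of S ?K "W ` ?K"] by blast
    then obtain F where F': "finite F" "F \<subseteq> ?K" "\<F> = W ` F" by (metis finite_subset_image)
    have KM: "?K \<in> sets \<mu>" using borel_of_closed[OF Kcl] s\<mu> by simp
    have OM: "O' \<in> sets \<mu>" using borel_of_open[OF O'(1)] s\<mu> by simp
    have "emeasure \<mu> ?K \<le> 1" using \<mu>(2) KM topS by (metis emeasure_mono Diff_subset)
    then have "ennreal d * emeasure \<mu> ?K \<le> ennreal d * 1" by (rule mult_left_mono) simp
    have b: "emeasure M (C \<inter> (?K \<times> topspace T)) \<le> ennreal d * emeasure \<mu> ?K"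
      using F F' O'(2) KM by (intro bound[of F]) auto
    have "emeasure M C \<le> emeasure M ((O' \<times> topspace T) \<union> (C \<inter> (?K \<times> topspace T)))"
      using Csub times[OF OM topT] times[OF KM topT] CM by (intro emeasure_mono) auto
    also have "\<dots> \<le> emeasure M (O' \<times> topspace T) + emeasure M (C \<inter> (?K \<times> topspace T))"
      using times[OF OM topT] times[OF KM topT] CM by (intro emeasure_subadditive) auto
    also have "\<dots> \<le> emeasure \<mu> O' + ennreal d"
      using b \<open>ennreal d * emeasure \<mu> ?K \<le> ennreal d * 1\<close> M(2)[OF OM topT] \<nu>(2) by (intro add_mono) auto
    also have "\<dots> = ennreal d + emeasure \<mu> O'" by (rule add.commute)
    also have "\<dots> < ennreal d + ennreal d" using O'(3) by (simp add: ennreal_add_left_cancel_less)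
    also have "\<dots> = ennreal c" using d0 by (simp add: d_def flip: ennreal_plus)
    finally show False using c by simp
  qed
  then show ?thesis using d0 Zcl by (intro exI[of _ d] exI[of _ Z]) (auto simp: Z_def)
qed

section \<open>Commuting open subgroups from a positive commuting probability\<close>

text \<open>The finite case of Baire's theorem, valid in every space.\<close>

lemma open_subset_finite_closed_cover:
  assumes "finite \<C>" "\<And>C. C \<in> \<C> \<Longrightarrow> closedin X C" "openin X U" "U \<noteq> {}" "U \<subseteq> \<Union>\<C>"
  shows "\<exists>C\<in>\<C>. \<exists>V. openin X V \<and> V \<noteq> {} \<and> V \<subseteq> C"
  using assms
proof (induction arbitrary: U)
  case (insert C \<C>)
  show ?case
  proof (cases "U \<subseteq> C")
    case True then show ?thesis using insert.prems by blast
  next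
    case False
    have "\<exists>D\<in>\<C>. \<exists>V. openin X V \<and> V \<noteq> {} \<and> V \<subseteq> D"
    proof (rule insert.IH)
      show "openin X (U - C)" using insert.prems(1)[of C] insert.prems(2) by (simp add: openin_diff)
      show "U - C \<noteq> {}" using False by blast
      show "U - C \<subseteq> \<Union>\<C>" using insert.prems(4) by blast
    qed (use insert.prems(1) in simp)
    then show ?thesis by blast
  qed
qed simp

context group
begin

text \<open>The conjugates of \<open>x\<close> by elements of \<open>K\<close>; it need not lie in \<open>K\<close>.\<close>

definition orbit_under :: "'a set \<Rightarrow> 'a \<Rightarrow> 'a set" where
  "orbit_under K x = (\<lambda>k. k \<otimes> x \<otimes> inv k) ` K"

lemma orbit_under_mult:
  assumes "K \<subseteq> carrier G" "x \<in> carrier G" "y \<in> carrier G"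
    "finite (orbit_under K x)" "finite (orbit_under K y)"
  shows "finite (orbit_under K (x \<otimes> y))"
    "card (orbit_under K (x \<otimes> y)) \<le> card (orbit_under K x) * card (orbit_under K y)"
proof -
  have "orbit_under K (x \<otimes> y) \<subseteq> (\<lambda>(u, v). u \<otimes> v) ` (orbit_under K x \<times> orbit_under K y)"
  proof
    fix z assume "z \<in> orbit_under K (x \<otimes> y)"
    then obtain k where k: "k \<in> K" "z = k \<otimes> (x \<otimes> y) \<otimes> inv k" by (auto simp: orbit_under_def)
    then have "z = (k \<otimes> x \<otimes> inv k) \<otimes> (k \<otimes> y \<otimes> inv k)" using assms(1-3) by (auto simp: m_assoc subset_iff)
    then show "z \<in> (\<lambda>(u, v). u \<otimes> v) ` (orbit_under K x \<times> orbit_under K y)" using k(1) by (force simp: orbit_under_def)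
  qed
  moreover have f: "finite (orbit_under K x \<times> orbit_under K y)" using assms by simp
  ultimately show "finite (orbit_under K (x \<otimes> y))" "card (orbit_under K (x \<otimes> y)) \<le> card (orbit_under K x) * card (orbit_under K y)"
    using finite_surj[OF f] surj_card_le[OF f] by (auto simp: card_cartesian_product)
qed

lemma orbit_under_inv:
  assumes "K \<subseteq> carrier G" "x \<in> carrier G" "finite (orbit_under K x)"
  shows "finite (orbit_under K (inv x))" "card (orbit_under K (inv x)) \<le> card (orbit_under K x)"
proof -
  have "orbit_under K (inv x) \<subseteq> (\<lambda>u. inv u) ` orbit_under K x"
  proof
    fix z assume "z \<in> orbit_under K (inv x)"
    then obtain k where k: "k \<in> K" "z = k \<otimes> inv x \<otimes> inv k" by (auto simp: orbit_under_def)
    then have "z = inv (k \<otimes> x \<otimes> inv k)" using assms by (auto simp: m_assoc inv_mult_group subset_iff)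
    then show "z \<in> (\<lambda>u. inv u) ` orbit_under K x" using k(1) by (force simp: orbit_under_def)
  qed
  then show "finite (orbit_under K (inv x))" "card (orbit_under K (inv x)) \<le> card (orbit_under K x)"
    using finite_surj[OF assms(3)] surj_card_le[OF assms(3)] by auto
qed

end

context profinite
begin

lemma closed_translate:
  assumes "closedin T A" "x \<in> carrier G" shows "closedin T (x <# A)"
proof -
  have "x <# A = {y \<in> carrier G. inv x \<otimes> y \<in> A}"
  proof (intro equalityI subsetI)
    fix y assume "y \<in> x <# A"
    then obtain a where "a \<in> A" "y = x \<otimes> a" unfolding l_coset_image by blast
    then show "y \<in> {y \<in> carrier G. inv x \<otimes> y \<in> A}" using assms(2) closed_carrier[OF assms(1)] by auto
  next
    fix y assume "y \<in> {y \<in> carrier G. inv x \<otimes> y \<in> A}"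
    then have "y = x \<otimes> (inv x \<otimes> y)" "inv x \<otimes> y \<in> A" using assms by simp_all
    then show "y \<in> x <# A" unfolding l_coset_image by blast
  qed
  moreover have "continuous_map T T (\<lambda>y. inv x \<otimes> y)" using assms by (intro continuous_group) auto
  ultimately show ?thesis using closed_preimage assms(1) by simp
qed

lemma disjoint_translates_card:
  assumes \<mu>: "is_normalized_haar_measure G T \<mu>" and A: "closedin T A" "emeasure \<mu> A \<ge> ennreal d" "d > 0"
    and F: "finite F" "F \<subseteq> carrier G" "\<And>f g. f \<in> F \<Longrightarrow> g \<in> F \<Longrightarrow> f \<noteq> g \<Longrightarrow> (f <# A) \<inter> (g <# A) = {}"
  shows "card F \<le> nat \<lfloor>1 / d\<rfloor>"
proof -
  have s: "sets \<mu> = sets (borel_of T)" using \<mu> by (simp add: is_normalized_haar_measure_def regular_borel_measure_def)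
  have sp: "space \<mu> = carrier G" using sets_eq_imp_space_eq[OF s] by simp
  have AM: "A \<in> sets \<mu>" using borel_of_closed[OF A(1)] s by simp
  have fA: "f <# A \<in> sets \<mu>" if "f \<in> carrier G" for f using borel_of_closed[OF closed_translate[OF A(1) that]] s by simp
  have "ennreal (card F * d) = of_nat (card F) * ennreal d" using A(3) by (simp add: ennreal_mult ennreal_of_nat_eq_real_of_nat)
  also have "\<dots> \<le> of_nat (card F) * emeasure \<mu> A" using A(2) by (rule mult_left_mono) simp
  also have "\<dots> = (\<Sum>f\<in>F. emeasure \<mu> A)" by simp
  also have "\<dots> = (\<Sum>f\<in>F. emeasure \<mu> (f <# A))"
    using \<mu> F(2) AM by (intro sum.cong) (auto simp: is_normalized_haar_measure_def)
  also have "\<dots> = emeasure \<mu> (\<Union>f\<in>F. f <# A)"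
    using fA F by (intro sum_emeasure) (auto simp: disjoint_family_on_def)
  also have "\<dots> \<le> emeasure \<mu> (space \<mu>)" by (rule emeasure_space)
  also have "\<dots> = ennreal 1" using \<mu> sp by (simp add: is_normalized_haar_measure_def)
  finally have "card F * d \<le> 1" by (simp add: ennreal_le_iff)
  then have "real (card F) \<le> 1 / d" using A(3) by (simp add: field_simps)
  then show ?thesis by linarith
qed

text \<open>In a largest family of disjoint translates of \<open>A\<close>, any further translate \<open>h A\<close> meets some member \<open>f A\<close>.\<close>

lemma finite_translates_cover:
  assumes \<mu>: "is_normalized_haar_measure G T \<mu>" and A: "closedin T A" "emeasure \<mu> A > 0"
  shows "\<exists>F. finite F \<and> F \<subseteq> carrier G \<and> (\<forall>h\<in>carrier G. \<exists>f\<in>F. \<exists>a\<in>A. \<exists>b\<in>A. h = f \<otimes> (a \<otimes> inv b))"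
proof -
  have Ac: "A \<subseteq> carrier G" using closed_carrier A by blast
  obtain d where d: "d > 0" "ennreal d \<le> emeasure \<mu> A"
  proof -
    obtain r where "0 < r" "ennreal r < emeasure \<mu> A" using A(2) ennreal_rat_dense[of 0 "emeasure \<mu> A"] dense[of 0 "emeasure \<mu> A"]
      by (metis ennreal_0 ennreal_cases ennreal_less_zero_iff less_top_ennreal not_less_iff_gr_or_eq order_less_le_trans top_greatest)
    then show ?thesis using that less_imp_le by blast
  qed
  define P where "P = (\<lambda>F. finite F \<and> F \<subseteq> carrier G \<and> (\<forall>f\<in>F. \<forall>g\<in>F. f \<noteq> g \<longrightarrow> (f <# A) \<inter> (g <# A) = {}))"
  have bnd: "card F < Suc (nat \<lfloor>1 / d\<rfloor>)" if "P F" for F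
    using disjoint_translates_card[OF \<mu> A(1) d(2,1), of F] that unfolding P_def by (simp add: less_Suc_eq_le)
  have "P {}" by (simp add: P_def)
  then obtain F where F: "P F" "\<And>F'. P F' \<Longrightarrow> card F' \<le> card F"
    using ex_has_greatest_nat[of P "{}" card "Suc (nat \<lfloor>1 / d\<rfloor>)"] bnd by blast
  have "\<exists>f\<in>F. \<exists>a\<in>A. \<exists>b\<in>A. h = f \<otimes> (a \<otimes> inv b)" if h: "h \<in> carrier G" for h
  proof (cases "h \<in> F")
    case True
    have "A \<noteq> {}" using A(2) by auto
    then obtain a where "a \<in> A" by blast
    moreover from this have "h = h \<otimes> (a \<otimes> inv a)" using Ac h by auto
    ultimately show ?thesis using True by blast
  next
    case False
    have fin: "finite F" using F(1) by (simp add: P_def)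
    have "\<not> P (insert h F)" using F(2)[of "insert h F"] False fin by auto
    then obtain f where f: "f \<in> F" "(h <# A) \<inter> (f <# A) \<noteq> {}"
      using F(1) h unfolding P_def by (auto simp: Int_commute)
    then obtain a b where ab: "a \<in> A" "b \<in> A" "h \<otimes> a = f \<otimes> b" unfolding l_coset_image by blast
    have c: "f \<in> carrier G" "a \<in> carrier G" "b \<in> carrier G" using f ab Ac F(1) unfolding P_def by auto
    have "h = (h \<otimes> a) \<otimes> inv a" using h c by (simp add: m_assoc)
    also have "\<dots> = f \<otimes> (b \<otimes> inv a)" using ab(3) c by (simp add: m_assoc)
    finally show ?thesis using f ab by blast
  qed
  moreover have "finite F" "F \<subseteq> carrier G" using F(1) by (simp_all add: P_def)
  ultimately show ?thesis by (intro exI[of _ F] conjI ballI)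
qed

text \<open>Elements of \<open>K\<close> that conjugate \<open>x\<close> to different elements give disjoint cosets of the centraliser.\<close>

lemma centralizer_measure_orbit:
  assumes \<mu>: "is_normalized_haar_measure (G\<lparr>carrier := K\<rparr>) (subtopology T K) \<mu>"
    and K: "subgroup K G" "closedin T K" and x: "x \<in> carrier G"
    and d: "d > 0" "ennreal d \<le> emeasure \<mu> {k \<in> K. x \<otimes> k = k \<otimes> x}"
  shows "finite (orbit_under K x) \<and> card (orbit_under K x) \<le> nat \<lfloor>1 / d\<rfloor>"
proof (rule finite_if_finite_subsets_card_bdd)
  interpret K: profinite "G\<lparr>carrier := K\<rparr>" "subtopology T K"
    by (rule profinite_closed_subgroup[OF K])
  have Kc: "K \<subseteq> carrier G" using subgroup.subset[OF K(1)] .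
  let ?C = "{k \<in> K. x \<otimes> k = k \<otimes> x}"
  have "closedin T {k \<in> topspace T. x \<otimes> k = k \<otimes> x}"
    using x by (intro closedin_continuous_maps_eq[OF Hausdorff] continuous_group)
  then have "closedin (subtopology T K) ?C"
    using Kc by (auto simp: closedin_subtopology intro!: exI[of _ "{k \<in> topspace T. x \<otimes> k = k \<otimes> x}"])
  fix F assume F: "F \<subseteq> orbit_under K x" "finite F"
  then obtain J where J: "J \<subseteq> K" "inj_on (\<lambda>k. k \<otimes> x \<otimes> inv k) J" "F = (\<lambda>k. k \<otimes> x \<otimes> inv k) ` J"
    unfolding orbit_under_def subset_image_inj by blast
  have "finite J" using F(2) J finite_imageD by blast
  moreover have "(f <#\<^bsub>G\<lparr>carrier := K\<rparr>\<^esub> ?C) \<inter> (g <#\<^bsub>G\<lparr>carrier := K\<rparr>\<^esub> ?C) = {}" if fg: "f \<in> J" "g \<in> J" "f \<noteq> g" for f g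
  proof (rule ccontr)
    assume "(f <#\<^bsub>G\<lparr>carrier := K\<rparr>\<^esub> ?C) \<inter> (g <#\<^bsub>G\<lparr>carrier := K\<rparr>\<^esub> ?C) \<noteq> {}"
    then obtain a b where ab: "a \<in> ?C" "b \<in> ?C" "f \<otimes> a = g \<otimes> b" by (auto simp: l_coset_def)
    have c: "a \<in> carrier G" "b \<in> carrier G" "f \<in> carrier G" "g \<in> carrier G" using ab fg J Kc by auto
    have conj: "u \<otimes> c \<otimes> x \<otimes> inv (u \<otimes> c) = u \<otimes> x \<otimes> inv u" if "u \<in> carrier G" "c \<in> carrier G" "x \<otimes> c = c \<otimes> x" for u c
    proof -
      have "u \<otimes> c \<otimes> x \<otimes> inv (u \<otimes> c) = u \<otimes> (c \<otimes> x) \<otimes> (inv c \<otimes> inv u)" using that x by (simp add: inv_mult_group m_assoc)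
      also have "\<dots> = u \<otimes> x \<otimes> inv u" unfolding that(3)[symmetric] using that(1,2) x by (simp add: m_assoc)
      finally show ?thesis .
    qed
    have "f \<otimes> x \<otimes> inv f = g \<otimes> x \<otimes> inv g"
      using conj[OF c(3,1)] conj[OF c(4,2)] ab by simp
    then show False using J(2) fg by (auto simp: inj_on_def)
  qed
  ultimately have "card J \<le> nat \<lfloor>1 / d\<rfloor>"
    using K.disjoint_translates_card[OF \<mu> \<open>closedin (subtopology T K) ?C\<close> d(2,1)] J(1) by simp
  then show "card F \<le> nat \<lfloor>1 / d\<rfloor>" using J by (simp add: card_image)
qed

lemma commuting_prob_pos_section:
  assumes H: "subgroup H G" "closedin T H" and K: "subgroup K G" "closedin T K"
    and pos: "commuting_prob G T H K > 0"
  shows "\<exists>n Z \<mu>. is_normalized_haar_measure (G\<lparr>carrier := H\<rparr>) (subtopology T H) \<mu> \<and>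
     closedin (subtopology T H) Z \<and> emeasure \<mu> Z > 0 \<and>
     (\<forall>x\<in>Z. finite (orbit_under K x) \<and> card (orbit_under K x) \<le> n)"
proof -
  let ?S = "subtopology T H" and ?R = "subtopology T K"
  interpret H: profinite "G\<lparr>carrier := H\<rparr>" ?S
    by (rule profinite_closed_subgroup[OF H])
  interpret K: profinite "G\<lparr>carrier := K\<rparr>" ?R
    by (rule profinite_closed_subgroup[OF K])
  let ?\<mu> = "haar_measure (G\<lparr>carrier := H\<rparr>) ?S" and ?\<nu> = "haar_measure (G\<lparr>carrier := K\<rparr>) ?R"
  note \<mu> = H.haar_measure and \<nu> = K.haar_measure
  have \<mu>': "regular_borel_measure ?S ?\<mu>" "emeasure ?\<mu> (topspace ?S) = 1"
    and \<nu>': "regular_borel_measure ?R ?\<nu>" "emeasure ?\<nu> (topspace ?R) = 1"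
    using \<mu> \<nu> by (simp_all only: is_normalized_haar_measure_def H.topspace K.topspace)
  define M where "M = radon_product ?S ?R ?\<mu> ?\<nu>"
  have M: "regular_borel_measure (prod_topology ?S ?R) M \<and>
    (\<forall>A\<in>sets ?\<mu>. \<forall>B\<in>sets ?\<nu>. emeasure M (A \<times> B) = emeasure ?\<mu> A * emeasure ?\<nu> B)"
    unfolding M_def radon_product_def
    using radon_product_exists[OF stone_space_profinite[OF H.profinite] stone_space_profinite[OF K.profinite] \<mu>' \<nu>']
    by (rule someI_ex)
  let ?C = "{(x, y). x \<in> H \<and> y \<in> K \<and> x \<otimes> y = y \<otimes> x}"
  have Hc: "H \<subseteq> carrier G" and Kc: "K \<subseteq> carrier G" using subgroup.subset H K by auto
  have fs: "continuous_map (prod_topology ?S ?R) T fst" "continuous_map (prod_topology ?S ?R) T snd"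
    using continuous_map_fst[of ?S ?R] continuous_map_snd[of ?S ?R] by (auto intro: continuous_map_into_fulltopology)
  have "closedin (prod_topology ?S ?R) {z \<in> topspace (prod_topology ?S ?R). fst z \<otimes> snd z = snd z \<otimes> fst z}"
    by (intro closedin_continuous_maps_eq[OF Hausdorff] continuous_mult fs)
  moreover have "{z \<in> topspace (prod_topology ?S ?R). fst z \<otimes> snd z = snd z \<otimes> fst z} = ?C"
    using Hc Kc by auto
  ultimately have C: "closedin (prod_topology ?S ?R) ?C" by simp
  have "measure M ?C > 0" using pos by (simp add: commuting_prob_def M_def)
  then have "emeasure M ?C > 0" by (auto simp: Sigma_Algebra.measure_def intro: ccontr)
  then obtain d Z where dZ: "d > 0" "closedin ?S Z" "emeasure ?\<mu> Z > 0" "\<And>x. x \<in> Z \<Longrightarrow> emeasure ?\<nu> {y. (x, y) \<in> ?C} \<ge> ennreal d"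
    using positive_measure_sections[OF H.compact H.Hausdorff K.compact K.Hausdorff \<mu>' \<nu>' _ _ C] M by blast
  have "finite (orbit_under K x) \<and> card (orbit_under K x) \<le> nat \<lfloor>1 / d\<rfloor>" if x: "x \<in> Z" for x
  proof -
    have xH: "x \<in> H" using x closedin_subset[OF dZ(2)] by auto
    then have "{y. (x, y) \<in> ?C} = {k \<in> K. x \<otimes> k = k \<otimes> x}" by auto
    then show ?thesis using centralizer_measure_orbit[OF \<nu> K _ dZ(1), of x] dZ(4)[OF x] xH Hc by auto
  qed
  then show ?thesis using \<mu> dZ by blast
qed

text \<open>Some translate of \<open>Z Z\<inverse>\<close>, with \<open>Z\<close> as in \<open>commuting_prob_pos_section\<close>, has interior in \<open>H\<close>; so near \<open>1\<close> all
  elements of \<open>H\<close> are products of four elements of \<open>Z\<close> and their inverses.\<close>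

lemma commuting_prob_pos_bounded_orbits:
  assumes H: "subgroup H G" "closedin T H" and K: "subgroup K G" "closedin T K"
    and pos: "commuting_prob G T H K > 0"
  shows "\<exists>N\<in>ONS. \<exists>n. \<forall>x\<in>H \<inter> N. finite (orbit_under K x) \<and> card (orbit_under K x) \<le> n"
proof -
  let ?S = "subtopology T H"
  interpret H: profinite "G\<lparr>carrier := H\<rparr>" ?S
    by (rule profinite_closed_subgroup[OF H])
  have Hc: "H \<subseteq> carrier G" and Kc: "K \<subseteq> carrier G" using subgroup.subset H K by auto
  obtain n Z \<mu> where nZ: "is_normalized_haar_measure (G\<lparr>carrier := H\<rparr>) ?S \<mu>" "closedin ?S Z" "emeasure \<mu> Z > 0"
    "\<And>x. x \<in> Z \<Longrightarrow> finite (orbit_under K x) \<and> card (orbit_under K x) \<le> n"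
    using commuting_prob_pos_section[OF H K pos] by blast
  have ZH: "Z \<subseteq> H" using closedin_subset[OF nZ(2)] by auto
  have Zcl: "closedin T Z" using nZ(2) H(2) closedin_trans_full by blast
  obtain F where F: "finite F" "F \<subseteq> H" "\<And>h. h \<in> H \<Longrightarrow> \<exists>f\<in>F. \<exists>a\<in>Z. \<exists>b\<in>Z. h = f \<otimes> (a \<otimes> inv b)"
  proof -
    have "\<exists>F. finite F \<and> F \<subseteq> H \<and> (\<forall>h\<in>H. \<exists>f\<in>F. \<exists>a\<in>Z. \<exists>b\<in>Z. h = f \<otimes> (a \<otimes> inv\<^bsub>G\<lparr>carrier := H\<rparr>\<^esub> b))"
      using H.finite_translates_cover[OF nZ(1-3)] by simp
    moreover have "inv\<^bsub>G\<lparr>carrier := H\<rparr>\<^esub> b = inv b" if "b \<in> Z" for b using m_inv_consistent[OF H(1)] that ZH by blast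
    ultimately show ?thesis using that by (metis (no_types, lifting))
  qed
  define D where "D = (\<lambda>z. fst z \<otimes> inv (snd z)) ` (Z \<times> Z)"
  have "compactin (prod_topology T T) (Z \<times> Z)" using closed_compact[OF Zcl] by (simp add: compactin_Times)
  moreover have "continuous_map (prod_topology T T) T (\<lambda>z. fst z \<otimes> inv (snd z))" by (intro continuous_group)
  ultimately have "closedin T D" unfolding D_def using image_compactin compact_closed by blast
  have sDH: "f <# D \<subseteq> H" if "f \<in> F" for f
    using that F(2) ZH subgroup.m_closed[OF H(1)] subgroup.m_inv_closed[OF H(1)] by (auto simp: l_coset_image D_def subset_iff)
  have cl: "closedin ?S C" if CF: "C \<in> (\<lambda>f. f <# D) ` F" for C
  proof -
    obtain f where f: "f \<in> F" "C = f <# D" using CF by blast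
    then have "closedin T C" using closed_translate \<open>closedin T D\<close> F(2) Hc by blast
    then show ?thesis using sDH[OF f(1)] f(2) by (simp add: closedin_subset_topspace)
  qed
  have "openin ?S H" using openin_topspace[of ?S] by (simp add: Int_absorb1[OF Hc])
  moreover have "H \<noteq> {}" using subgroup.one_closed[OF H(1)] by blast
  moreover have "H \<subseteq> \<Union>((\<lambda>f. f <# D) ` F)"
  proof
    fix h assume "h \<in> H"
    then obtain f a b where "f \<in> F" "a \<in> Z" "b \<in> Z" "h = f \<otimes> (a \<otimes> inv b)" using F(3) by blast
    then show "h \<in> \<Union>((\<lambda>f. f <# D) ` F)" by (force simp: l_coset_image D_def)
  qed
  ultimately have "\<exists>C\<in>(\<lambda>f. f <# D) ` F. \<exists>V. openin ?S V \<and> V \<noteq> {} \<and> V \<subseteq> C"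
    using F(1) cl by (intro open_subset_finite_closed_cover) auto
  then obtain f V where f: "f \<in> F" "openin ?S V" "V \<noteq> {}" "V \<subseteq> f <# D" by blast
  then obtain U where U: "openin T U" "V = U \<inter> H" by (auto simp: openin_subtopology)
  obtain h where h: "h \<in> V" using f by blast
  then have hc: "h \<in> carrier G" "h \<in> H" using U Hc by auto
  have fc: "f \<in> carrier G" using f F Hc by auto
  have "continuous_map T T (\<lambda>x. h \<otimes> x)" using hc by (intro continuous_group)
  from open_preimage[OF this U(1)] obtain N where N: "N \<in> ONS" "N \<subseteq> {x \<in> carrier G. h \<otimes> x \<in> U}"
    using ONS_base[of "{x \<in> carrier G. h \<otimes> x \<in> U}"] h U hc by auto
  \<comment> \<open>if \<open>h = f v\<close> and \<open>h x = f u\<close> with \<open>u, v \<in> Z Z\<inverse>\<close>, then \<open>x = v\<inverse> u\<close>\<close>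
  have "finite (orbit_under K x) \<and> card (orbit_under K x) \<le> (n * n) * (n * n)" if x: "x \<in> H \<inter> N" for x
  proof -
    have xc: "x \<in> carrier G" using x Hc by auto
    have "h \<otimes> x \<in> V" using x N(2) U(2) subgroup.m_closed[OF H(1) hc(2)] by auto
    then obtain u where u: "u \<in> D" "h \<otimes> x = f \<otimes> u" using f(4) unfolding l_coset_image by blast
    obtain v where v: "v \<in> D" "h = f \<otimes> v" using f(4) h unfolding l_coset_image by blast
    have D: "w \<in> carrier G \<and> finite (orbit_under K w) \<and> card (orbit_under K w) \<le> n * n" if wD: "w \<in> D" for w
    proof -
      obtain a b where ab: "a \<in> Z" "b \<in> Z" "w = a \<otimes> inv b" using wD by (auto simp: D_def)
      have c: "a \<in> carrier G" "b \<in> carrier G" using ab ZH Hc by auto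
      note i = orbit_under_inv[OF Kc c(2)]
      note m = orbit_under_mult[OF Kc c(1) inv_closed[OF c(2)]]
      have "finite (orbit_under K w)" using m(1) i(1) nZ(4) ab by blast
      moreover have "card (orbit_under K w) \<le> card (orbit_under K a) * card (orbit_under K (inv b))"
        using m(2) i(1) nZ(4) ab by blast
      moreover have "\<dots> \<le> n * n" using nZ(4) ab i(2) by (meson mult_le_mono order_trans)
      ultimately show ?thesis using ab c by auto
    qed
    have uv: "u \<in> carrier G" "v \<in> carrier G" using D u v by auto
    have "f \<otimes> (v \<otimes> x) = f \<otimes> u" using u(2) v(2) fc uv xc by (simp add: m_assoc)
    then have "v \<otimes> x = u" using fc uv xc by simp
    then have xe: "x = inv v \<otimes> u" using uv xc by (metis inv_cancel(1))
    note i = orbit_under_inv[OF Kc uv(2)]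
    note m = orbit_under_mult[OF Kc inv_closed[OF uv(2)] uv(1)]
    have "finite (orbit_under K x)" using m(1) i(1) D u v xe by blast
    moreover have "card (orbit_under K x) \<le> card (orbit_under K (inv v)) * card (orbit_under K u)"
      using m(2) i(1) D u v xe by blast
    moreover have "\<dots> \<le> (n * n) * (n * n)" using D u v i(2) by (meson mult_le_mono order_trans)
    ultimately show ?thesis by auto
  qed
  then show ?thesis using N(1) by blast
qed

lemma ONS_finite_refine:
  assumes "finite J" "\<And>k. k \<in> J \<Longrightarrow> N k \<in> ONS"
  shows "\<exists>M\<in>ONS. \<forall>k\<in>J. M \<subseteq> N k"
  using assms
proof (induction J)
  case empty then show ?case using ONS_carrier by blast
next
  case (insert k J)
  then obtain M where M: "M \<in> ONS" "\<forall>j\<in>J. M \<subseteq> N j" by auto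
  then have "M \<inter> N k \<in> ONS" using insert.prems by (intro ONS_Int) auto
  then show ?case using M(2) by (intro bexI[of _ "M \<inter> N k"]) auto
qed

lemma ONS_avoid_finite:
  assumes "finite D" "D \<subseteq> carrier G"
  shows "\<exists>N\<in>ONS. N \<inter> D \<subseteq> {\<one>}"
proof -
  have "closedin T (D - {\<one>})" using assms by (intro closedin_Hausdorff_finite[OF Hausdorff]) auto
  then have "openin T (carrier G - (D - {\<one>}))" using openin_diff[OF openin_topspace] by fastforce
  then obtain N where "N \<in> ONS" "N \<subseteq> carrier G - (D - {\<one>})" using ONS_base[of "carrier G - (D - {\<one>})"] by auto
  then show ?thesis by blast
qed

text \<open>Neumann's argument. Choose \<open>x\<close> in \<open>H\<^sub>0\<close> with a largest orbit under \<open>K\<^sub>0\<close>, the conjugates of \<open>x\<close> by a finite set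
  \<open>J\<close>. If \<open>h\<close> centralises \<open>J\<close>, the conjugates of \<open>x h\<close> by \<open>J\<close> are the conjugates of \<open>x\<close> by \<open>J\<close>, multiplied by \<open>h\<close>;
  they are distinct, and so by maximality they are the whole orbit of \<open>x h\<close>. Comparing with
  the conjugate by an arbitrary \<open>k\<close> confines \<open>k h k\<inverse> h\<inverse>\<close> to a finite set. The centraliser of \<open>J\<close> is open since
  the elements of \<open>J\<close> have finite orbits under \<open>H\<close>.\<close>

theorem commuting_open_subgroups:
  assumes H: "subgroup H G" "closedin T H" and K: "subgroup K G" "closedin T K"
    and pos: "commuting_prob G T H K > 0" "commuting_prob G T K H > 0"
  shows "\<exists>N\<in>ONS. \<forall>h\<in>H \<inter> N. \<forall>k\<in>K \<inter> N. h \<otimes> k = k \<otimes> h"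
proof -
  have Hc: "H \<subseteq> carrier G" and Kc: "K \<subseteq> carrier G" using subgroup.subset H K by auto
  obtain N0 n0 where N0: "N0 \<in> ONS" "\<And>x. x \<in> H \<inter> N0 \<Longrightarrow> finite (orbit_under K x) \<and> card (orbit_under K x) \<le> n0"
    using commuting_prob_pos_bounded_orbits[OF H K pos(1)] by blast
  obtain N1 n1 where N1: "N1 \<in> ONS" "\<And>x. x \<in> K \<inter> N1 \<Longrightarrow> finite (orbit_under H x) \<and> card (orbit_under H x) \<le> n1"
    using commuting_prob_pos_bounded_orbits[OF K H pos(2)] by blast
  define N where "N = N0 \<inter> N1"
  have N: "N \<in> ONS" unfolding N_def using ONS_Int N0(1) N1(1) by blast
  define H0 K0 where "H0 = H \<inter> N" and "K0 = K \<inter> N"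
  have sH0: "subgroup H0 G" unfolding H0_def using H(1) ONS_D(2)[OF N] subgroups_Inter_pair by blast
  have H0c: "H0 \<subseteq> carrier G" and K0c: "K0 \<subseteq> carrier G" using Hc Kc by (auto simp: H0_def K0_def)
  have orb: "finite (orbit_under K0 x) \<and> card (orbit_under K0 x) \<le> n0" if "x \<in> H0" for x
  proof -
    have sub: "orbit_under K0 x \<subseteq> orbit_under K x" by (auto simp: orbit_under_def K0_def)
    have "finite (orbit_under K x)" "card (orbit_under K x) \<le> n0" using N0(2)[of x] that by (auto simp: H0_def N_def)
    then show ?thesis using finite_subset[OF sub] card_mono[OF _ sub] by simp
  qed
  have "\<one> \<in> H0" using subgroup.one_closed[OF sH0] .
  then obtain x where x: "x \<in> H0" "\<And>y. y \<in> H0 \<Longrightarrow> card (orbit_under K0 y) \<le> card (orbit_under K0 x)"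
    using ex_has_greatest_nat[of "\<lambda>x. x \<in> H0" \<one> "\<lambda>x. card (orbit_under K0 x)" "Suc n0"] orb
    by (metis le_imp_less_Suc)
  have xc: "x \<in> carrier G" using x H0c by auto
  let ?f = "\<lambda>k. k \<otimes> x \<otimes> inv k"
  \<comment> \<open>representatives of the elements of the orbit\<close>
  obtain J where J: "J \<subseteq> K0" "inj_on ?f J" "orbit_under K0 x = ?f ` J"
    using subset_image_inj[of "orbit_under K0 x" ?f K0] by (auto simp: orbit_under_def)
  have finJ: "finite J" using orb[OF x(1)] J finite_imageD by metis
  have Jc: "J \<subseteq> carrier G" using J K0c by auto
  have "\<exists>M\<in>ONS. \<forall>h\<in>H \<inter> M. h \<otimes> k = k \<otimes> h" if k: "k \<in> J" for k
  proof -
    have kc: "k \<in> carrier G" using k Jc by auto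
    have fin: "finite (orbit_under H k)" using N1(2)[of k] k J(1) by (auto simp: K0_def N_def)
    have oc: "orbit_under H k \<subseteq> carrier G" using Hc kc by (auto simp: orbit_under_def)
    have "closedin T (orbit_under H k - {k})" using fin oc by (intro closedin_Hausdorff_finite[OF Hausdorff]) auto
    then have op: "openin T (carrier G - (orbit_under H k - {k}))" using openin_diff[OF openin_topspace] by fastforce
    have "continuous_map T T (\<lambda>h. h \<otimes> k \<otimes> inv h)" using kc by (intro continuous_group)
    from open_preimage[OF this op] obtain M where M: "M \<in> ONS"
      "M \<subseteq> {h \<in> carrier G. h \<otimes> k \<otimes> inv h \<in> carrier G - (orbit_under H k - {k})}"
      using ONS_base[of "{h \<in> carrier G. h \<otimes> k \<otimes> inv h \<in> carrier G - (orbit_under H k - {k})}"] kc by auto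
    have "h \<otimes> k = k \<otimes> h" if h: "h \<in> H \<inter> M" for h
    proof -
      have hc: "h \<in> carrier G" using h Hc by auto
      have "h \<otimes> k \<otimes> inv h \<in> orbit_under H k" using h by (auto simp: orbit_under_def)
      then have "h \<otimes> k \<otimes> inv h = k" using M(2) h by blast
      then have "k \<otimes> h = (h \<otimes> k \<otimes> inv h) \<otimes> h" by simp
      then show ?thesis using hc kc by (simp add: m_assoc)
    qed
    then show ?thesis using M(1) by blast
  qed
  then obtain Nk where Nk: "\<And>k. k \<in> J \<Longrightarrow> Nk k \<in> ONS \<and> (\<forall>h\<in>H \<inter> Nk k. h \<otimes> k = k \<otimes> h)" by metis
  then obtain N3 where N3: "N3 \<in> ONS" "\<forall>k\<in>J. N3 \<subseteq> Nk k" using ONS_finite_refine[OF finJ, of Nk] by blast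
  define D where "D = (\<lambda>(u, v). inv u \<otimes> v) ` (orbit_under K0 x \<times> orbit_under K0 x)"
  have "orbit_under K0 x \<subseteq> carrier G" using K0c xc by (auto simp: orbit_under_def)
  then have Dc: "D \<subseteq> carrier G" by (auto simp: D_def)
  have "finite D" using orb[OF x(1)] by (simp add: D_def)
  then obtain N2 where N2: "N2 \<in> ONS" "N2 \<inter> D \<subseteq> {\<one>}" using ONS_avoid_finite Dc by blast
  define N' where "N' = N \<inter> N2 \<inter> N3"
  have N': "N' \<in> ONS" unfolding N'_def using ONS_Int N N2(1) N3(1) by blast
  have "h \<otimes> k = k \<otimes> h" if hk: "h \<in> H \<inter> N'" "k \<in> K \<inter> N'" for h k
  proof -
    have c: "h \<in> carrier G" "k \<in> carrier G" using hk Hc Kc by auto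
    have hH0: "h \<in> H0" and kK0: "k \<in> K0" using hk by (auto simp: H0_def K0_def N'_def)
    have comm: "j \<otimes> h = h \<otimes> j" if "j \<in> J" for j
    proof -
      have "h \<in> H \<inter> Nk j" using N3(2) hk(1) that unfolding N'_def by blast
      then show ?thesis using Nk[OF that] by simp
    qed
    have xh: "x \<otimes> h \<in> H0" using x(1) hH0 subgroup.m_closed[OF sH0] by blast
    have eqj: "j \<otimes> (x \<otimes> h) \<otimes> inv j = ?f j \<otimes> h" if "j \<in> J" for j
    proof -
      have jc: "j \<in> carrier G" using that Jc by auto
      have "inv j \<otimes> h = h \<otimes> inv j"
      proof -
        have "inv j \<otimes> h = inv j \<otimes> (h \<otimes> j) \<otimes> inv j" using jc c by (simp add: m_assoc)
        also have "\<dots> = h \<otimes> inv j" unfolding comm[OF that, symmetric] using jc c by simp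
        finally show ?thesis .
      qed
      then show ?thesis using jc c xc by (simp add: m_assoc)
    qed
    have inj: "inj_on (\<lambda>j. j \<otimes> (x \<otimes> h) \<otimes> inv j) J"
    proof (rule inj_onI)
      fix i j assume ij: "i \<in> J" "j \<in> J" "i \<otimes> (x \<otimes> h) \<otimes> inv i = j \<otimes> (x \<otimes> h) \<otimes> inv j"
      then have "?f i \<otimes> h = ?f j \<otimes> h" using eqj by simp
      then have "?f i = ?f j" using ij Jc xc c by (auto simp: subset_iff)
      then show "i = j" using J(2) ij by (auto simp: inj_on_def)
    qed
    have sub: "(\<lambda>j. j \<otimes> (x \<otimes> h) \<otimes> inv j) ` J \<subseteq> orbit_under K0 (x \<otimes> h)" using J(1) by (auto simp: orbit_under_def)
    have "card (orbit_under K0 (x \<otimes> h)) \<le> card J" using x(2)[OF xh] J by (simp add: card_image)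
    also have "\<dots> = card ((\<lambda>j. j \<otimes> (x \<otimes> h) \<otimes> inv j) ` J)" using inj by (simp add: card_image)
    finally have "(\<lambda>j. j \<otimes> (x \<otimes> h) \<otimes> inv j) ` J = orbit_under K0 (x \<otimes> h)"
      using card_seteq[OF _ sub] orb[OF xh] by blast
    moreover have "k \<otimes> (x \<otimes> h) \<otimes> inv k \<in> orbit_under K0 (x \<otimes> h)" using kK0 by (auto simp: orbit_under_def)
    ultimately obtain j where j: "j \<in> J" "k \<otimes> (x \<otimes> h) \<otimes> inv k = ?f j \<otimes> h" using eqj by auto
    have jc: "j \<in> carrier G" using j Jc by auto
    have "(?f k) \<otimes> (k \<otimes> h \<otimes> inv k) = ?f j \<otimes> h" using j(2) c xc by (simp add: m_assoc)
    moreover have "w \<otimes> inv h = inv a \<otimes> b"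
      if abw: "a \<otimes> w = b \<otimes> h" "a \<in> carrier G" "b \<in> carrier G" "w \<in> carrier G" for a b w
    proof -
      have "w = inv a \<otimes> (b \<otimes> h)" using abw c by (metis inv_cancel(1))
      then show ?thesis using abw(2,3) c by (simp add: m_assoc)
    qed
    ultimately have "k \<otimes> h \<otimes> inv k \<otimes> inv h = inv (?f k) \<otimes> ?f j" using c xc jc by blast
    moreover have "?f k \<in> orbit_under K0 x" "?f j \<in> orbit_under K0 x" using kK0 j(1) J(1) by (auto simp: orbit_under_def)
    ultimately have "k \<otimes> h \<otimes> inv k \<otimes> inv h \<in> D" by (force simp: D_def)
    moreover have "k \<otimes> h \<otimes> inv k \<otimes> inv h \<in> N2"
      using ONS_conj[OF N2(1), of h k] hk c ONS_D(2)[OF N2(1)] by (simp add: N'_def subgroup.m_closed subgroup.m_inv_closed)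
    ultimately have one: "k \<otimes> h \<otimes> inv k \<otimes> inv h = \<one>" using N2(2) by blast
    have "k \<otimes> h = (k \<otimes> h \<otimes> inv k \<otimes> inv h) \<otimes> (h \<otimes> k)" using c by (simp add: m_assoc)
    then show ?thesis using one c by simp
  qed
  then show ?thesis using N' by blast
qed

end

section \<open>Existence of Sylow subgroups\<close>

context group
begin

definition conj_set :: "'a \<Rightarrow> 'a set \<Rightarrow> 'a set" where
  "conj_set g A = (\<lambda>x. g \<otimes> x \<otimes> inv g) ` A"

lemma conj_set_iff:
  assumes "g \<in> carrier G" "A \<subseteq> carrier G" "x \<in> carrier G"
  shows "x \<in> conj_set g A \<longleftrightarrow> inv g \<otimes> x \<otimes> g \<in> A"
proof
  assume "x \<in> conj_set g A"
  then obtain a where "a \<in> A" "x = g \<otimes> a \<otimes> inv g" by (auto simp: conj_set_def)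
  then show "inv g \<otimes> x \<otimes> g \<in> A" using assms by (auto simp: m_assoc subset_iff)
next
  assume "inv g \<otimes> x \<otimes> g \<in> A"
  moreover have "x = g \<otimes> (inv g \<otimes> x \<otimes> g) \<otimes> inv g" using assms by (simp add: m_assoc)
  ultimately show "x \<in> conj_set g A" unfolding conj_set_def by blast
qed

lemma subgroup_conj_set:
  assumes "g \<in> carrier G" "subgroup A G" shows "subgroup (conj_set g A) G"
proof (rule subgroupI)
  note c = subgroup.mem_carrier[OF assms(2)]
  show "conj_set g A \<subseteq> carrier G" using assms(1) c by (auto simp: conj_set_def)
  show "conj_set g A \<noteq> {}" using subgroup.one_closed[OF assms(2)] by (auto simp: conj_set_def)
  fix x assume "x \<in> conj_set g A"
  then obtain a where a: "a \<in> A" "x = g \<otimes> a \<otimes> inv g" by (auto simp: conj_set_def)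
  then have "inv x = g \<otimes> inv a \<otimes> inv g" using assms(1) c by (simp add: inv_mult_group m_assoc)
  then show "inv x \<in> conj_set g A" using a subgroup.m_inv_closed[OF assms(2)] unfolding conj_set_def by blast
  fix y assume "y \<in> conj_set g A"
  then obtain b where b: "b \<in> A" "y = g \<otimes> b \<otimes> inv g" by (auto simp: conj_set_def)
  have "x \<otimes> y = g \<otimes> (a \<otimes> b) \<otimes> inv g" using a b assms(1) c by (simp add: m_assoc)
  then show "x \<otimes> y \<in> conj_set g A" using a b subgroup.m_closed[OF assms(2)] unfolding conj_set_def by blast
qed

lemma conj_nat_pow:
  assumes "g \<in> carrier G" "x \<in> carrier G"
  shows "(g \<otimes> x \<otimes> inv g) [^] (e::nat) = g \<otimes> x [^] e \<otimes> inv g"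
  using assms by (induction e) (simp_all add: m_assoc)

definition commutator :: "'a \<Rightarrow> 'a \<Rightarrow> 'a" where
  "commutator x y = x \<otimes> y \<otimes> inv x \<otimes> inv y"

lemma commutator_eq_one:
  assumes "x \<in> carrier G" "y \<in> carrier G"
  shows "commutator x y = \<one> \<longleftrightarrow> x \<otimes> y = y \<otimes> x"
proof -
  have 1: "x \<otimes> y = commutator x y \<otimes> (y \<otimes> x)" using assms by (simp add: commutator_def m_assoc)
  show ?thesis
  proof
    assume "commutator x y = \<one>"
    then show "x \<otimes> y = y \<otimes> x" using 1 assms by simp
  next
    assume "x \<otimes> y = y \<otimes> x"
    then have "commutator x y = y \<otimes> x \<otimes> inv x \<otimes> inv y" by (simp add: commutator_def)
    also have "\<dots> = \<one>" using assms by (simp add: m_assoc)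
    finally show "commutator x y = \<one>" .
  qed
qed

lemma rcos_mult_cong:
  assumes "N \<lhd> G" "x \<in> carrier G" "x' \<in> carrier G" "y \<in> carrier G" "y' \<in> carrier G"
    "N #> x = N #> x'" "N #> y = N #> y'"
  shows "N #> (x \<otimes> y) = N #> (x' \<otimes> y')"
  using normal.rcos_sum[OF assms(1,2,4)] normal.rcos_sum[OF assms(1,3,5)] assms(6,7) by simp

lemma rcos_inv_cong:
  assumes "N \<lhd> G" "x \<in> carrier G" "x' \<in> carrier G" "N #> x = N #> x'"
  shows "N #> inv x = N #> inv x'"
  using normal.rcos_inv[OF assms(1,2)] normal.rcos_inv[OF assms(1,3)] assms(4) by simp

lemma commutator_cong:
  assumes "N \<lhd> G" "x \<in> carrier G" "x' \<in> carrier G" "y \<in> carrier G" "y' \<in> carrier G"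
    "N #> x = N #> x'" "N #> y = N #> y'"
  shows "N #> commutator x y = N #> commutator x' y'"
  unfolding commutator_def using assms by (intro rcos_mult_cong rcos_inv_cong) auto

end

context profinite
begin

lemma open_subgroup_closed: "subgroup M G \<Longrightarrow> openin T M \<Longrightarrow> closedin T M"
  using closed_r_coset[of M \<one>] coset_mult_one[of M] subgroup.subset[of M G] by simp

lemma set_mult_ONS:
  assumes P: "subgroup P G" and M: "M \<in> ONS"
  shows "subgroup (P <#> M) G" "P \<subseteq> P <#> M" "M \<subseteq> P <#> M" "openin T (P <#> M)" "finite (rcosets (P <#> M))"
    "P <#> M = M <#> P"
proof -
  show s: "subgroup (P <#> M) G"
    by (rule subgroup_set_mult_normalising[OF P ONS_D(2)[OF M]])
      (use ONS_conj[OF M] subgroup.mem_carrier[OF P] in blast)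
  show sub: "P \<subseteq> P <#> M" "M \<subseteq> P <#> M" using subset_set_mult[OF P ONS_D(2)[OF M]] by auto
  show o: "openin T (P <#> M)" using open_subgroup[OF s M sub(2)] .
  show "finite (rcosets (P <#> M))" using open_subgroup_finite_index[OF s o] .
  show "P <#> M = M <#> P" using commut_normal[OF P ONS_D(1)[OF M]] .
qed

lemma set_mult_ONS_absorb:
  assumes P: "subgroup P G" and M: "M \<in> ONS" and C: "P \<subseteq> C" "C \<subseteq> P <#> M"
  shows "C <#> M = P <#> M"
proof
  show "C <#> M \<subseteq> P <#> M"
  proof
    fix x assume "x \<in> C <#> M"
    then obtain c m where "c \<in> C" "m \<in> M" "x = c \<otimes> m" by (auto simp: set_mult_iff)
    then show "x \<in> P <#> M" using C(2) set_mult_ONS(3)[OF P M] subgroup.m_closed[OF set_mult_ONS(1)[OF P M]] by blast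
  qed
  show "P <#> M \<subseteq> C <#> M" using C(1) by (intro mono_set_mult) auto
qed

lemma closed_eq_Inter_set_mult:
  assumes P: "subgroup P G" "closedin T P" and x: "\<And>M. M \<in> ONS \<Longrightarrow> x \<in> P <#> M"
  shows "x \<in> P"
proof (rule ccontr)
  assume xP: "x \<notin> P"
  have "x \<in> carrier G" using subgroup.subset[OF set_mult_ONS(1)[OF P(1) ONS_carrier]] x[OF ONS_carrier] by blast
  then obtain N where N: "N \<in> ONS" "\<forall>n\<in>N. n \<otimes> x \<notin> P"
    using ONS_avoid_closed[OF P(2)] xP by blast
  have "x \<in> N <#> P" using x[OF N(1)] set_mult_ONS(6)[OF P(1) N(1)] by simp
  then obtain n a where na: "n \<in> N" "a \<in> P" "x = n \<otimes> a" by (auto simp: set_mult_iff)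
  have "inv n \<otimes> x = a" using na ONS_D(4)[OF N(1)] subgroup.mem_carrier[OF P(1)] by auto
  moreover have "inv n \<in> N" using na ONS_D(2)[OF N(1)] by (simp add: subgroup.m_inv_closed)
  ultimately show False using N(2) na by metis
qed

text \<open>\<open>S M\<close> has index prime to \<open>p\<close> for each open normal \<open>M\<close>: the image of \<open>S\<close> in every finite quotient of \<open>G\<close>
  contains a Sylow \<open>p\<close>-subgroup.\<close>

definition coprime_index :: "nat \<Rightarrow> 'a set \<Rightarrow> bool" where
  "coprime_index p S \<longleftrightarrow> (\<forall>M \<in> ONS. \<not> p dvd rel_index (carrier G) (S <#> M))"

text \<open>Pro-p subgroups whose images in the finite quotients of \<open>G\<close> are Sylow subgroups. They are Sylow
  subgroups in the sense of maximality (\<open>large_p_subgroup_sylow\<close>); the condition on the index allows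
  comparing orders in finite quotients, in place of conjugacy of Sylow subgroups.\<close>

definition large_p_subgroup :: "nat \<Rightarrow> 'a set \<Rightarrow> bool" where
  "large_p_subgroup p P \<longleftrightarrow> subgroup P G \<and> closedin T P \<and> pi_torsion {p} P \<and> coprime_index p P"

text \<open>By compactness, modulo an open normal subgroup the intersection of a chain agrees with one of its
  members.\<close>

lemma coprime_index_Inter:
  assumes ch: "\<And>A B. A \<in> \<C> \<Longrightarrow> B \<in> \<C> \<Longrightarrow> A \<subseteq> B \<or> B \<subseteq> A" and ne: "\<C> \<noteq> {}"
    and mem: "\<And>S. S \<in> \<C> \<Longrightarrow> subgroup S G \<and> closedin T S \<and> coprime_index p S"
  shows "subgroup (\<Inter>\<C>) G \<and> closedin T (\<Inter>\<C>) \<and> coprime_index p (\<Inter>\<C>)"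
proof (intro conjI)
  show s: "subgroup (\<Inter>\<C>) G" using subgroups_Inter[of \<C>] mem ne by blast
  show "closedin T (\<Inter>\<C>)" using ne mem by (intro closedin_Inter) auto
  show "coprime_index p (\<Inter>\<C>)"
    unfolding coprime_index_def
  proof
    fix M assume M: "M \<in> ONS"
    have "\<exists>C\<in>\<C>. C \<subseteq> \<Inter>\<C> <#> M"
    proof (rule directed_closed_subset_open[OF compact ne])
      show "\<And>C. C \<in> \<C> \<Longrightarrow> closedin T C" using mem by blast
      show "\<exists>C\<in>\<C>. C \<subseteq> A \<inter> B" if "A \<in> \<C>" "B \<in> \<C>" for A B using ch[OF that] that by blast
    qed (use set_mult_ONS[OF s M] in auto)
    then obtain C where C: "C \<in> \<C>" "C \<subseteq> \<Inter>\<C> <#> M" by blast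
    then have "C <#> M = \<Inter>\<C> <#> M" using set_mult_ONS_absorb[OF s M, of C] by blast
    then show "\<not> p dvd rel_index (carrier G) (\<Inter>\<C> <#> M)" using mem[OF C(1)] M unfolding coprime_index_def by metis
  qed
qed

text \<open>Zorn's lemma for complements.\<close>

lemma coprime_index_minimal:
  "\<exists>S. subgroup S G \<and> closedin T S \<and> coprime_index p S \<and>
    (\<forall>S'. subgroup S' G \<and> closedin T S' \<and> coprime_index p S' \<and> S' \<subseteq> S \<longrightarrow> S' = S)" if p: "prime p"
proof -
  define \<S> where "\<S> = {S. subgroup S G \<and> closedin T S \<and> coprime_index p S}"
  have "carrier G \<in> \<S>"
  proof -
    have "carrier G <#> M = carrier G" if M: "M \<in> ONS" for M
      using set_mult_ONS(2)[OF subgroup_self M] subgroup.subset[OF set_mult_ONS(1)[OF subgroup_self M]] by blast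
    moreover have "rel_index (carrier G) (carrier G) = 1"
    proof -
      have "(\<lambda>b. carrier G #> b) ` carrier G = {carrier G}"
        using coset_join2[OF _ subgroup_self] by auto
      then show ?thesis by (simp add: rel_index_def)
    qed
    ultimately show ?thesis using subgroup_self closedin_topspace[of T] p by (auto simp: \<S>_def coprime_index_def)
  qed
  let ?A = "(\<lambda>S. carrier G - S) ` \<S>"
  have sub: "S \<subseteq> carrier G" if "S \<in> \<S>" for S using that subgroup.subset by (auto simp: \<S>_def)
  have "\<exists>M\<in>?A. \<forall>X\<in>?A. M \<subseteq> X \<longrightarrow> X = M"
  proof (rule subset_Zorn_nonempty)
    show "?A \<noteq> {}" using \<open>carrier G \<in> \<S>\<close> by blast
    fix C assume C: "C \<noteq> {}" "subset.chain ?A C"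
    define \<C> where "\<C> = (\<lambda>X. carrier G - X) ` C"
    have inA: "X \<in> ?A" if "X \<in> C" for X using C(2) that by (auto simp: subset_chain_def)
    have inS: "\<C> \<subseteq> \<S>"
    proof
      fix S assume "S \<in> \<C>"
      then obtain X where X: "X \<in> C" "S = carrier G - X" by (auto simp: \<C>_def)
      then obtain S' where "S' \<in> \<S>" "X = carrier G - S'" using inA by blast
      then show "S \<in> \<S>" using X sub[of S'] by (simp add: double_diff)
    qed
    have "\<Inter>\<C> \<in> \<S>"
    proof -
      have "A \<subseteq> B \<or> B \<subseteq> A" if "A \<in> \<C>" "B \<in> \<C>" for A B
      proof -
        obtain X Y where "X \<in> C" "Y \<in> C" "A = carrier G - X" "B = carrier G - Y" using \<open>A \<in> \<C>\<close> \<open>B \<in> \<C>\<close> by (auto simp: \<C>_def)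
        moreover from this have "X \<subseteq> Y \<or> Y \<subseteq> X" using C(2) by (auto simp: subset_chain_def)
        ultimately show ?thesis by blast
      qed
      moreover have "\<C> \<noteq> {}" using C(1) by (simp add: \<C>_def)
      ultimately have "subgroup (\<Inter>\<C>) G \<and> closedin T (\<Inter>\<C>) \<and> coprime_index p (\<Inter>\<C>)"
        using inS by (intro coprime_index_Inter) (auto simp: \<S>_def)
      then show ?thesis by (simp add: \<S>_def)
    qed
    moreover have "\<Union>C = carrier G - \<Inter>\<C>"
    proof -
      have "X \<subseteq> carrier G" if "X \<in> C" for X using inA[OF that] by blast
      then show ?thesis unfolding \<C>_def by blast
    qed
    ultimately show "\<Union>C \<in> ?A" by blast
  qed
  then obtain S where S: "S \<in> \<S>" "\<And>S'. S' \<in> \<S> \<Longrightarrow> carrier G - S \<subseteq> carrier G - S' \<Longrightarrow> carrier G - S' = carrier G - S" by blast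
  have "S' = S" if S': "S' \<in> \<S>" "S' \<subseteq> S" for S'
  proof -
    have "carrier G - S' = carrier G - S" using S(2)[OF S'(1)] S'(2) by blast
    then show ?thesis using sub[OF S'(1)] sub[OF S(1)] by blast
  qed
  then show ?thesis using S(1) unfolding \<S>_def by blast
qed

text \<open>A minimal closed subgroup \<open>S\<close> with index prime to \<open>p\<close> is pro-p: if \<open>S / (S \<inter> M)\<close> were not a \<open>p\<close>-group, the
  preimage in \<open>S\<close> of one of its Sylow subgroups would be smaller and still have index prime to \<open>p\<close>.\<close>

lemma large_p_subgroup_exists:
  assumes p: "prime p" shows "\<exists>P. large_p_subgroup p P"
proof -
  obtain S where S: "subgroup S G" "closedin T S" "coprime_index p S"
    "\<And>S'. subgroup S' G \<Longrightarrow> closedin T S' \<Longrightarrow> coprime_index p S' \<Longrightarrow> S' \<subseteq> S \<Longrightarrow> S' = S"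
    using coprime_index_minimal[OF p] by blast
  have Sc: "S \<subseteq> carrier G" using subgroup.subset[OF S(1)] .
  have "\<forall>x\<in>S. \<exists>e. pi_number {p} e \<and> x [^] e \<in> M" if M: "M \<in> ONS" for M
  proof -
    define K where "K = S \<inter> M"
    have nK: "K \<lhd> (G\<lparr>carrier := S\<rparr>)" using normal_Int_subgroup[OF S(1) ONS_D(1)[OF M]] by (simp add: K_def Int_commute)
    interpret K: normal K "G\<lparr>carrier := S\<rparr>" by (rule nK)
    let ?Q = "(G\<lparr>carrier := S\<rparr>) Mod K"
    have sK: "subgroup K G" using K_def S(1) ONS_D(2)[OF M] subgroups_Inter_pair by blast
    have rc: "K #>\<^bsub>G\<lparr>carrier := S\<rparr>\<^esub> y = K #> y" for y by (simp add: r_coset_def)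
    have car: "carrier ?Q = (\<lambda>b. K #> b) ` S" by (auto simp: FactGroup_def RCOSETS_def r_coset_def)
    have ord: "order ?Q = rel_index S M" using order_subgroup_Mod[of S K] rel_index_Int[OF S(1) ONS_D(2)[OF M]] by (simp add: K_def)
    have pos: "rel_index S M > 0" using rel_index_pos[OF M Sc] subgroup.one_closed[OF S(1)] by blast
    have fQ: "finite (carrier ?Q)" using pos ord card_ge_0_finite[of "carrier ?Q"] by (simp add: order_def)
    obtain a m where am: "rel_index S M = p ^ a * m" "\<not> p dvd m"
      using multiplicity_decompose'[of "rel_index S M" p] pos p by (metis not_prime_unit less_not_refl)
    obtain Y where Y: "subgroup Y ?Q" "card Y = p ^ a"
      using sylow_thm[OF p K.factorgroup_is_group _ fQ, of a m] ord am by auto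
    define S' where "S' = {s \<in> S. K #> s \<in> Y}"
    have sum: "(K #> x) \<otimes>\<^bsub>?Q\<^esub> (K #> y) = K #> (x \<otimes> y)" if "x \<in> S" "y \<in> S" for x y
      using K.rcos_sum[of x y] that by (simp add: rc)
    have invq: "inv\<^bsub>?Q\<^esub> (K #> x) = K #> inv x" if "x \<in> S" for x
    proof -
      have "K #> x \<in> carrier ?Q" using car that by blast
      then show ?thesis using K.inv_FactGroup[of "K #> x"] K.rcos_inv[of x] that m_inv_consistent[OF S(1) that] by (simp add: rc)
    qed
    have K1: "K = \<one>\<^bsub>?Q\<^esub>" by (simp add: FactGroup_def)
    have sS': "subgroup S' G"
    proof (rule subgroupI)
      show "S' \<subseteq> carrier G" using Sc by (auto simp: S'_def)
      have "K #> \<one> = K" using coset_mult_one[OF subgroup.subset[OF sK]] .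
      then have "\<one> \<in> S'" using subgroup.one_closed[OF S(1)] subgroup.one_closed[OF Y(1)] K1 by (simp add: S'_def)
      then show "S' \<noteq> {}" by blast
      fix x assume x: "x \<in> S'"
      then have xS: "x \<in> S" "K #> x \<in> Y" by (simp_all add: S'_def)
      show "inv x \<in> S'"
        using subgroup.m_inv_closed[OF Y(1) xS(2)] subgroup.m_inv_closed[OF S(1) xS(1)] invq[OF xS(1)] by (simp add: S'_def)
      fix y assume y: "y \<in> S'"
      then have yS: "y \<in> S" "K #> y \<in> Y" by (simp_all add: S'_def)
      show "x \<otimes> y \<in> S'"
        using subgroup.m_closed[OF Y(1) xS(2) yS(2)] subgroup.m_closed[OF S(1) xS(1) yS(1)] sum[OF xS(1) yS(1)] by (simp add: S'_def)
    qed
    have S'S: "S' \<subseteq> S" by (auto simp: S'_def)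
    have KS': "K \<subseteq> S'"
    proof
      fix k assume k: "k \<in> K"
      then have "K #> k = K" using coset_join2[OF _ sK k] subgroup.subset[OF sK] by auto
      then show "k \<in> S'" using k subgroup.one_closed[OF Y(1)] K1 by (auto simp: S'_def K_def)
    qed
    \<comment> \<open>by this, \<open>|S L : S' L| = |S : S'|\<close> for all small \<open>L\<close>\<close>
    have inter: "S \<inter> (S' <#> L) = S'" if L: "L \<in> ONS" "L \<subseteq> M" for L
    proof
      show "S' \<subseteq> S \<inter> (S' <#> L)" using S'S set_mult_ONS(2)[OF sS' L(1)] by blast
      show "S \<inter> (S' <#> L) \<subseteq> S'"
      proof
        fix x assume x: "x \<in> S \<inter> (S' <#> L)"
        then obtain s l where sl: "s \<in> S'" "l \<in> L" "x = s \<otimes> l" by (auto simp: set_mult_iff)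
        have c: "s \<in> carrier G" "l \<in> carrier G" using sl S'S Sc ONS_D(4)[OF L(1)] by auto
        have "inv s \<otimes> x \<in> S" using sl x S'S subgroup.m_closed[OF S(1)] subgroup.m_inv_closed[OF S(1)] by blast
        moreover have "inv s \<otimes> x = l" using sl c by simp
        ultimately have "l \<in> K" using sl L(2) by (auto simp: K_def)
        then show "x \<in> S'" using sl KS' subgroup.m_closed[OF sS'] by blast
      qed
    qed
    have clS': "closedin T S'"
    proof -
      have "closedin T (S' <#> M)" using open_subgroup_closed set_mult_ONS(1,4)[OF sS' M] by blast
      then have "closedin T (S \<inter> (S' <#> M))" using S(2) by blast
      then show ?thesis using inter[OF M] by simp
    qed
    have SL: "rel_index (S <#> L) (S' <#> L) = rel_index S S'" if L: "L \<in> ONS" "L \<subseteq> M" for L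
    proof -
      have "S <#> L = (S' <#> L) <#> S"
      proof
        show "(S' <#> L) <#> S \<subseteq> S <#> L"
        proof
          fix x assume "x \<in> (S' <#> L) <#> S"
          then obtain u s where "u \<in> S' <#> L" "s \<in> S" "x = u \<otimes> s" by (auto simp: set_mult_iff)
          moreover have "S' <#> L \<subseteq> S <#> L" using S'S by (intro mono_set_mult) auto
          ultimately show "x \<in> S <#> L"
            using set_mult_ONS(2)[OF S(1) L(1)] subgroup.m_closed[OF set_mult_ONS(1)[OF S(1) L(1)]] by blast
        qed
        have "L <#> S \<subseteq> (S' <#> L) <#> S" using set_mult_ONS(3)[OF sS' L(1)] by (intro mono_set_mult) auto
        then show "S <#> L \<subseteq> (S' <#> L) <#> S" using set_mult_ONS(6)[OF S(1) L(1)] by simp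
      qed
      then have "rel_index (S <#> L) (S' <#> L) = rel_index S (S' <#> L)"
        using rel_index_set_mult[OF set_mult_ONS(1)[OF sS' L(1)] Sc] by simp
      also have "\<dots> = rel_index S (S \<inter> (S' <#> L))" using rel_index_Int[OF S(1) set_mult_ONS(1)[OF sS' L(1)]] by simp
      finally show ?thesis using inter[OF L] by simp
    qed
    have ind: "rel_index S S' = m"
    proof -
      have "rel_index (S <#> M) M = rel_index (S <#> M) (S' <#> M) * rel_index (S' <#> M) M"
      proof (rule rel_index_tower[OF ONS_D(2)[OF M] set_mult_ONS(1,3)[OF sS' M] ONS_finite_index[OF M]])
        show "S <#> M \<subseteq> carrier G" using subgroup.subset[OF set_mult_ONS(1)[OF S(1) M]] .
        fix c a assume ca: "c \<in> S' <#> M" "a \<in> S <#> M"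
        have "S' <#> M \<subseteq> S <#> M" using S'S by (intro mono_set_mult) auto
        then show "c \<otimes> a \<in> S <#> M" using ca subgroup.m_closed[OF set_mult_ONS(1)[OF S(1) M]] by blast
      qed
      moreover have "rel_index (S <#> M) M = rel_index S M"
        using set_mult_ONS(6)[OF S(1) M] rel_index_set_mult[OF ONS_D(2)[OF M] Sc] by simp
      moreover have "rel_index (S' <#> M) M = rel_index S' M"
        using set_mult_ONS(6)[OF sS' M] rel_index_set_mult[OF ONS_D(2)[OF M] subgroup.subset[OF sS']] by simp
      moreover have "rel_index S' M = p ^ a"
      proof -
        have "S' \<inter> M = K" using KS' S'S by (auto simp: K_def)
        then have "rel_index S' M = rel_index S' K" using rel_index_Int[OF sS' ONS_D(2)[OF M]] by simp
        also have "(\<lambda>b. K #> b) ` S' = Y" using subgroup.subset[OF Y(1)] car by (auto simp: S'_def)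
        then have "rel_index S' K = p ^ a" using Y(2) by (simp add: rel_index_def)
        finally show ?thesis .
      qed
      ultimately have "p ^ a * m = rel_index S S' * p ^ a" using am(1) SL[OF M] by simp
      then show ?thesis using p by (simp add: prime_gt_0_nat)
    qed
    have "coprime_index p S'"
      unfolding coprime_index_def
    proof
      fix L0 assume L0: "L0 \<in> ONS"
      define L where "L = L0 \<inter> M"
      have L: "L \<in> ONS" "L \<subseteq> M" unfolding L_def using ONS_Int L0 M by auto
      have LL0: "S' <#> L \<subseteq> S' <#> L0" by (intro mono_set_mult) (auto simp: L_def)
      have LS: "S' <#> L \<subseteq> S <#> L" using S'S by (intro mono_set_mult) auto
      have "rel_index (carrier G) (S' <#> L) = rel_index (carrier G) (S <#> L) * rel_index (S <#> L) (S' <#> L)"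
        by (rule rel_index_tower[OF set_mult_ONS(1)[OF sS' L(1)] set_mult_ONS(1)[OF S(1) L(1)] LS set_mult_ONS(5)[OF sS' L(1)]])
          (use subgroup.subset[OF set_mult_ONS(1)[OF S(1) L(1)]] in auto)
      moreover have "rel_index (carrier G) (S' <#> L) = rel_index (carrier G) (S' <#> L0) * rel_index (S' <#> L0) (S' <#> L)"
        by (rule rel_index_tower[OF set_mult_ONS(1)[OF sS' L(1)] set_mult_ONS(1)[OF sS' L0] LL0 set_mult_ONS(5)[OF sS' L(1)]])
          (use subgroup.subset[OF set_mult_ONS(1)[OF sS' L0]] in auto)
      moreover have "\<not> p dvd rel_index (carrier G) (S <#> L)" using S(3) L(1) by (simp add: coprime_index_def)
      ultimately show "\<not> p dvd rel_index (carrier G) (S' <#> L0)"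
        using am(2) SL[OF L] ind p by (metis dvd_mult2 prime_dvd_mult_iff)
    qed
    then have "S' = S" using S(4)[OF sS' clS' _ S'S] by blast
    moreover have "rel_index S S = 1"
    proof -
      have "(\<lambda>b. S #> b) ` S = {S}" using coset_join2[OF _ S(1)] Sc subgroup.one_closed[OF S(1)] by (auto simp: subset_iff)
      then show ?thesis by (simp add: rel_index_def)
    qed
    ultimately have "rel_index S M = p ^ a" using ind am by simp
    then have "pi_number {p} (rel_index S M)" using pi_number_singleton[OF p] by blast
    then show ?thesis using pi_torsion_index[OF M S(1)] by blast
  qed
  then have "pi_torsion {p} S" by (simp add: pi_torsion_def)
  then show ?thesis using S(1-3) unfolding large_p_subgroup_def by blast
qed

end

section \<open>A normal intersection of a Sylow subgroup with an open subgroup\<close>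

context profinite
begin

text \<open>\<open>|N : N \<inter> P M| = |N P M : P M|\<close> divides \<open>|G : P M|\<close>.\<close>

lemma coprime_index_in_normal:
  assumes P: "subgroup P G" "coprime_index p P" and N: "N \<in> ONS" and M: "M \<in> ONS"
  shows "\<not> p dvd rel_index N (P <#> M)"
proof -
  let ?D = "P <#> M"
  note D = set_mult_ONS[OF P(1) M]
  note DN = set_mult_ONS[OF D(1) N]
  have "rel_index (carrier G) ?D = rel_index (carrier G) (?D <#> N) * rel_index (?D <#> N) ?D"
    by (rule rel_index_tower[OF D(1) DN(1) DN(2) D(5)]) (use subgroup.mem_carrier[OF DN(1)] in auto)
  moreover have "rel_index (?D <#> N) ?D = rel_index N ?D"
    using rel_index_set_mult[OF D(1) ONS_D(4)[OF N]] .
  moreover have "\<not> p dvd rel_index (carrier G) ?D" using P(2) M by (simp add: coprime_index_def)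
  ultimately show ?thesis by (metis dvd_mult)
qed

text \<open>\<open>|W M : W M \<inter> P M|\<close> is a power of \<open>p\<close> because \<open>W\<close> has \<open>p\<close>-power exponents modulo \<open>M\<close>; it divides
  \<open>|N : N \<inter> P M|\<close>, which is prime to \<open>p\<close>; so it is one.\<close>

lemma p_torsion_above_large:
  assumes p: "prime p" and P: "subgroup P G" "coprime_index p P"
    and N: "N \<in> ONS" and M: "M \<in> ONS" "M \<subseteq> N"
    and W: "subgroup W G" "P \<inter> N \<subseteq> W" "W \<subseteq> N"
    and tors: "\<forall>x\<in>W. \<exists>e. pi_number {p} e \<and> x [^] e \<in> M"
  shows "W \<subseteq> P <#> M"
proof -
  let ?D = "P <#> M" and ?V = "W <#> M"
  note D = set_mult_ONS[OF P(1) M(1)]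
  note V = set_mult_ONS[OF W(1) M(1)]
  note Vc = subgroup.subset[OF V(1)]
  have VN: "?V \<subseteq> N"
  proof
    fix x assume "x \<in> ?V"
    then obtain w m where "w \<in> W" "m \<in> M" "x = w \<otimes> m" by (auto simp: set_mult_iff)
    then show "x \<in> N" using W(3) M(2) subgroup.m_closed[OF ONS_D(2)[OF N]] by blast
  qed
  have DV: "?D \<inter> N \<subseteq> ?V"
  proof
    fix x assume x: "x \<in> ?D \<inter> N"
    then obtain a m where am: "a \<in> P" "m \<in> M" "x = a \<otimes> m" by (auto simp: set_mult_iff)
    have c: "a \<in> carrier G" "m \<in> carrier G" using am subgroup.mem_carrier[OF P(1)] ONS_D(4)[OF M(1)] by auto
    have "x \<otimes> inv m \<in> N" using x am M(2) subgroup.m_closed[OF ONS_D(2)[OF N]] subgroup.m_inv_closed[OF ONS_D(2)[OF N]] by blast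
    then have "a \<in> N" using am(3) c by (simp add: m_assoc)
    then show "x \<in> ?V" using am W(2) by (auto simp: set_mult_iff)
  qed
  have E: "subgroup (?V \<inter> ?D) G" using V(1) D(1) subgroups_Inter_pair by blast
  have EN: "?V \<inter> ?D = N \<inter> ?D" using VN DV by blast
  have ME: "M \<subseteq> ?V \<inter> ?D" using V(3) D(3) by blast
  have fE: "finite (rcosets (?V \<inter> ?D))"
    using finite_rcosets_mono[OF ONS_D(2)[OF M(1)] E ME ONS_finite_index[OF M(1)]] .
  let ?j = "rel_index ?V (?V \<inter> ?D)"
  have "pi_number {p} (rel_index W M)" using tors pi_torsion_index[OF M(1) W(1)] by blast
  moreover have "rel_index ?V M = rel_index W M"
    using V(6) rel_index_set_mult[OF ONS_D(2)[OF M(1)] subgroup.subset[OF W(1)]] by simp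
  moreover have "rel_index ?V M = ?j * rel_index (?V \<inter> ?D) M"
    by (rule rel_index_tower[OF ONS_D(2)[OF M(1)] E ME ONS_finite_index[OF M(1)] Vc])
      (use subgroup.m_closed[OF V(1)] in auto)
  ultimately have "pi_number {p} ?j" by (metis pi_number_mult)
  then obtain k where k: "?j = p ^ k" using pi_number_singleton[OF p] by blast
  have "rel_index N (?V \<inter> ?D) = rel_index N ?V * ?j"
    by (rule rel_index_tower[OF E V(1) _ fE ONS_D(4)[OF N]])
      (use VN subgroup.m_closed[OF ONS_D(2)[OF N]] in auto)
  moreover have "rel_index N (?V \<inter> ?D) = rel_index N ?D"
    using EN rel_index_Int[OF ONS_D(2)[OF N] D(1)] by simp
  ultimately have "\<not> p dvd ?j" using coprime_index_in_normal[OF P N M(1)] by (metis dvd_mult)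
  then have "?j = 1" using k by (cases k) auto
  then have "rel_index ?V ?D = 1" using rel_index_Int[OF V(1) D(1)] by simp
  then have "?V \<subseteq> ?D" using rel_index_eq_1[OF V(1) D(1)] by blast
  then show ?thesis using V(2) by blast
qed

text \<open>If \<open>P \<inter> N\<close> normalises \<open>V\<close>, their product is a pro-p subgroup above \<open>P \<inter> N\<close>, so by
  \<open>p_torsion_above_large\<close> it is not larger than \<open>P\<close> modulo any open normal subgroup.\<close>

lemma p_torsion_normalised_subset:
  assumes p: "prime p" and P: "large_p_subgroup p P" and N: "N \<in> ONS"
    and V: "subgroup V G" "V \<subseteq> N" "pi_torsion {p} V"
    and norm: "\<And>u v. u \<in> P \<inter> N \<Longrightarrow> v \<in> V \<Longrightarrow> u \<otimes> v \<otimes> inv u \<in> V"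
  shows "V \<subseteq> P"
proof
  fix x assume x: "x \<in> V"
  have P': "subgroup P G" "closedin T P" "pi_torsion {p} P" "coprime_index p P" using P by (auto simp: large_p_subgroup_def)
  have U: "subgroup (P \<inter> N) G" using P'(1) ONS_D(2)[OF N] subgroups_Inter_pair by blast
  have tU: "pi_torsion {p} (P \<inter> N)" using P'(3) by (auto simp: pi_torsion_def)
  let ?W = "(P \<inter> N) <#> V"
  have W: "subgroup ?W G" by (rule subgroup_set_mult_normalising[OF U V(1) norm])
  have tW: "pi_torsion {p} ?W" by (rule pi_torsion_set_mult[OF U tU V(1,3) norm])
  have WN: "?W \<subseteq> N"
  proof
    fix y assume "y \<in> ?W"
    then obtain a b where "a \<in> P \<inter> N" "b \<in> V" "y = a \<otimes> b" by (auto simp: set_mult_iff)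
    then show "y \<in> N" using V(2) subgroup.m_closed[OF ONS_D(2)[OF N]] by blast
  qed
  show "x \<in> P"
  proof (rule closed_eq_Inter_set_mult[OF P'(1,2)])
    fix M0 assume M0: "M0 \<in> ONS"
    let ?M = "M0 \<inter> N"
    have M: "?M \<in> ONS" using ONS_Int M0 N by blast
    have "?W \<subseteq> P <#> ?M"
      by (rule p_torsion_above_large[OF p P'(1,4) N M _ W subset_set_mult(1)[OF U V(1)] WN])
        (use tW M in \<open>auto simp: pi_torsion_def\<close>)
    also have "\<dots> \<subseteq> P <#> M0" by (intro mono_set_mult) auto
    finally show "x \<in> P <#> M0" using x subset_set_mult(2)[OF U V(1)] by blast
  qed
qed

lemma large_p_subgroup_sylow:
  assumes p: "prime p" and P: "large_p_subgroup p P"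
  shows "sylow_subgroup p G T P"
  unfolding sylow_subgroup_def
proof (intro conjI allI impI)
  have P': "subgroup P G" "closedin T P" "pi_torsion {p} P" "coprime_index p P" using P by (auto simp: large_p_subgroup_def)
  show "pro_p_subgroup p G T P" using P' by (simp add: pro_p_subgroup_iff[OF p])
  fix Q assume "pro_p_subgroup p G T Q \<and> P \<subseteq> Q"
  then have Q: "subgroup Q G" "pi_torsion {p} Q" "P \<subseteq> Q" by (auto simp: pro_p_subgroup_iff[OF p])
  have "Q \<subseteq> P"
  proof (rule p_torsion_normalised_subset[OF p P ONS_carrier Q(1) subgroup.subset[OF Q(1)] Q(2)])
    fix u v assume "u \<in> P \<inter> carrier G" "v \<in> Q"
    then show "u \<otimes> v \<otimes> inv u \<in> Q" using Q(3) subgroup.m_closed[OF Q(1)] subgroup.m_inv_closed[OF Q(1)] by blast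
  qed
  then show "Q = P" using Q(3) by blast
qed

lemma conj_set_Int_ONS:
  assumes "N \<in> ONS" "g \<in> carrier G" "A \<subseteq> carrier G"
  shows "conj_set g (A \<inter> N) = conj_set g A \<inter> N"
proof
  show "conj_set g (A \<inter> N) \<subseteq> conj_set g A \<inter> N" using ONS_conj[OF assms(1) _ assms(2)] by (auto simp: conj_set_def)
  show "conj_set g A \<inter> N \<subseteq> conj_set g (A \<inter> N)"
  proof
    fix x assume x: "x \<in> conj_set g A \<inter> N"
    then have xc: "x \<in> carrier G" using ONS_D(4)[OF assms(1)] by blast
    have "inv g \<otimes> x \<otimes> g \<in> A" using x conj_set_iff[OF assms(2,3) xc] by blast
    moreover have "inv g \<otimes> x \<otimes> g \<in> N" using ONS_conj[OF assms(1), of x "inv g"] x assms(2) by simp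
    ultimately show "x \<in> conj_set g (A \<inter> N)" using conj_set_iff[OF assms(2) _ xc, of "A \<inter> N"] assms(3) by blast
  qed
qed

lemma pi_torsion_conj_set:
  assumes "g \<in> carrier G" "A \<subseteq> carrier G" "pi_torsion \<pi> A" shows "pi_torsion \<pi> (conj_set g A)"
  unfolding pi_torsion_def
proof (intro ballI)
  fix M x assume M: "M \<in> ONS" and "x \<in> conj_set g A"
  then obtain a where a: "a \<in> A" "x = g \<otimes> a \<otimes> inv g" by (auto simp: conj_set_def)
  then obtain e where e: "pi_number \<pi> e" "a [^] e \<in> M" using assms(3) M by (auto simp: pi_torsion_def)
  have "x [^] e = g \<otimes> a [^] e \<otimes> inv g" using conj_nat_pow[OF assms(1)] a assms(2) by blast
  then show "\<exists>e. pi_number \<pi> e \<and> x [^] e \<in> M" using e ONS_conj[OF M e(2) assms(1)] by metis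
qed

lemma large_p_subgroup_conj_set:
  assumes g: "g \<in> carrier G" and P: "large_p_subgroup p P"
  shows "large_p_subgroup p (conj_set g P)"
proof -
  have P': "subgroup P G" "closedin T P" "pi_torsion {p} P" "coprime_index p P" using P by (auto simp: large_p_subgroup_def)
  have Pc: "P \<subseteq> carrier G" using subgroup.subset[OF P'(1)] .
  have s: "subgroup (conj_set g P) G" using subgroup_conj_set[OF g P'(1)] .
  have "conj_set g P = {x \<in> carrier G. inv g \<otimes> x \<otimes> g \<in> P}"
    using conj_set_iff[OF g Pc] subgroup.subset[OF s] by blast
  moreover have "continuous_map T T (\<lambda>x. inv g \<otimes> x \<otimes> g)" using g by (intro continuous_group) auto
  ultimately have cl: "closedin T (conj_set g P)" using closed_preimage P'(2) by simp
  have "coprime_index p (conj_set g P)"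
    unfolding coprime_index_def
  proof
    fix M assume M: "M \<in> ONS"
    let ?D = "P <#> M" and ?E = "conj_set g P <#> M"
    note D = set_mult_ONS[OF P'(1) M] and E = set_mult_ONS[OF s M]
    have EI: "x \<in> ?E \<longleftrightarrow> inv g \<otimes> x \<otimes> g \<in> ?D" if x: "x \<in> carrier G" for x
    proof
      assume "x \<in> ?E"
      then obtain a m where am: "a \<in> P" "m \<in> M" "x = (g \<otimes> a \<otimes> inv g) \<otimes> m" by (auto simp: set_mult_iff conj_set_def)
      have c: "a \<in> carrier G" "m \<in> carrier G" using am Pc ONS_D(4)[OF M] by auto
      have "inv g \<otimes> x \<otimes> g = a \<otimes> (inv g \<otimes> m \<otimes> g)" using am(3) c g by (simp add: m_assoc)
      moreover have "inv g \<otimes> m \<otimes> g \<in> M" using ONS_conj[OF M am(2), of "inv g"] g by simp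
      ultimately show "inv g \<otimes> x \<otimes> g \<in> ?D" using am(1) by (auto simp: set_mult_iff)
    next
      assume "inv g \<otimes> x \<otimes> g \<in> ?D"
      then obtain a m where am: "a \<in> P" "m \<in> M" "inv g \<otimes> x \<otimes> g = a \<otimes> m" by (auto simp: set_mult_iff)
      have c: "a \<in> carrier G" "m \<in> carrier G" using am Pc ONS_D(4)[OF M] by auto
      have "x = g \<otimes> (inv g \<otimes> x \<otimes> g) \<otimes> inv g" using x g by (simp add: m_assoc)
      also have "\<dots> = (g \<otimes> a \<otimes> inv g) \<otimes> (g \<otimes> m \<otimes> inv g)" unfolding am(3) using c g by (simp add: m_assoc)
      finally show "x \<in> ?E" using am ONS_conj[OF M am(2) g] unfolding set_mult_iff conj_set_def by blast
    qed
    have "rel_index (carrier G) ?E = card ((\<lambda>b. ?D #> (inv g \<otimes> b)) ` carrier G)"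
      unfolding rel_index_def
    proof (rule card_image_eq_if_same_kernel)
      fix x y assume c: "x \<in> carrier G" "y \<in> carrier G"
      have "inv g \<otimes> (x \<otimes> inv y) \<otimes> g = (inv g \<otimes> x) \<otimes> inv (inv g \<otimes> y)" using c g by (simp add: inv_mult_group m_assoc)
      then show "?E #> x = ?E #> y \<longleftrightarrow> ?D #> (inv g \<otimes> x) = ?D #> (inv g \<otimes> y)"
        using EI[of "x \<otimes> inv y"] r_coset_eq_iff[OF E(1) c] r_coset_eq_iff[OF D(1), of "inv g \<otimes> x" "inv g \<otimes> y"] c g by simp
    qed
    also have "\<dots> = card ((\<lambda>b. ?D #> b) ` ((\<lambda>b. inv g \<otimes> b) ` carrier G))" by (simp add: image_image)
    also have "(\<lambda>b. inv g \<otimes> b) ` carrier G = carrier G"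
    proof (intro equalityI subsetI)
      fix y assume "y \<in> carrier G"
      then have "y = inv g \<otimes> (g \<otimes> y)" "g \<otimes> y \<in> carrier G" using g by simp_all
      then show "y \<in> (\<lambda>b. inv g \<otimes> b) ` carrier G" by blast
    qed (use g in auto)
    finally have "rel_index (carrier G) ?E = rel_index (carrier G) ?D" by (simp add: rel_index_def)
    then show "\<not> p dvd rel_index (carrier G) ?E" using P'(4) M by (simp add: coprime_index_def)
  qed
  then show ?thesis using s cl pi_torsion_conj_set[OF g Pc P'(3)] by (simp add: large_p_subgroup_def)
qed

lemma conj_set_conj_set:
  assumes "g \<in> carrier G" "h \<in> carrier G" "A \<subseteq> carrier G"
  shows "conj_set g (conj_set h A) = conj_set (g \<otimes> h) A"
proof -
  have "g \<otimes> (h \<otimes> a \<otimes> inv h) \<otimes> inv g = (g \<otimes> h) \<otimes> a \<otimes> inv (g \<otimes> h)" if "a \<in> A" for a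
    using assms that by (auto simp: inv_mult_group m_assoc subset_iff)
  then show ?thesis by (simp add: conj_set_def image_image cong: image_cong)
qed

text \<open>Let \<open>U = P \<inter> N\<close>. For \<open>h \<in> g\<^sub>0 N\<close>, \<open>U\<close> and its conjugate by \<open>h\<close> normalise each other, so each contains the
  other. Hence \<open>N\<close> normalises \<open>U\<close>, and any conjugate of \<open>U\<close> is a pro-p subgroup of \<open>N\<close> normalised by \<open>U\<close>.\<close>

lemma normal_if_commuting_coset:
  assumes p: "prime p" and P: "large_p_subgroup p P" and N: "N \<in> ONS" and g0: "g0 \<in> carrier G"
    and comm: "\<And>n a b. n \<in> N \<Longrightarrow> a \<in> P \<inter> N \<Longrightarrow> b \<in> conj_set (g0 \<otimes> n) (P \<inter> N) \<Longrightarrow> a \<otimes> b = b \<otimes> a"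
    and g: "g \<in> carrier G"
  shows "conj_set g (P \<inter> N) \<subseteq> P"
proof -
  let ?U = "P \<inter> N"
  have P': "subgroup P G" "pi_torsion {p} P" using P by (auto simp: large_p_subgroup_def)
  have Nc: "N \<subseteq> carrier G" using ONS_D(4)[OF N] .
  have Pc: "P \<subseteq> carrier G" using subgroup.subset[OF P'(1)] .
  have sU: "subgroup ?U G" using P'(1) ONS_D(2)[OF N] subgroups_Inter_pair by blast
  have Uc: "?U \<subseteq> carrier G" using Pc by blast
  have tU: "pi_torsion {p} ?U" using P'(2) by (auto simp: pi_torsion_def)
  have eqU: "conj_set (g0 \<otimes> n) ?U = ?U" if n: "n \<in> N" for n
  proof -
    let ?h = "g0 \<otimes> n"
    let ?V = "conj_set ?h ?U"
    have h: "?h \<in> carrier G" using g0 n Nc by auto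
    have sV: "subgroup ?V G" using subgroup_conj_set[OF h sU] .
    have Vc: "?V \<subseteq> carrier G" using subgroup.subset[OF sV] .
    have V_eq: "?V = conj_set ?h P \<inter> N" using conj_set_Int_ONS[OF N h Pc] .
    have tV: "pi_torsion {p} ?V" using pi_torsion_conj_set[OF h Uc tU] .
    have fix1: "a \<otimes> b \<otimes> inv a = b" if "a \<in> ?U" "b \<in> ?V" for a b
    proof -
      have c: "a \<in> carrier G" "b \<in> carrier G" using that Uc Vc by blast+
      show ?thesis unfolding comm[OF n that] using c by (simp add: m_assoc)
    qed
    have fix2: "b \<otimes> a \<otimes> inv b = a" if "a \<in> ?U" "b \<in> ?V" for a b
    proof -
      have c: "a \<in> carrier G" "b \<in> carrier G" using that Uc Vc by blast+
      show ?thesis unfolding comm[OF n that, symmetric] using c by (simp add: m_assoc)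
    qed
    have "?V \<subseteq> P"
      by (rule p_torsion_normalised_subset[OF p P N sV _ tV]) (use V_eq fix1 in auto)
    moreover have "?U \<subseteq> conj_set ?h P"
    proof (rule p_torsion_normalised_subset[OF p large_p_subgroup_conj_set[OF h P] N sU _ tU])
      fix u v assume "u \<in> conj_set ?h P \<inter> N" "v \<in> ?U"
      then show "u \<otimes> v \<otimes> inv u \<in> ?U" using fix2[of v u] V_eq by simp
    qed blast
    ultimately show ?thesis using V_eq by blast
  qed
  have e1: "conj_set g0 ?U = ?U" using eqU[OF ONS_D(5)[OF N]] g0 by simp
  have invU: "conj_set (inv g0) ?U = ?U"
  proof -
    have "conj_set (inv g0) (conj_set g0 ?U) = conj_set \<one> ?U" using conj_set_conj_set[of "inv g0" g0 ?U] g0 Uc by simp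
    also have "\<dots> = ?U" using Uc by (force simp: conj_set_def image_iff)
    finally show ?thesis using e1 by simp
  qed
  have nU: "conj_set n ?U = ?U" if n: "n \<in> N" for n
  proof -
    have nc: "n \<in> carrier G" using n Nc by blast
    have "conj_set n ?U = conj_set (inv g0) (conj_set (g0 \<otimes> n) ?U)"
      using conj_set_conj_set[of "inv g0" "g0 \<otimes> n" ?U] g0 nc Uc by simp
    then show ?thesis using eqU[OF n] invU by simp
  qed
  let ?V = "conj_set g ?U"
  have sV: "subgroup ?V G" using subgroup_conj_set[OF g sU] .
  have VN: "?V \<subseteq> N" using conj_set_Int_ONS[OF N g Pc] by blast
  have tV: "pi_torsion {p} ?V" using pi_torsion_conj_set[OF g Uc tU] .
  show "?V \<subseteq> P"
  proof (rule p_torsion_normalised_subset[OF p P N sV VN tV])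
    fix u v assume u: "u \<in> ?U" and "v \<in> ?V"
    then obtain a where a: "a \<in> ?U" "v = g \<otimes> a \<otimes> inv g" by (auto simp: conj_set_def)
    have c: "u \<in> carrier G" "a \<in> carrier G" using u a Uc by auto
    let ?n = "inv g \<otimes> u \<otimes> g"
    have n: "?n \<in> N" using ONS_conj[OF N, of u "inv g"] u g by simp
    have "?n \<otimes> a \<otimes> inv ?n \<in> ?U" using nU[OF n] a(1) unfolding conj_set_def by blast
    moreover have "u \<otimes> v \<otimes> inv u = g \<otimes> (?n \<otimes> a \<otimes> inv ?n) \<otimes> inv g"
      using a(2) c g by (simp add: inv_mult_group m_assoc)
    ultimately show "u \<otimes> v \<otimes> inv u \<in> ?V" unfolding conj_set_def by blast
  qed
qed

text \<open>Otherwise \<open>normal_if_commuting_coset\<close> lets us choose nested cosets \<open>g\<^sub>i N\<^sub>i\<close> such that \<open>P \<inter> N\<^sub>i\<close> and its conjugate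
  by \<open>g\<^sub>i\<^sub>+\<^sub>1\<close> do not commute modulo \<open>N\<^sub>i\<^sub>+\<^sub>1\<close>. Let \<open>x\<close> lie in all these cosets and let \<open>P \<inter> M\<close> commute with its
  conjugate by \<open>x\<close>. By compactness \<open>P \<inter> N\<^sub>j\<close> is contained in \<open>K (P \<inter> M)\<close> for some \<open>j\<close>, where \<open>K\<close> is the
  intersection of \<open>P\<close> with all \<open>N\<^sub>i\<close>. As \<open>K \<subseteq> N\<^sub>j\<^sub>+\<^sub>1\<close>, the subgroup \<open>P \<inter> N\<^sub>j\<close> would commute with its conjugate
  by \<open>g\<^sub>j\<^sub>+\<^sub>1\<close> modulo \<open>N\<^sub>j\<^sub>+\<^sub>1\<close>.\<close>

theorem open_normal_Int_large_normal:
  assumes p: "prime p" and P: "large_p_subgroup p P"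
    and comm: "\<And>g. g \<in> carrier G \<Longrightarrow> \<exists>M\<in>ONS. \<forall>a\<in>P \<inter> M. \<forall>b\<in>conj_set g P \<inter> M. a \<otimes> b = b \<otimes> a"
  shows "\<exists>N\<in>ONS. \<forall>g\<in>carrier G. conj_set g (P \<inter> N) \<subseteq> P"
proof (rule ccontr)
  assume neg: "\<not> (\<exists>N\<in>ONS. \<forall>g\<in>carrier G. conj_set g (P \<inter> N) \<subseteq> P)"
  have P': "subgroup P G" "closedin T P" using P by (auto simp: large_p_subgroup_def)
  have Pc: "P \<subseteq> carrier G" using subgroup.subset[OF P'(1)] .
  define ok where "ok = (\<lambda>s. fst s \<in> carrier G \<and> snd s \<in> ONS)"
  define nx where "nx = (\<lambda>s s'. (\<exists>n\<in>snd s. fst s' = fst s \<otimes> n) \<and> snd s' \<subseteq> snd s \<and>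
     (\<exists>a\<in>P \<inter> snd s. \<exists>b\<in>P \<inter> snd s. commutator a (fst s' \<otimes> b \<otimes> inv (fst s')) \<notin> snd s'))"
  have step: "\<exists>s'. ok s' \<and> nx s s'" if oks: "ok s" for s
  proof -
    obtain g N where s: "s = (g, N)" by force
    have g: "g \<in> carrier G" and N: "N \<in> ONS" using oks s by (auto simp: ok_def)
    have Nc: "N \<subseteq> carrier G" using ONS_D(4)[OF N] .
    obtain n a b where nab: "n \<in> N" "a \<in> P \<inter> N" "b \<in> conj_set (g \<otimes> n) (P \<inter> N)" "a \<otimes> b \<noteq> b \<otimes> a"
      using normal_if_commuting_coset[OF p P N g] neg N by blast
    obtain b' where b': "b' \<in> P \<inter> N" "b = (g \<otimes> n) \<otimes> b' \<otimes> inv (g \<otimes> n)" using nab(3) by (auto simp: conj_set_def)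
    have c: "a \<in> carrier G" "b' \<in> carrier G" "n \<in> carrier G" using nab b' Nc by auto
    then have bc: "b \<in> carrier G" using b' g by simp
    have "commutator a b \<noteq> \<one>" using commutator_eq_one[OF c(1) bc] nab(4) by blast
    moreover have cc: "commutator a b \<in> carrier G" using c bc by (simp add: commutator_def)
    ultimately obtain M where M: "M \<in> ONS" "M \<inter> {commutator a b} \<subseteq> {\<one>}"
      using ONS_avoid_finite[of "{commutator a b}"] by auto
    then have "commutator a b \<notin> M \<inter> N" using \<open>commutator a b \<noteq> \<one>\<close> by blast
    then have "nx s (g \<otimes> n, M \<inter> N)" using nab b' unfolding s nx_def by auto
    moreover have "ok (g \<otimes> n, M \<inter> N)" using g c ONS_Int[OF M(1) N] by (simp add: ok_def)
    ultimately show ?thesis by blast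
  qed
  have "\<exists>f. \<forall>i. ok (f i) \<and> nx (f i) (f (Suc i))"
  proof (rule dependent_nat_choice)
    show "\<exists>s. ok s" using ONS_carrier one_closed by (intro exI[of _ "(\<one>, carrier G)"]) (simp add: ok_def)
    show "\<exists>s'. ok s' \<and> nx s s'" if "ok s" for s using step[OF that] .
  qed
  then obtain f where f: "\<And>i. ok (f i)" "\<And>i. nx (f i) (f (Suc i))" by blast
  define g N where "g = (\<lambda>i. fst (f i))" and "N = (\<lambda>i. snd (f i))"
  have gN: "g i \<in> carrier G" "N i \<in> ONS" for i
    using f(1)[of i] by (simp_all add: g_def N_def ok_def)
  have nx: "\<exists>n\<in>N i. g (Suc i) = g i \<otimes> n" "N (Suc i) \<subseteq> N i"
     "\<exists>a\<in>P \<inter> N i. \<exists>b\<in>P \<inter> N i. commutator a (g (Suc i) \<otimes> b \<otimes> inv (g (Suc i))) \<notin> N (Suc i)" for i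
    using f(2)[of i] by (simp_all add: g_def N_def nx_def)
  have decN: "N j \<subseteq> N i" if "i \<le> j" for i j using that nx(2) by (rule lift_Suc_antimono_le[rotated])
  have Nc: "N i \<subseteq> carrier G" for i using ONS_D(4)[OF gN(2)] .
  have Ncl: "closedin T (N i)" for i using open_subgroup_closed[OF ONS_D(2,3)[OF gN(2)]] .
  have "(\<Inter>i. g i <# N i) \<noteq> {}"
  proof (rule compact_space_imp_nest[OF compact])
    show "closedin T (g i <# N i)" for i using closed_translate[OF Ncl gN(1)] .
    show "g i <# N i \<noteq> {}" for i using ONS_D(5)[OF gN(2)] by (auto simp: l_coset_def)
    show "decseq (\<lambda>i. g i <# N i)"
    proof (rule decseq_SucI)
      fix i show "g (Suc i) <# N (Suc i) \<le> g i <# N i"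
      proof
        fix x assume "x \<in> g (Suc i) <# N (Suc i)"
        then obtain m where m: "m \<in> N (Suc i)" "x = g (Suc i) \<otimes> m" by (auto simp: l_coset_def)
        obtain n where n: "n \<in> N i" "g (Suc i) = g i \<otimes> n" using nx(1) by blast
        have "m \<in> N i" using m nx(2) by blast
        then have "n \<otimes> m \<in> N i" "x = g i \<otimes> (n \<otimes> m)"
          using n m subgroup.m_closed[OF ONS_D(2)[OF gN(2)]] gN(1)[of i] Nc by (auto simp: m_assoc subset_iff)
        then show "x \<in> g i <# N i" by (auto simp: l_coset_def)
      qed
    qed
  qed
  then obtain x where x: "\<And>i. x \<in> g i <# N i" by blast
  have xc: "x \<in> carrier G" using x[of 0] gN(1)[of 0] Nc[of 0] by (auto simp: l_coset_def subset_iff)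
  obtain M where M: "M \<in> ONS" "\<And>a b. a \<in> P \<inter> M \<Longrightarrow> b \<in> conj_set x P \<inter> M \<Longrightarrow> a \<otimes> b = b \<otimes> a"
    using comm[OF xc] by blast
  define K where "K = P \<inter> (\<Inter>i. N i)"
  have sK: "subgroup K G"
  proof -
    have "subgroup (\<Inter>i. N i) G" using subgroups_Inter[of "range N"] ONS_D(2)[OF gN(2)] by auto
    then show ?thesis unfolding K_def using P'(1) subgroups_Inter_pair by blast
  qed
  note KM = set_mult_ONS[OF sK M(1)]
  \<comment> \<open>\<open>K M\<close> is an open set that contains the intersection of all \<open>P \<inter> N\<^sub>i\<close>\<close>
  have "\<exists>C\<in>range (\<lambda>i. P \<inter> N i). C \<subseteq> K <#> M"
  proof (rule directed_closed_subset_open[OF compact])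
    show "closedin T C" if "C \<in> range (\<lambda>i. P \<inter> N i)" for C using that P'(2) Ncl by auto
    show "\<exists>C\<in>range (\<lambda>i. P \<inter> N i). C \<subseteq> A \<inter> B" if AB: "A \<in> range (\<lambda>i. P \<inter> N i)" "B \<in> range (\<lambda>i. P \<inter> N i)" for A B
    proof -
      obtain i j where "A = P \<inter> N i" "B = P \<inter> N j" using AB by blast
      then have "P \<inter> N (max i j) \<subseteq> A \<inter> B" using decN[of i "max i j"] decN[of j "max i j"] by auto
      then show ?thesis by blast
    qed
    have "\<Inter>(range (\<lambda>i. P \<inter> N i)) \<subseteq> K" by (auto simp: K_def)
    then show "\<Inter>(range (\<lambda>i. P \<inter> N i)) \<subseteq> K <#> M" using KM(2) by blast
  qed (use KM in auto)
  then obtain j where j: "P \<inter> N j \<subseteq> K <#> M" by blast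
  obtain a b where ab: "a \<in> P \<inter> N j" "b \<in> P \<inter> N j" "commutator a (g (Suc j) \<otimes> b \<otimes> inv (g (Suc j))) \<notin> N (Suc j)"
    using nx(3) by blast
  let ?N = "N (Suc j)" and ?g = "g (Suc j)"
  note N = gN(2)[of "Suc j"] and gc = gN(1)[of "Suc j"]
  note nN = ONS_D(1)[OF N] and sN = ONS_D(2)[OF N]
  \<comment> \<open>modulo \<open>N\<^sub>j\<^sub>+\<^sub>1\<close> the elements of \<open>P \<inter> N\<^sub>j\<close> are represented in \<open>P \<inter> M\<close>\<close>
  have approx: "\<exists>c\<in>P \<inter> M. ?N #> y = ?N #> c" if y: "y \<in> P \<inter> N j" for y
  proof -
    obtain k c where kc: "k \<in> K" "c \<in> M" "y = k \<otimes> c" using j y by (auto simp: set_mult_iff dest!: subsetD)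
    have kP: "k \<in> P" "k \<in> ?N" using kc by (auto simp: K_def)
    have cc: "k \<in> carrier G" "c \<in> carrier G" using kP kc ONS_D(4)[OF M(1)] Pc by auto
    have "c = inv k \<otimes> y" using kc(3) cc by simp
    then have "c \<in> P" using kP y subgroup.m_closed[OF P'(1)] subgroup.m_inv_closed[OF P'(1)] by blast
    moreover have "?N #> y = ?N #> c"
      using r_coset_eq_iff[OF sN, of y c] kc(3) cc kP(2) by (simp add: m_assoc)
    ultimately show ?thesis using kc by blast
  qed
  obtain c where c: "c \<in> P \<inter> M" "?N #> a = ?N #> c" using approx[OF ab(1)] by blast
  obtain d where d: "d \<in> P \<inter> M" "?N #> b = ?N #> d" using approx[OF ab(2)] by blast
  have car: "a \<in> carrier G" "b \<in> carrier G" "c \<in> carrier G" "d \<in> carrier G" using ab c d Pc by auto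
  obtain m where m: "m \<in> ?N" "x = ?g \<otimes> m" using x[of "Suc j"] by (auto simp: l_coset_def)
  have mc: "m \<in> carrier G" using m Nc by blast
  have "?N #> ?g = ?N #> x"
  proof -
    have "?g \<otimes> inv x = ?g \<otimes> inv m \<otimes> inv ?g" using m(2) mc gc by (simp add: inv_mult_group m_assoc)
    also have "\<dots> \<in> ?N" using ONS_conj[OF N _ gc] m(1) subgroup.m_inv_closed[OF sN] by blast
    finally show ?thesis using r_coset_eq_iff[OF sN gc xc] by blast
  qed
  then have "?N #> (?g \<otimes> b \<otimes> inv ?g) = ?N #> (x \<otimes> d \<otimes> inv x)"
    using nN gc xc car d(2) by (intro rcos_mult_cong rcos_inv_cong) auto
  then have "?N #> commutator a (?g \<otimes> b \<otimes> inv ?g) = ?N #> commutator c (x \<otimes> d \<otimes> inv x)"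
    using nN gc xc car c(2) by (intro commutator_cong) auto
  moreover have "commutator c (x \<otimes> d \<otimes> inv x) = \<one>"
  proof -
    have "x \<otimes> d \<otimes> inv x \<in> conj_set x P \<inter> M"
      using d(1) ONS_conj[OF M(1) _ xc] by (auto simp: conj_set_def)
    then show ?thesis using M(2)[OF c(1)] commutator_eq_one car xc by simp
  qed
  ultimately have "?N #> commutator a (?g \<otimes> b \<otimes> inv ?g) = ?N #> \<one>" by simp
  moreover have "commutator a (?g \<otimes> b \<otimes> inv ?g) \<in> carrier G" using car gc by (simp add: commutator_def)
  ultimately have "commutator a (?g \<otimes> b \<otimes> inv ?g) \<in> ?N"
    using r_coset_eq_iff[OF sN _ one_closed] by simp
  then show False using ab(3) by blast
qed

end

section \<open>Openness of the preimage of the largest normal pro-p' subgroup\<close>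

context group
begin

lemma subgroup_FactGroup_preimage:
  assumes R: "R \<lhd> G" and Y: "subgroup Y (G Mod R)"
  shows "subgroup {x \<in> carrier G. R #> x \<in> Y} G"
proof (rule subgroupI)
  interpret R: normal R G by fact
  show "{x \<in> carrier G. R #> x \<in> Y} \<subseteq> carrier G" by blast
  have "R \<in> Y" using subgroup.one_closed[OF Y] by (simp add: FactGroup_def)
  then have "\<one> \<in> {x \<in> carrier G. R #> x \<in> Y}" using coset_mult_one[OF R.subset] by simp
  then show "{x \<in> carrier G. R #> x \<in> Y} \<noteq> {}" by blast
  fix x assume "x \<in> {x \<in> carrier G. R #> x \<in> Y}"
  then have x: "x \<in> carrier G" "R #> x \<in> Y" by auto
  have "inv\<^bsub>G Mod R\<^esub> (R #> x) = R #> inv x"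
    using R.inv_FactGroup[of "R #> x"] R.rcos_inv[OF x(1)] subgroup.mem_carrier[OF Y x(2)] by simp
  then show "inv x \<in> {x \<in> carrier G. R #> x \<in> Y}" using subgroup.m_inv_closed[OF Y x(2)] x(1) by simp
  fix y assume "y \<in> {x \<in> carrier G. R #> x \<in> Y}"
  then have y: "y \<in> carrier G" "R #> y \<in> Y" by auto
  have "(R #> x) \<otimes>\<^bsub>G Mod R\<^esub> (R #> y) = R #> (x \<otimes> y)" using R.rcos_sum[OF x(1) y(1)] by simp
  then show "x \<otimes> y \<in> {x \<in> carrier G. R #> x \<in> Y}" using subgroup.m_closed[OF Y x(2) y(2)] x(1) y(1) by simp
qed

lemma normal_FactGroup_preimage:
  assumes R: "R \<lhd> G" and Y: "Y \<lhd> G Mod R"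
  shows "{x \<in> carrier G. R #> x \<in> Y} \<lhd> G"
proof -
  interpret R: normal R G by fact
  have "x \<otimes> h \<otimes> inv x \<in> {x \<in> carrier G. R #> x \<in> Y}" if x: "x \<in> carrier G" and h: "h \<in> carrier G" "R #> h \<in> Y" for x h
  proof -
    have xc: "R #> x \<in> carrier (G Mod R)" using x by (auto simp: FactGroup_def rcosets_image)
    have "inv\<^bsub>G Mod R\<^esub> (R #> x) = R #> inv x" using R.inv_FactGroup[OF xc] R.rcos_inv[OF x] by simp
    then have "(R #> x) \<otimes>\<^bsub>G Mod R\<^esub> (R #> h) \<otimes>\<^bsub>G Mod R\<^esub> inv\<^bsub>G Mod R\<^esub> (R #> x) = R #> (x \<otimes> h \<otimes> inv x)"
      using x h(1) by (simp add: R.rcos_sum)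
    then show ?thesis using normal.inv_op_closed2[OF Y xc h(2)] x h(1) by simp
  qed
  then show ?thesis
    using subgroup_FactGroup_preimage[OF R normal_imp_subgroup[OF Y]] by (simp add: normal_inv_iff)
qed

lemma normal_FactGroup_image:
  assumes R: "R \<lhd> G" and N: "N \<lhd> G"
  shows "(\<lambda>x. R #> x) ` N \<lhd> G Mod R"
proof (rule normal.surj_hom_normal_subgroup[OF N])
  interpret R: normal R G by fact
  show "group_hom G (G Mod R) (\<lambda>x. R #> x)"
    using R.r_coset_hom_Mod R.factorgroup_is_group is_group by (simp add: group_hom_def group_hom_axioms_def)
  show "(\<lambda>x. R #> x) ` carrier G = carrier (G Mod R)" by (auto simp: FactGroup_def rcosets_image)
qed

end

context profinite
begin

text \<open>The exponents of elements of \<open>N\<close> modulo an open normal \<open>L\<close> with \<open>P \<inter> N \<subseteq> O\<^sub>p(G) \<subseteq> L\<close> are prime to \<open>p\<close>, since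
  \<open>|N : N \<inter> L|\<close> is the index in \<open>N\<close> of \<open>(P \<inter> N) (L \<inter> N)\<close>.\<close>

lemma O_pp'_open:
  assumes p: "prime p" and P: "large_p_subgroup p P" and N: "N \<in> ONS"
    and norm: "\<And>g. g \<in> carrier G \<Longrightarrow> conj_set g (P \<inter> N) \<subseteq> P"
  shows "openin T (O_pp' p G T)"
proof -
  define R where "R = pi_radical {p}"
  have P': "subgroup P G" "pi_torsion {p} P" "coprime_index p P" using P by (auto simp: large_p_subgroup_def)
  have sU: "subgroup (P \<inter> N) G" using P'(1) ONS_D(2)[OF N] subgroups_Inter_pair by blast
  have "x \<otimes> h \<otimes> inv x \<in> P \<inter> N" if "x \<in> carrier G" "h \<in> P \<inter> N" for x h
  proof -
    have "x \<otimes> h \<otimes> inv x \<in> conj_set x (P \<inter> N)" using that(2) by (auto simp: conj_set_def)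
    then show ?thesis using norm[OF that(1)] ONS_conj[OF N _ that(1)] that(2) by blast
  qed
  then have "P \<inter> N \<lhd> G" using sU by (simp add: normal_inv_iff)
  moreover have "pi_torsion {p} (P \<inter> N)" using P'(2) by (auto simp: pi_torsion_def)
  ultimately have UR: "P \<inter> N \<subseteq> R" unfolding R_def by (rule pi_radical_greatest)
  have R: "R \<lhd> G" "closedin T R" unfolding R_def using pi_radical_normal pi_radical_closed by auto
  interpret R: normal R G by (rule R(1))
  let ?S = "coset_topology G T R"
  interpret Q: profinite "G Mod R" ?S
    using quotient_profinite[OF R] R.factorgroup_is_group by (simp add: profinite_def profinite_axioms_def)
  have cm: "continuous_map T ?S (\<lambda>x. R #> x)"
    using quotient_imp_continuous_map[OF quotient_map_coset_topology[OF top_group R(1)]] .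
  have "Q.pi_torsion (- {p}) ((\<lambda>x. R #> x) ` N)"
    unfolding Q.pi_torsion_def
  proof (intro ballI)
    fix Y X assume Y: "Y \<in> open_normal_subgroups (G Mod R) ?S" and "X \<in> (\<lambda>x. R #> x) ` N"
    then obtain x where x: "x \<in> N" "X = R #> x" by blast
    have xc: "x \<in> carrier G" using x ONS_D(4)[OF N] by blast
    define L where "L = {y \<in> carrier G. R #> y \<in> Y}"
    have "openin T L" unfolding L_def using openin_continuous_map_preimage[OF cm Q.ONS_D(3)[OF Y]] by simp
    then have L: "L \<in> ONS"
      using normal_FactGroup_preimage[OF R(1) Q.ONS_D(1)[OF Y]] by (simp add: open_normal_subgroups_def L_def)
    have RL: "R \<subseteq> L"
    proof
      fix r assume r: "r \<in> R"
      then have "R #> r = R" using R.rcos_const[OF is_group] by simp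
      then show "r \<in> L" using Q.ONS_D(5)[OF Y] r R.mem_carrier by (simp add: L_def FactGroup_def)
    qed
    let ?M = "L \<inter> N"
    have M: "?M \<in> ONS" using ONS_Int L N by blast
    have "N \<inter> (P <#> ?M) = ?M"
    proof
      show "?M \<subseteq> N \<inter> (P <#> ?M)" using set_mult_ONS(3)[OF P'(1) M] by blast
      show "N \<inter> (P <#> ?M) \<subseteq> ?M"
      proof
        fix y assume y: "y \<in> N \<inter> (P <#> ?M)"
        then obtain a m where am: "a \<in> P" "m \<in> ?M" "y = a \<otimes> m" by (auto simp: set_mult_iff)
        have c: "a \<in> carrier G" "m \<in> carrier G" using am subgroup.mem_carrier[OF P'(1)] ONS_D(4)[OF M] by auto
        have "y \<otimes> inv m \<in> N" using y am subgroup.m_closed[OF ONS_D(2)[OF N]] subgroup.m_inv_closed[OF ONS_D(2)[OF N]] by blast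
        then have "a \<in> N" using am(3) c by (simp add: m_assoc)
        then have "a \<in> ?M" using am(1) UR RL by blast
        then show "y \<in> ?M" using am subgroup.m_closed[OF ONS_D(2)[OF M]] by blast
      qed
    qed
    then have "rel_index N (P <#> ?M) = rel_index N ?M"
      using rel_index_Int[OF ONS_D(2)[OF N] set_mult_ONS(1)[OF P'(1) M]] by simp
    then have "pi_number (- {p}) (rel_index N ?M)"
      using coprime_index_in_normal[OF P'(1,3) N M] pi_number_compl[OF p] by simp
    then obtain e where e: "pi_number (- {p}) e" "x [^] e \<in> ?M"
      using pi_torsion_index[OF M ONS_D(2)[OF N]] x(1) by blast
    have "X [^]\<^bsub>G Mod R\<^esub> e = R #> (x [^] e)"
      using Mod_nat_pow[of R "carrier G" x e] R(1) subgroup_self xc x(2) by simp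
    then have "X [^]\<^bsub>G Mod R\<^esub> e \<in> Y" using e(2) by (simp add: L_def)
    then show "\<exists>e. pi_number (- {p}) e \<and> X [^]\<^bsub>G Mod R\<^esub> e \<in> Y" using e(1) by blast
  qed
  then have sub: "(\<lambda>x. R #> x) ` N \<subseteq> Q.pi_radical (- {p})"
    using Q.pi_radical_greatest normal_FactGroup_image[OF R(1) ONS_D(1)[OF N]] by blast
  have eq: "O_pp' p G T = {x \<in> carrier G. R #> x \<in> Q.pi_radical (- {p})}"
    by (simp add: O_pp'_def O_p_eq[OF p] Q.O_p'_eq[OF p] R_def[symmetric])
  have "subgroup (O_pp' p G T) G"
    unfolding eq using subgroup_FactGroup_preimage[OF R(1) normal_imp_subgroup[OF Q.pi_radical_normal]] .
  moreover have "N \<subseteq> O_pp' p G T" unfolding eq using sub ONS_D(4)[OF N] by blast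
  ultimately show ?thesis using open_subgroup[OF _ N] by blast
qed

text \<open>A normal pro-p subgroup is normalised by \<open>P\<close>, so it lies in \<open>P\<close>.\<close>

lemma O_p_virtually_abelian:
  assumes p: "prime p" and P: "large_p_subgroup p P" and M: "M \<in> ONS"
    and comm: "\<And>h k. h \<in> P \<inter> M \<Longrightarrow> k \<in> P \<inter> M \<Longrightarrow> h \<otimes> k = k \<otimes> h"
  shows "virtually_abelian (G\<lparr>carrier := O_p p G T\<rparr>) (subtopology T (O_p p G T))"
proof -
  define R where "R = pi_radical {p}"
  have R: "R \<lhd> G" "pi_torsion {p} R" unfolding R_def using pi_radical_normal pi_radical_torsion by auto
  note sR = normal_imp_subgroup[OF R(1)]
  have RP: "R \<subseteq> P"
    by (rule p_torsion_normalised_subset[OF p P ONS_carrier sR subgroup.subset[OF sR] R(2)])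
      (use normal.inv_op_closed2[OF R(1)] in blast)
  let ?A = "R \<inter> M"
  have sA: "subgroup ?A G" using sR ONS_D(2)[OF M] subgroups_Inter_pair by blast
  have "subgroup ?A (G\<lparr>carrier := R\<rparr>)" using subgroup_incl[OF sA sR] by blast
  moreover have "openin (subtopology T R) ?A" using ONS_D(3)[OF M] by (simp add: openin_subtopology_Int2)
  moreover have "comm_group (G\<lparr>carrier := ?A\<rparr>)"
    by (rule group.group_comm_groupI[OF subgroup_imp_group[OF sA]]) (use comm RP in auto)
  then have "comm_group (G\<lparr>carrier := R, carrier := ?A\<rparr>)" by simp
  ultimately show ?thesis unfolding virtually_abelian_def O_p_eq[OF p] R_def[symmetric] by blast
qed

end

theorem theorem1p7:
  fixes G :: "('a, 'b) monoid_scheme" and T :: "'a topology" and p :: nat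
  assumes "profinite_group G T"
    and "p \<in> prime_divisors_of_order G T"
    and "\<And>P1 P2. sylow_subgroup p G T P1 \<Longrightarrow> sylow_subgroup p G T P2 \<Longrightarrow> commuting_prob G T P1 P2 > 0"
  shows "openin T (O_pp' p G T) \<and>
         virtually_abelian (G\<lparr>carrier := O_p p G T\<rparr>) (subtopology T (O_p p G T))"
proof -
  interpret profinite G T
    using assms(1) by (simp add: profinite_def profinite_axioms_def profinite_group_def topological_group_def)
  have p: "prime p" using assms(2) by (simp add: prime_divisors_of_order_def)
  obtain P where P: "large_p_subgroup p P" using large_p_subgroup_exists[OF p] by blast
  have comm: "\<exists>M\<in>open_normal_subgroups G T. \<forall>h\<in>H \<inter> M. \<forall>k\<in>K \<inter> M. h \<otimes>\<^bsub>G\<^esub> k = k \<otimes>\<^bsub>G\<^esub> h"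
    if "large_p_subgroup p H" "large_p_subgroup p K" for H K
    using that assms(3) large_p_subgroup_sylow[OF p]
    by (intro commuting_open_subgroups) (auto simp: large_p_subgroup_def)
  obtain N where "N \<in> open_normal_subgroups G T" "\<And>g. g \<in> carrier G \<Longrightarrow> conj_set g (P \<inter> N) \<subseteq> P"
    using open_normal_Int_large_normal[OF p P] comm[OF P large_p_subgroup_conj_set[OF _ P]] by blast
  moreover obtain M where "M \<in> open_normal_subgroups G T" "\<And>h k. h \<in> P \<inter> M \<Longrightarrow> k \<in> P \<inter> M \<Longrightarrow> h \<otimes>\<^bsub>G\<^esub> k = k \<otimes>\<^bsub>G\<^esub> h"
    using comm[OF P P] by blast
  ultimately show ?thesis using O_pp'_open[OF p P] O_p_virtually_abelian[OF p P] by blast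
qed

end
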